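(* Let $n>1$ be an integer, let $K$ be a field, and let $R_n$ be the cyclotomic KLR algebra over $K$ defined in the context. Then $$\dim_K R_n=\binom{2(n-1)}{n-1}.$$
   Context: Let $K$ be a field and $n>1$ an integer. The quiver $A_n^{(1)}$ (in this paper's indexing) has vertices $\{0,1,\dots,n-1\}$ and arrows $i\to i+1$ for $0\le i\le n-2$ together with $n-1\to 0$. (For $n=2$ there is an arrow in each direction between $0$ and $1$.) Let $I_n$ be the set of all permutations ${\bf i}=(i_1,\dots,i_n)$ of $(0,1,\dots,n-1)$. For $1\le k\le n-1$, $s_k\cdot{\bf i}$ is ${\bf i}$ with the entries $i_k,i_{k+1}$ interchanged. For vertices $i\ne j$: $i\not\leftrightarrow j$ means there is no arrow between them; $i\to j$ means there is an arrow from $i$ to $j$ only; $i\leftarrow j$ means there is an arrow from $j$ to $i$ only; $i\leftrightarrow j$ means there are arrows both ways. The KLR algebra $R_n(\alpha)$ (for $\alpha=\sum_{i}\alpha_i$, the sum over all vertices) is the unital associative $K$-algebra with generators ${\bf e}({\bf i})$ (${\bf i}\in I_n$), $y_1,\dots,y_n$, $\psi_1,\dots,\psi_{n-1}$ and relations, for all indices and ${\bf i},{\bf j}\in I_n$ for which they make sense: ${\bf e}({\bf i}){\bf e}({\bf j})=\delta_{{\bf i},{\bf j}}{\bf e}({\bf i})$; $\sum_{{\bf i}\in I_n}{\bf e}({\bf i})=1$; $y_k{\bf e}({\bf i})={\bf e}({\bf i})y_k$; $\psi_k{\bf e}({\bf i})={\bf e}(s_k\cdot{\bf i})\psi_k$;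 $y_ky_l=y_ly_k$; $\psi_ky_l=y_l\psi_k$ for $l\ne k,k+1$; $\psi_k\psi_l=\psi_l\psi_k$ for $|k-l|>1$; $\psi_ky_{k+1}{\bf e}({\bf i})=y_k\psi_k{\bf e}({\bf i})$; $y_{k+1}\psi_k{\bf e}({\bf i})=\psi_ky_k{\bf e}({\bf i})$; $\psi_k\psi_{k+1}\psi_k{\bf e}({\bf i})=\psi_{k+1}\psi_k\psi_{k+1}{\bf e}({\bf i})$; and $\psi_k^2{\bf e}({\bf i})$ equals ${\bf e}({\bf i})$ if $i_k\not\leftrightarrow i_{k+1}$; $(y_{k+1}-y_k){\bf e}({\bf i})$ if $i_k\to i_{k+1}$; $(y_k-y_{k+1}){\bf e}({\bf i})$ if $i_k\leftarrow i_{k+1}$; $(y_{k+1}-y_k)(y_k-y_{k+1}){\bf e}({\bf i})$ if $i_k\leftrightarrow i_{k+1}$. The cyclotomic ideal $I^{\Lambda}$ (for $\Lambda=\Lambda_0$) is the two-sided ideal of $R_n(\alpha)$ generated by $\{y_1{\bf e}({\bf i}) : {\bf i}\in I_n,\ i_1=0\}\cup\{{\bf e}({\bf i}) : {\bf i}\in I_n,\ i_1\ne 0\}$, and $R_n=R_n(\alpha)/I^{\Lambda}$. The images of the generators in $R_n$ are denoted by the same symbols. *)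

theory Defs
  imports
    "Jordan_Normal_Form.VS_Connect"
    "HOL-Algebra.QuotRing"
    "HOL-Combinatorics.Multiset_Permutations"
    "HOL-Library.Poly_Mapping"
begin

hide_const (open) Multiset.mult Polynomial.smult Modules.module

section \<open>Unital associative algebras over a field\<close>

text \<open>
  The library locale \<^locale>\<open>algebra\<close> is restricted to commutative algebras.
  An algebra is a \<^typ>\<open>('k, 'a) module\<close> record, so that the notions for vector spaces,
  rings and two-sided ideals (\<^const>\<open>ideal\<close>, \<^const>\<open>genideal\<close>, \<^const>\<open>FactRing\<close>)
  all apply to it.
\<close>

locale assoc_algebra = vectorspace K A + ring A for K (structure) and A (structure) +
  assumes smult_mult_left:
    "\<lbrakk>c \<in> carrier K; x \<in> carrier A; y \<in> carrier A\<rbrakk>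
      \<Longrightarrow> (c \<odot>\<^bsub>A\<^esub> x) \<otimes>\<^bsub>A\<^esub> y = c \<odot>\<^bsub>A\<^esub> (x \<otimes>\<^bsub>A\<^esub> y)"
    and smult_mult_right:
    "\<lbrakk>c \<in> carrier K; x \<in> carrier A; y \<in> carrier A\<rbrakk>
      \<Longrightarrow> x \<otimes>\<^bsub>A\<^esub> (c \<odot>\<^bsub>A\<^esub> y) = c \<odot>\<^bsub>A\<^esub> (x \<otimes>\<^bsub>A\<^esub> y)"

text \<open>
  The scalar multiplication on cosets follows the pattern of \<^const>\<open>rcoset_mult\<close>;
  it satisfies \<open>c \<odot> (I +> x) = I +> (c \<odot> x)\<close>, see \<open>quot_algebra_smult\<close> below.
\<close>

definition quot_algebra :: "('k, 'a, 'm) module_scheme \<Rightarrow> 'a set \<Rightarrow> ('k, 'a set) module" where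
  "quot_algebra A I =
    \<lparr>carrier = carrier (A Quot I), mult = mult (A Quot I), one = one (A Quot I),
     zero = zero (A Quot I), add = add (A Quot I),
     smult = (\<lambda>c X. \<Union>x\<in>X. I +>\<^bsub>A\<^esub> (c \<odot>\<^bsub>A\<^esub> x))\<rparr>"


section \<open>Free algebras\<close>

text \<open>
  The free algebra is the monoid algebra of the free monoid. Finitely supported functions
  carry the convolution product when the index type is a \<^class>\<open>monoid_add\<close>, so
  concatenation of words is written additively.
\<close>

datatype 'g free_mon = Wrd (letters: "'g list")

instantiation free_mon :: (type) monoid_add
begin

definition zero_free_mon :: "'a free_mon" where
  "0 = Wrd []"

definition plus_free_mon :: "'a free_mon \<Rightarrow> 'a free_mon \<Rightarrow> 'a free_mon" where
  "u + v = Wrd (letters u @ letters v)"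

instance
  by standard (simp_all add: zero_free_mon_def plus_free_mon_def)

end

type_synonym ('k, 'g) ncpoly = "'g free_mon \<Rightarrow>\<^sub>0 'k"

definition gen :: "'g \<Rightarrow> ('k :: field, 'g) ncpoly" where
  "gen g = Poly_Mapping.single (Wrd [g]) 1"

text \<open>The free algebra on a set of generators that need not exhaust its type.\<close>

definition free_algebra :: "'g set \<Rightarrow> ('k :: field, ('k, 'g) ncpoly) module" where
  "free_algebra X =
    \<lparr>carrier = {f. \<forall>w \<in> Poly_Mapping.keys f. set (letters w) \<subseteq> X},
     mult = (*), one = 1, zero = 0, add = (+),
     smult = (\<lambda>c f. Poly_Mapping.single 0 c * f)\<rparr>"


section \<open>The cyclic quiver\<close>

definition arrow :: "nat \<Rightarrow> nat \<Rightarrow> nat \<Rightarrow> bool" where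
  "arrow n a b \<longleftrightarrow> (a + 2 \<le> n \<and> b = a + 1) \<or> (a = n - 1 \<and> b = 0)"

text \<open>
  A sequence \<open>(i\<^sub>1, \<dots>, i\<^sub>n)\<close> is a list; positions are counted from 1
  as in the presentation of the algebra, while lists are indexed from 0.
\<close>

definition seqs :: "nat \<Rightarrow> nat list set" where
  "seqs n = permutations_of_set {0..<n}"

definition entry :: "nat list \<Rightarrow> nat \<Rightarrow> nat" where
  "entry i k = i ! (k - 1)"

definition swap_entries :: "nat \<Rightarrow> nat list \<Rightarrow> nat list" where
  "swap_entries k i = i[k - 1 := entry i (k + 1), k := entry i k]"


section \<open>The KLR algebra and its cyclotomic quotient\<close>

datatype klr_gen = Gen_e "nat list" | Gen_y nat | Gen_psi nat

definition klr_gens :: "nat \<Rightarrow> klr_gen set" where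
  "klr_gens n = Gen_e ` seqs n \<union> Gen_y ` {1..n} \<union> Gen_psi ` {1..n - 1}"

abbreviation (input) klr_free :: "nat \<Rightarrow> ('k :: field, ('k, klr_gen) ncpoly) module" where
  "klr_free n \<equiv> free_algebra (klr_gens n)"

abbreviation klr_e :: "nat list \<Rightarrow> ('k :: field, klr_gen) ncpoly" where
  "klr_e i \<equiv> gen (Gen_e i)"

abbreviation klr_y :: "nat \<Rightarrow> ('k :: field, klr_gen) ncpoly" where
  "klr_y k \<equiv> gen (Gen_y k)"

abbreviation klr_psi :: "nat \<Rightarrow> ('k :: field, klr_gen) ncpoly" where
  "klr_psi k \<equiv> gen (Gen_psi k)"

text \<open>\<open>klr_rel n l r\<close> means that \<open>l = r\<close> is one of the defining relations.\<close>

inductive klr_rel :: "nat \<Rightarrow> ('k :: field, klr_gen) ncpoly \<Rightarrow> ('k, klr_gen) ncpoly \<Rightarrow> bool"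
  for n :: nat where
  idem_mult: "\<lbrakk>i \<in> seqs n; j \<in> seqs n\<rbrakk>
    \<Longrightarrow> klr_rel n (klr_e i * klr_e j) (if i = j then klr_e i else 0)"
| idem_sum: "klr_rel n (\<Sum>i\<in>seqs n. klr_e i) 1"
| dot_idem: "\<lbrakk>k \<in> {1..n}; i \<in> seqs n\<rbrakk>
    \<Longrightarrow> klr_rel n (klr_y k * klr_e i) (klr_e i * klr_y k)"
| psi_idem: "\<lbrakk>k \<in> {1..n - 1}; i \<in> seqs n\<rbrakk>
    \<Longrightarrow> klr_rel n (klr_psi k * klr_e i) (klr_e (swap_entries k i) * klr_psi k)"
| dot_dot: "\<lbrakk>k \<in> {1..n}; l \<in> {1..n}\<rbrakk>
    \<Longrightarrow> klr_rel n (klr_y k * klr_y l) (klr_y l * klr_y k)"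
| psi_dot_far: "\<lbrakk>k \<in> {1..n - 1}; l \<in> {1..n}; l \<noteq> k; l \<noteq> k + 1\<rbrakk>
    \<Longrightarrow> klr_rel n (klr_psi k * klr_y l) (klr_y l * klr_psi k)"
| psi_psi_far: "\<lbrakk>k \<in> {1..n - 1}; l \<in> {1..n - 1}; k + 1 < l \<or> l + 1 < k\<rbrakk>
    \<Longrightarrow> klr_rel n (klr_psi k * klr_psi l) (klr_psi l * klr_psi k)"
| psi_dot: "\<lbrakk>k \<in> {1..n - 1}; i \<in> seqs n\<rbrakk>
    \<Longrightarrow> klr_rel n (klr_psi k * klr_y (k + 1) * klr_e i) (klr_y k * klr_psi k * klr_e i)"
| dot_psi: "\<lbrakk>k \<in> {1..n - 1}; i \<in> seqs n\<rbrakk>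
    \<Longrightarrow> klr_rel n (klr_y (k + 1) * klr_psi k * klr_e i) (klr_psi k * klr_y k * klr_e i)"
| braid: "\<lbrakk>k \<in> {1..n - 1}; k + 1 \<in> {1..n - 1}; i \<in> seqs n\<rbrakk>
    \<Longrightarrow> klr_rel n (klr_psi k * klr_psi (k + 1) * klr_psi k * klr_e i)
                (klr_psi (k + 1) * klr_psi k * klr_psi (k + 1) * klr_e i)"
| psi_sq_none: "\<lbrakk>k \<in> {1..n - 1}; i \<in> seqs n;
      \<not> arrow n (entry i k) (entry i (k + 1)); \<not> arrow n (entry i (k + 1)) (entry i k)\<rbrakk>
    \<Longrightarrow> klr_rel n (klr_psi k * klr_psi k * klr_e i) (klr_e i)"
| psi_sq_right: "\<lbrakk>k \<in> {1..n - 1}; i \<in> seqs n;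
      arrow n (entry i k) (entry i (k + 1)); \<not> arrow n (entry i (k + 1)) (entry i k)\<rbrakk>
    \<Longrightarrow> klr_rel n (klr_psi k * klr_psi k * klr_e i) ((klr_y (k + 1) - klr_y k) * klr_e i)"
| psi_sq_left: "\<lbrakk>k \<in> {1..n - 1}; i \<in> seqs n;
      \<not> arrow n (entry i k) (entry i (k + 1)); arrow n (entry i (k + 1)) (entry i k)\<rbrakk>
    \<Longrightarrow> klr_rel n (klr_psi k * klr_psi k * klr_e i) ((klr_y k - klr_y (k + 1)) * klr_e i)"
| psi_sq_both: "\<lbrakk>k \<in> {1..n - 1}; i \<in> seqs n;
      arrow n (entry i k) (entry i (k + 1)); arrow n (entry i (k + 1)) (entry i k)\<rbrakk>
    \<Longrightarrow> klr_rel n (klr_psi k * klr_psi k * klr_e i)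
                ((klr_y (k + 1) - klr_y k) * (klr_y k - klr_y (k + 1)) * klr_e i)"

definition klr_ideal :: "nat \<Rightarrow> ('k :: field, klr_gen) ncpoly set" where
  "klr_ideal n = Idl\<^bsub>klr_free n\<^esub> {l - r | l r. klr_rel n l r}"

definition klr_algebra :: "nat \<Rightarrow> ('k :: field, ('k, klr_gen) ncpoly set) module" where
  "klr_algebra n = quot_algebra (klr_free n) (klr_ideal n)"

definition klr_class :: "nat \<Rightarrow> ('k :: field, klr_gen) ncpoly \<Rightarrow> ('k, klr_gen) ncpoly set" where
  "klr_class n x = klr_ideal n +>\<^bsub>klr_free n\<^esub> x"

definition cyclotomic_ideal :: "nat \<Rightarrow> ('k :: field, klr_gen) ncpoly set set" where
  "cyclotomic_ideal n = Idl\<^bsub>klr_algebra n\<^esub>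
    ({klr_class n (klr_y 1 * klr_e i) | i. i \<in> seqs n \<and> entry i 1 = 0} \<union>
     {klr_class n (klr_e i) | i. i \<in> seqs n \<and> entry i 1 \<noteq> 0})"

definition cyclotomic_klr_algebra ::
    "nat \<Rightarrow> ('k :: field, ('k, klr_gen) ncpoly set set) module" where
  "cyclotomic_klr_algebra n = quot_algebra (klr_algebra n) (cyclotomic_ideal n)"


section \<open>Well-definedness\<close>

lemma quot_algebra_sel [simp]:
  "carrier (quot_algebra A I) = a_rcosets\<^bsub>A\<^esub> I"
  "mult (quot_algebra A I) = rcoset_mult A I"
  "one (quot_algebra A I) = I +>\<^bsub>A\<^esub> \<one>\<^bsub>A\<^esub>"
  "zero (quot_algebra A I) = I"
  "add (quot_algebra A I) = set_add A"
  "smult (quot_algebra A I) = (\<lambda>c X. \<Union>x\<in>X. I +>\<^bsub>A\<^esub> (c \<odot>\<^bsub>A\<^esub> x))"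
  by (simp_all add: quot_algebra_def FactRing_def)

lemma (in assoc_algebra) smult_ideal:
  assumes "ideal I A" "c \<in> carrier K" "x \<in> I"
  shows "c \<odot>\<^bsub>A\<^esub> x \<in> I"
proof -
  interpret ideal I A by fact
  have x: "x \<in> carrier A" using assms by (simp add: a_Hcarr)
  have "(c \<odot>\<^bsub>A\<^esub> \<one>\<^bsub>A\<^esub>) \<otimes>\<^bsub>A\<^esub> x \<in> I"
    using assms by (intro I_l_closed) auto
  then show ?thesis using assms x by (simp add: smult_mult_left)
qed

lemma (in assoc_algebra) quot_algebra_smult:
  assumes "ideal I A" "c \<in> carrier K" "x \<in> carrier A"
  shows "c \<odot>\<^bsub>quot_algebra A I\<^esub> (I +>\<^bsub>A\<^esub> x) = I +>\<^bsub>A\<^esub> (c \<odot>\<^bsub>A\<^esub> x)"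
proof -
  interpret I: ideal I A by fact
  have "I +>\<^bsub>A\<^esub> (c \<odot>\<^bsub>A\<^esub> z) = I +>\<^bsub>A\<^esub> (c \<odot>\<^bsub>A\<^esub> x)" if "z \<in> I +>\<^bsub>A\<^esub> x" for z
  proof -
    from that obtain h where h: "h \<in> I" "z = h \<oplus>\<^bsub>A\<^esub> x"
      by (auto simp: a_r_coset_def r_coset_def)
    have "c \<odot>\<^bsub>A\<^esub> z = (c \<odot>\<^bsub>A\<^esub> h) \<oplus>\<^bsub>A\<^esub> (c \<odot>\<^bsub>A\<^esub> x)"
      using h assms I.a_Hcarr by (simp add: smult_r_distr)
    then have "c \<odot>\<^bsub>A\<^esub> z \<in> I +>\<^bsub>A\<^esub> (c \<odot>\<^bsub>A\<^esub> x)"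
      using smult_ideal[OF assms(1,2) h(1)] by (auto simp: a_r_coset_def r_coset_def)
    then show ?thesis
      using assms by (metis I.a_repr_independence' smult_closed)
  qed
  moreover have "I +>\<^bsub>A\<^esub> x \<noteq> {}"
    using I.a_rcos_self[OF assms(3)] by (rule ex_in_conv[THEN iffD1, OF exI])
  ultimately show ?thesis
    unfolding quot_algebra_sel by (intro SUP_eq_const)
qed

lemma (in assoc_algebra) assoc_algebra_quot:
  assumes "ideal I A"
  shows "assoc_algebra K (quot_algebra A I)"
proof -
  interpret I: ideal I A by fact
  let ?Q = "quot_algebra A I"
  have FQ: "ring (A Quot I)" by (rule I.quotient_is_ring)
  interpret FQ: ring "A Quot I" by (rule FQ)
  have ring: "ring ?Q"
  proof (rule ringI)
    show "abelian_group ?Q"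
    proof (rule abelian_groupI)
      fix X assume "X \<in> carrier ?Q"
      then show "\<exists>Y\<in>carrier ?Q. Y \<oplus>\<^bsub>?Q\<^esub> X = \<zero>\<^bsub>?Q\<^esub>"
        using FQ.l_neg[of X] FQ.a_inv_closed[of X] by (auto simp: FactRing_def)
    qed (use FQ.a_closed FQ.a_assoc FQ.a_comm FQ.zero_closed FQ.l_zero in
          \<open>auto simp: FactRing_def\<close>)
    show "Group.monoid ?Q"
      using FQ.m_closed FQ.m_assoc FQ.one_closed FQ.l_one FQ.r_one
      by (intro monoidI) (auto simp: FactRing_def)
  qed (use FQ.l_distr FQ.r_distr in \<open>auto simp: FactRing_def\<close>)
  interpret Q: ring ?Q by (rule ring)
  have carrier: "X \<in> carrier ?Q \<longleftrightarrow> (\<exists>x\<in>carrier A. X = I +>\<^bsub>A\<^esub> x)" for X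
    by (auto simp: A_RCOSETS_defs a_r_coset_def)
  note sm = quot_algebra_smult[OF assms]
  have ad: "(I +>\<^bsub>A\<^esub> x) \<oplus>\<^bsub>?Q\<^esub> (I +>\<^bsub>A\<^esub> y) = I +>\<^bsub>A\<^esub> (x \<oplus>\<^bsub>A\<^esub> y)"
    if "x \<in> carrier A" "y \<in> carrier A" for x y
    using that by (simp add: I.a_rcos_sum)
  have mu: "(I +>\<^bsub>A\<^esub> x) \<otimes>\<^bsub>?Q\<^esub> (I +>\<^bsub>A\<^esub> y) = I +>\<^bsub>A\<^esub> (x \<otimes>\<^bsub>A\<^esub> y)"
    if "x \<in> carrier A" "y \<in> carrier A" for x y
    using that by (simp add: I.rcoset_mult_add)
  have "Module.module K ?Q"
  proof (rule moduleI)
    show "cring K" by (rule R.is_cring)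
    show "abelian_group ?Q" by (rule Q.abelian_group_axioms)
  next
    fix c X assume "c \<in> carrier K" "X \<in> carrier ?Q"
    then show "c \<odot>\<^bsub>?Q\<^esub> X \<in> carrier ?Q"
      unfolding carrier by (metis sm smult_closed)
  next
    fix c d X assume "c \<in> carrier K" "d \<in> carrier K" "X \<in> carrier ?Q"
    then show "(c \<oplus>\<^bsub>K\<^esub> d) \<odot>\<^bsub>?Q\<^esub> X = (c \<odot>\<^bsub>?Q\<^esub> X) \<oplus>\<^bsub>?Q\<^esub> (d \<odot>\<^bsub>?Q\<^esub> X)"
      unfolding carrier by (metis sm ad smult_closed smult_l_distr R.add.m_closed)
  next
    fix c X Y assume "c \<in> carrier K" "X \<in> carrier ?Q" "Y \<in> carrier ?Q"
    then show "c \<odot>\<^bsub>?Q\<^esub> (X \<oplus>\<^bsub>?Q\<^esub> Y) = (c \<odot>\<^bsub>?Q\<^esub> X) \<oplus>\<^bsub>?Q\<^esub> (c \<odot>\<^bsub>?Q\<^esub> Y)"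
      unfolding carrier by (metis sm ad smult_closed smult_r_distr M.add.m_closed)
  next
    fix c d X assume "c \<in> carrier K" "d \<in> carrier K" "X \<in> carrier ?Q"
    then show "(c \<otimes>\<^bsub>K\<^esub> d) \<odot>\<^bsub>?Q\<^esub> X = c \<odot>\<^bsub>?Q\<^esub> (d \<odot>\<^bsub>?Q\<^esub> X)"
      unfolding carrier by (metis sm smult_closed smult_assoc1 R.m_closed)
  next
    fix X assume "X \<in> carrier ?Q"
    then show "\<one>\<^bsub>K\<^esub> \<odot>\<^bsub>?Q\<^esub> X = X"
      unfolding carrier by (metis sm smult_one R.one_closed)
  qed
  moreover have "(c \<odot>\<^bsub>?Q\<^esub> X) \<otimes>\<^bsub>?Q\<^esub> Y = c \<odot>\<^bsub>?Q\<^esub> (X \<otimes>\<^bsub>?Q\<^esub> Y)"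
    "X \<otimes>\<^bsub>?Q\<^esub> (c \<odot>\<^bsub>?Q\<^esub> Y) = c \<odot>\<^bsub>?Q\<^esub> (X \<otimes>\<^bsub>?Q\<^esub> Y)"
    if "c \<in> carrier K" "X \<in> carrier ?Q" "Y \<in> carrier ?Q" for c X Y
  proof -
    from that(2) obtain x where x: "x \<in> carrier A" "X = I +>\<^bsub>A\<^esub> x"
      unfolding carrier by (rule bexE)
    from that(3) obtain y where y: "y \<in> carrier A" "Y = I +>\<^bsub>A\<^esub> y"
      unfolding carrier by (rule bexE)
    note xy = x y
    have "x \<otimes>\<^bsub>A\<^esub> y \<in> carrier A" "c \<odot>\<^bsub>A\<^esub> x \<in> carrier A" "c \<odot>\<^bsub>A\<^esub> y \<in> carrier A"
      using xy that by (simp_all add: smult_closed)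
    then show "(c \<odot>\<^bsub>?Q\<^esub> X) \<otimes>\<^bsub>?Q\<^esub> Y = c \<odot>\<^bsub>?Q\<^esub> (X \<otimes>\<^bsub>?Q\<^esub> Y)"
      "X \<otimes>\<^bsub>?Q\<^esub> (c \<odot>\<^bsub>?Q\<^esub> Y) = c \<odot>\<^bsub>?Q\<^esub> (X \<otimes>\<^bsub>?Q\<^esub> Y)"
      using xy that by (simp_all only: sm mu smult_mult_left smult_mult_right)
  qed
  ultimately show ?thesis
    using ring field_axioms
    by (intro assoc_algebra.intro vectorspace.intro assoc_algebra_axioms.intro)
qed

lemma free_algebra_sel [simp]:
  "f \<in> carrier (free_algebra X) \<longleftrightarrow> (\<forall>w \<in> Poly_Mapping.keys f. set (letters w) \<subseteq> X)"
  "mult (free_algebra X) = (*)"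
  "one (free_algebra X) = 1"
  "zero (free_algebra X) = 0"
  "add (free_algebra X) = (+)"
  "smult (free_algebra X) = (\<lambda>c f. Poly_Mapping.single 0 c * f)"
  by (simp_all add: free_algebra_def)

lemma free_algebra_closed:
  fixes f g :: "('k :: field, 'g) ncpoly"
  shows "0 \<in> carrier (free_algebra X)" "1 \<in> carrier (free_algebra X)"
    "Poly_Mapping.single 0 c \<in> carrier (free_algebra X)"
    "f \<in> carrier (free_algebra X) \<Longrightarrow> - f \<in> carrier (free_algebra X)"
    "\<lbrakk>f \<in> carrier (free_algebra X); g \<in> carrier (free_algebra X)\<rbrakk>
      \<Longrightarrow> f + g \<in> carrier (free_algebra X)"
    "\<lbrakk>f \<in> carrier (free_algebra X); g \<in> carrier (free_algebra X)\<rbrakk>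
      \<Longrightarrow> f - g \<in> carrier (free_algebra X)"
    "\<lbrakk>f \<in> carrier (free_algebra X); g \<in> carrier (free_algebra X)\<rbrakk>
      \<Longrightarrow> f * g \<in> carrier (free_algebra X)"
    "x \<in> X \<Longrightarrow> gen x \<in> carrier (free_algebra X)"
proof -
  show "0 \<in> carrier (free_algebra X)" "1 \<in> carrier (free_algebra X)"
    "Poly_Mapping.single 0 c \<in> carrier (free_algebra X)"
    "x \<in> X \<Longrightarrow> gen x \<in> carrier (free_algebra X)"
    by (auto simp: gen_def zero_free_mon_def)
  show neg: "f \<in> carrier (free_algebra X) \<Longrightarrow> - f \<in> carrier (free_algebra X)" for f
    by simp
  show add: "\<lbrakk>f \<in> carrier (free_algebra X); g \<in> carrier (free_algebra X)\<rbrakk>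
      \<Longrightarrow> f + g \<in> carrier (free_algebra X)" for f g
    using Poly_Mapping.keys_add[of f g] by fastforce
  show "\<lbrakk>f \<in> carrier (free_algebra X); g \<in> carrier (free_algebra X)\<rbrakk>
      \<Longrightarrow> f - g \<in> carrier (free_algebra X)"
    using add[of f "- g"] neg[of g] by simp
  show "\<lbrakk>f \<in> carrier (free_algebra X); g \<in> carrier (free_algebra X)\<rbrakk>
      \<Longrightarrow> f * g \<in> carrier (free_algebra X)"
    using keys_mult[of f g] by (fastforce simp: plus_free_mon_def)
qed

lemma single_zero_commute:
  fixes f :: "('k :: field, 'g) ncpoly"
  shows "Poly_Mapping.single 0 c * f = f * Poly_Mapping.single 0 c"
proof (induction f rule: update_induct)
  case const
  show ?case by simp
next
  case (update f k v)
  have "Poly_Mapping.update k v f = Poly_Mapping.single k v + f"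
    using update.hyps
    by (intro poly_mapping_eqI) (auto simp: lookup_update lookup_add lookup_single when_def in_keys_iff)
  with update.IH show ?case
    by (simp add: distrib_left distrib_right mult_single mult.commute)
qed

lemma assoc_algebra_free:
  "assoc_algebra (class_ring :: 'k ring) (free_algebra X :: ('k :: field, ('k, 'g) ncpoly) module)"
proof -
  let ?F = "free_algebra X :: ('k, ('k, 'g) ncpoly) module"
  note closed = free_algebra_closed[where X = X]
  have ring: "ring ?F"
  proof (rule ringI)
    show "abelian_group ?F"
    proof (rule abelian_groupI)
      fix f assume "f \<in> carrier ?F"
      then show "\<exists>g\<in>carrier ?F. g \<oplus>\<^bsub>?F\<^esub> f = \<zero>\<^bsub>?F\<^esub>"
        using closed(4) by (intro bexI[of _ "- f"]) auto
    qed (use closed in \<open>simp_all del: free_algebra_sel(1) add: add.assoc add.commute\<close>)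
    show "Group.monoid ?F"
      using closed by (intro monoidI) (simp_all del: free_algebra_sel(1) add: mult.assoc)
  qed (simp_all add: distrib_left distrib_right)
  have "Module.module (class_ring :: 'k ring) ?F"
  proof (rule moduleI)
    show "cring (class_ring :: 'k ring)"
      by (rule class_cring.is_cring)
    show "abelian_group ?F"
      using ring by (rule ring.is_abelian_group)
  next
    fix c f assume "f \<in> carrier ?F"
    then show "c \<odot>\<^bsub>?F\<^esub> f \<in> carrier ?F"
      using closed(7)[OF closed(3)] by simp
  qed (simp_all add: distrib_left distrib_right single_add mult_single flip: mult.assoc)
  moreover have "field (class_ring :: 'k ring)"
    by (rule class_field.field_axioms)
  moreover have "f * (Poly_Mapping.single 0 c * g) = Poly_Mapping.single 0 c * (f * g)"
    for c and f g :: "('k, 'g) ncpoly"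
    by (metis mult.assoc single_zero_commute)
  ultimately show ?thesis
    using ring
    by (intro assoc_algebra.intro vectorspace.intro assoc_algebra_axioms.intro)
      (simp_all only: free_algebra_sel mult.assoc)
qed

lemma swap_entries_seqs:
  assumes "i \<in> seqs n" "k \<in> {1..n - 1}"
  shows "swap_entries k i \<in> seqs n"
proof -
  have i: "set i = {0..<n}" "distinct i"
    using assms by (auto simp: seqs_def permutations_of_set_def)
  then have "length i = n" using distinct_card by fastforce
  then have "k - 1 < length i" "k < length i" using assms by auto
  then show ?thesis
    using i by (simp add: seqs_def permutations_of_set_def swap_entries_def entry_def)
qed

lemma klr_rel_closed:
  assumes "klr_rel n l r"
  shows "l \<in> carrier (klr_free n)" "r \<in> carrier (klr_free n)"
proof -
  let ?F = "klr_free n :: ('a, ('a, klr_gen) ncpoly) module"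
  note closed = free_algebra_closed[where X = "klr_gens n"]
  have e: "klr_e i \<in> carrier ?F" if "i \<in> seqs n" for i
    using that by (intro closed) (auto simp: klr_gens_def)
  have y: "klr_y k \<in> carrier ?F" if "k \<in> {1..n}" for k
    using that by (intro closed) (auto simp: klr_gens_def)
  have psi: "klr_psi k \<in> carrier ?F" if "k \<in> {1..n - 1}" for k
    using that by (intro closed) (auto simp: klr_gens_def)
  have sum: "(\<Sum>i\<in>S. klr_e i) \<in> carrier ?F" if "S \<subseteq> seqs n" for S
    using that by (induction S rule: infinite_finite_induct)
      (auto simp del: free_algebra_sel(1) intro!: closed e)
  note [simp del] = free_algebra_sel(1)
  from assms show "l \<in> carrier ?F"
    by cases (auto intro!: closed e y psi sum)
  from assms show "r \<in> carrier ?F"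
    by cases (auto intro!: closed e y psi sum swap_entries_seqs)
qed

lemma ideal_klr_ideal: "ideal (klr_ideal n :: ('k :: field, klr_gen) ncpoly set) (klr_free n)"
proof -
  interpret F: assoc_algebra "class_ring :: 'k ring"
    "klr_free n :: ('k, ('k, klr_gen) ncpoly) module"
    by (rule assoc_algebra_free)
  show ?thesis
    unfolding klr_ideal_def
    using klr_rel_closed free_algebra_closed(6) by (intro F.genideal_ideal) blast
qed

lemma assoc_algebra_klr:
  "assoc_algebra (class_ring :: 'k ring) (klr_algebra n :: ('k :: field, _) module)"
  unfolding klr_algebra_def
  by (rule assoc_algebra.assoc_algebra_quot[OF assoc_algebra_free ideal_klr_ideal])

lemma klr_class_closed:
  fixes x :: "('k :: field, klr_gen) ncpoly"
  assumes "x \<in> carrier (klr_free n)"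
  shows "klr_class n x \<in> carrier (klr_algebra n)"
proof -
  interpret ideal "klr_ideal n :: ('k, klr_gen) ncpoly set" "klr_free n"
    by (rule ideal_klr_ideal)
  show ?thesis
    unfolding klr_class_def klr_algebra_def quot_algebra_sel
    by (rule a_rcosetsI[OF a_subset assms])
qed

lemma ideal_cyclotomic_ideal:
  assumes "n > 0"
  shows "ideal (cyclotomic_ideal n :: ('k :: field, klr_gen) ncpoly set set) (klr_algebra n)"
proof -
  interpret R: assoc_algebra "class_ring :: 'k ring"
    "klr_algebra n :: ('k, ('k, klr_gen) ncpoly set) module"
    by (rule assoc_algebra_klr)
  have "klr_e i \<in> carrier (klr_free n)" if "i \<in> seqs n" for i
    using that by (intro free_algebra_closed) (auto simp: klr_gens_def)
  moreover have "klr_y 1 \<in> carrier (klr_free n)"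
    using assms by (intro free_algebra_closed) (auto simp: klr_gens_def)
  ultimately show ?thesis
    unfolding cyclotomic_ideal_def
    by (intro R.genideal_ideal) (auto simp del: free_algebra_sel(1)
        intro!: klr_class_closed free_algebra_closed(7))
qed

theorem assoc_algebra_cyclotomic_klr:
  assumes "n > 0"
  shows "assoc_algebra (class_ring :: 'k ring) (cyclotomic_klr_algebra n :: ('k :: field, _) module)"
  unfolding cyclotomic_klr_algebra_def
  by (rule assoc_algebra.assoc_algebra_quot[OF assoc_algebra_klr ideal_cyclotomic_ideal[OF assms]])

end

theory Submission
  imports Defs
begin

text \<open>
  In the cyclotomic quotient an idempotent \<open>e(i)\<close> vanishes unless \<open>i\<close> starts at 0 and
  visits the cycle by extending an arc to the left or to the right, because an entry without
  neighbours among its predecessors can be moved to the front. Such \<open>i\<close> correspond to words of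
  length \<open>n - 2\<close> in two letters, the last vertex being forced. One finds \<open>y\<^sub>k = 0\<close> for \<open>k < n\<close>,
  the inner \<open>\<psi>\<^sub>k\<close> exchange distinct neighbouring letters, \<open>\<psi>\<close> at the last position flips the
  last letter, and its square is \<open>y\<^sub>n\<close> up to sign, with \<open>y\<^sub>n\<^sup>2 = 0\<close> and no nonzero products of
  higher degree. Hence \<open>R\<^sub>n\<close> is spanned by elements indexed by pairs of words of length \<open>n - 1\<close>
  with the same number of letters of each kind (pairs of standard tableaux of a hook). A
  representation by monomial matrices, in which these elements act linearly independently, shows
  that they form a basis, and \<open>\<Sum>\<^sub>a (n-1 choose a)\<^sup>2 = (2(n-1) choose n-1)\<close>.
\<close>

section \<open>Words and residue sequences\<close>

text \<open>Idempotents are indexed by words of length n - 2, but basis elements by pairs of words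
  of length n - 1. The extra last letters p and q carry the degree: p = q = True is degree 0, p = q
  = False is degree 2, and p, q different is degree 1, where the two shorter words differ in content
  by one letter. Since the inner psi are invertible between distinct letters, everything can be
  compared at the sorted word of a given content, and one flip per kind of letter describes degree
  1. The obstacle is flipping the same kind of letter twice, which no quadratic relation controls.
  It vanishes because it is one side of a braid relation whose other side starts with a psi
  exchanging equal letters. A flip followed by the opposite flip gives \<open>y n\<close> up to
  sign, and this is annihilated by a further flip because \<open>y n\<close> can be traded for
  \<open>y (n - 1)\<close>, which is 0. Each generator thus maps a basis element to 0 or to plus or
  minus a basis element, so closure of the span involves no linear combinations. For independence,
  each basis element has its own test function and row that detect it and no other.\<close>

abbreviation trues :: "bool list \<Rightarrow> nat" where
  "trues w \<equiv> count_list w True"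

abbreviation falses :: "bool list \<Rightarrow> nat" where
  "falses w \<equiv> count_list w False"

lemma trues_plus_falses: "trues w + falses w = length w"
  by (induction w) auto

text \<open>
  A word records on which side an arc of the cycle starting at 0 is extended: \<^term>\<open>True\<close> appends the
  successor of its right end, \<^term>\<open>False\<close> the predecessor of its left end. In \<open>labels n r l w\<close> the arc
  reached so far is \<open>{0..r} \<union> {n - l..<n}\<close>.
\<close>

fun labels :: "nat \<Rightarrow> nat \<Rightarrow> nat \<Rightarrow> bool list \<Rightarrow> nat list" where
  "labels n r l [] = []"
| "labels n r l (b # w) =
    (if b then Suc r # labels n (Suc r) l w else (n - Suc l) # labels n r (Suc l) w)"

definition residues :: "nat \<Rightarrow> bool list \<Rightarrow> nat list" where
  "residues n w = 0 # labels n 0 0 w"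

lemma length_labels [simp]: "length (labels n r l w) = length w"
  by (induction n r l w rule: labels.induct) auto

lemma labels_append:
  "labels n r l (w @ v) = labels n r l w @ labels n (r + trues w) (l + falses w) v"
  by (induction n r l w rule: labels.induct) auto

lemma set_labels:
  "r + l + length w < n \<Longrightarrow>
    set (labels n r l w) = {r<..r + trues w} \<union> {n - l - falses w..<n - l}"
proof (induction n r l w rule: labels.induct)
  case (2 n r l b w)
  have tf: "trues w + falses w = length w"
    by (rule trues_plus_falses)
  show ?case
  proof (cases b)
    case True
    then have "set (labels n r l (b # w)) =
        insert (Suc r) {Suc r<..Suc r + trues w} \<union> {n - l - falses w..<n - l}"
      using 2 by simp
    also have "insert (Suc r) {Suc r<..Suc r + trues w} = {r<..r + trues (b # w)}"
      using True by auto
    finally show ?thesis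
      using True by simp
  next
    case False
    then have "set (labels n r l (b # w)) =
        {r<..r + trues w} \<union> insert (n - Suc l) {n - Suc l - falses w..<n - Suc l}"
      using 2 by simp
    also have "insert (n - Suc l) {n - Suc l - falses w..<n - Suc l} = {n - l - falses (b # w)..<n - l}"
      using 2(3) False tf by auto
    finally show ?thesis
      using False by simp
  qed
qed simp

lemma distinct_labels: "r + l + length w < n \<Longrightarrow> distinct (labels n r l w)"
proof (induction n r l w rule: labels.induct)
  case (2 n r l b w)
  note tf = trues_plus_falses[of w]
  show ?case
  proof (cases b)
    case True
    then show ?thesis
      using 2 tf by (simp add: set_labels)
  next
    case False
    moreover have "n - Suc l > r + trues w"
      using 2 tf by simp
    ultimately show ?thesis
      using 2 tf by (simp add: set_labels)
  qed
qed simp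
lemma length_residues [simp]: "length (residues n w) = Suc (length w)"
  by (simp add: residues_def)

lemma residues_append: "residues n (w @ v) = residues n w @ labels n (trues w) (falses w) v"
  by (simp add: residues_def labels_append)

lemma set_residues:
  assumes "length w < n"
  shows "set (residues n w) = {0..trues w} \<union> {n - falses w..<n}"
proof -
  have "set (residues n w) = insert 0 {0<..trues w} \<union> {n - falses w..<n}"
    using assms by (simp add: residues_def set_labels)
  also have "insert 0 {0<..trues w} = {0..trues w}"
    by auto
  finally show ?thesis .
qed

lemma distinct_residues:
  assumes "length w < n"
  shows "distinct (residues n w)"
proof -
  have "n - falses w > 0"
    using assms trues_plus_falses[of w] by linarith
  then show ?thesis
    using assms by (simp add: residues_def distinct_labels set_labels)
qed

lemma seqs_iff: "i \<in> seqs n \<longleftrightarrow> distinct i \<and> set i = {0..<n}"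
  by (auto simp: seqs_def permutations_of_set_def)

lemma length_seqs: "i \<in> seqs n \<Longrightarrow> length i = n"
  unfolding seqs_iff using distinct_card by fastforce

lemma residues_in_seqs:
  assumes "Suc (length w) = n"
  shows "residues n w \<in> seqs n"
proof -
  have "set (residues n w) \<subseteq> {0..<n}"
    using assms trues_plus_falses[of w] by (simp add: set_residues subset_iff)
  moreover have "card (set (residues n w)) = n"
    using assms by (simp add: distinct_card distinct_residues)
  ultimately show ?thesis
    using assms by (simp add: seqs_iff distinct_residues card_subset_eq)
qed

text \<open>The last vertex reached is adjacent to both ends of the arc already covered.\<close>

lemma residues_last:
  assumes "length u + 2 = n"
  shows "residues n (u @ [b]) = residues n (u @ [c])"
proof -
  have "Suc (trues u) = n - Suc (falses u)"
    using assms trues_plus_falses[of u] by linarith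
  then show ?thesis
    by (simp add: residues_append)
qed

text \<open>While at least two vertices are uncovered, the left and right extensions of the arc
  differ, so each label reveals its letter. Only the last label, given by \<open>b\<close> or
  \<open>c\<close>, reveals nothing.\<close>

lemma labels_inj:
  "\<lbrakk>length u = length v; r + l + length u + 2 \<le> n;
    labels n r l (u @ [b]) = labels n r l (v @ [c])\<rbrakk> \<Longrightarrow> u = v"
proof (induction u v arbitrary: r l rule: list_induct2)
  case (Cons x xs y ys)
  have "Suc r \<noteq> n - Suc l"
    using Cons.prems(1) by simp
  with Cons.prems show ?case
    using Cons.IH[of "Suc r" l] Cons.IH[of r "Suc l"] by (cases x; cases y) simp_all
qed simp

lemma residues_inj:
  "\<lbrakk>length u + 2 = n; length v + 2 = n; residues n (u @ [b]) = residues n (v @ [c])\<rbrakk> \<Longrightarrow> u = v"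
  using labels_inj[of u v 0 0 n b c] by (simp add: residues_def)

section \<open>Exchanging neighbouring entries of words and of residue sequences\<close>

lemma swap_entries_append:
  "swap_entries (Suc (length p)) (p @ x # y # s) = p @ y # x # s"
  by (simp add: swap_entries_def entry_def list_update_append nth_append)

lemma split_at_pair:
  assumes "Suc j < length u"
  obtains p a b s where "u = p @ a # b # s" "length p = j" "u ! j = a" "u ! Suc j = b"
proof
  show "u = take j u @ u ! j # u ! Suc j # drop (Suc (Suc j)) u"
    using assms by (simp add: Cons_nth_drop_Suc)
qed (use assms in simp_all)

lemma swap_entries_involution:
  assumes "i \<in> seqs n" "k \<in> {1..n - 1}"
  shows "swap_entries k (swap_entries k i) = i"
proof -
  have "Suc (k - 1) < length i"
    using assms length_seqs by fastforce
  then obtain p x x' s where "i = p @ x # x' # s" "length p = k - 1"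
    by (rule split_at_pair)
  then show ?thesis
    using swap_entries_append[of p x x' s] swap_entries_append[of p x' x s] assms(2) by simp
qed

text \<open>A letter's vertex depends only on how many equal letters precede it, so exchanging
  distinct letters moves their two vertices and leaves all later ones alone. The offset 2 comes from
  the leading 0 and from counting positions from 1.\<close>

lemma swap_residues:
  "a \<noteq> b \<Longrightarrow>
    swap_entries (length p + 2) (residues n (p @ a # b # s)) = residues n (p @ b # a # s)"
  using swap_entries_append[of "residues n p"]
  by (cases a; cases b) (simp_all add: residues_append)

definition exchange :: "nat \<Rightarrow> 'a list \<Rightarrow> 'a list" where
  "exchange j u = u[j := u ! Suc j, Suc j := u ! j]"

lemma length_exchange [simp]: "length (exchange j u) = length u"
  by (simp add: exchange_def)

lemma exchange_append: "exchange (length p) (p @ a # b # s) = p @ b # a # s"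
  by (simp add: exchange_def list_update_append nth_append)

lemma exchange_snoc: "Suc j < length u \<Longrightarrow> exchange j (u @ v) = exchange j u @ v"
  by (simp add: exchange_def list_update_append nth_append)

lemma nth_exchange:
  "Suc j < length u \<Longrightarrow> exchange j u ! k =
    (if k = j then u ! Suc j else if k = Suc j then u ! j else u ! k)"
  by (simp add: exchange_def nth_list_update)

lemma exchange_exchange [simp]: "Suc j < length u \<Longrightarrow> exchange j (exchange j u) = u"
  by (rule nth_equalityI) (simp_all add: nth_exchange)

lemma exchange_commute:
  "\<lbrakk>Suc j < length u; Suc k < length u; Suc j < k \<or> Suc k < j\<rbrakk> \<Longrightarrow>
    exchange j (exchange k u) = exchange k (exchange j u)"
  by (rule nth_equalityI) (auto simp: nth_exchange)

lemma count_list_exchange [simp]: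
  assumes "Suc j < length u"
  shows "count_list (exchange j u) c = count_list u c"
proof -
  obtain p a b s where u: "u = p @ a # b # s" "length p = j"
    using assms by (rule split_at_pair)
  then have "exchange j u = p @ b # a # s"
    using exchange_append[of p a b s] by simp
  then show ?thesis
    using u(1) by simp
qed

lemma residues_exchange:
  assumes "Suc j < length w" "w ! j \<noteq> w ! Suc j"
  shows "residues n (exchange j w) = swap_entries (j + 2) (residues n w)"
proof -
  obtain p a b s where w: "w = p @ a # b # s" "length p = j" "w ! j = a" "w ! Suc j = b"
    using assms(1) by (rule split_at_pair)
  then show ?thesis
    using exchange_append[of p a b s] swap_residues[of a b p n s] assms(2) by simp
qed

section \<open>Sorting a word by exchanging descents\<close>

fun inversions :: "bool list \<Rightarrow> nat" where
  "inversions [] = 0"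
| "inversions (b # w) = (if b then 0 else trues w) + inversions w"

lemma inversions_append:
  "inversions (v @ w) = inversions v + falses v * trues w + inversions w"
  by (induction v) (auto simp: algebra_simps)

definition descent :: "nat \<Rightarrow> bool list \<Rightarrow> bool" where
  "descent j u \<longleftrightarrow> Suc j < length u \<and> \<not> u ! j \<and> u ! Suc j"

lemma inversions_exchange:
  assumes "descent j u"
  shows "inversions (exchange j u) < inversions u"
proof -
  have "Suc j < length u"
    using assms by (simp add: descent_def)
  then obtain p a b s where u: "u = p @ a # b # s" "length p = j" "u ! j = a" "u ! Suc j = b"
    by (rule split_at_pair)
  have ab: "a = False" "b = True"
    using assms u(3,4) unfolding descent_def by blast+
  have "exchange j u = p @ True # False # s"
    using exchange_append[of p a b s] u(1,2) ab by simp
  then show ?thesis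
    using u(1) ab by (simp add: inversions_append)
qed

text \<open>\<open>LEAST\<close> merely makes the path a function of the word;
  \<open>transport_descent\<close> shows that starting with another descent yields the same
  element.\<close>

function sorting_path :: "bool list \<Rightarrow> nat list" where
  "sorting_path u = (if \<exists>j. descent j u
    then (LEAST j. descent j u) # sorting_path (exchange (LEAST j. descent j u) u) else [])"
  by auto
termination
  by (relation "measure inversions") (auto intro: inversions_exchange LeastI)

declare sorting_path.simps [simp del]

lemma sorting_path_Nil: "(\<And>j. \<not> descent j u) \<Longrightarrow> sorting_path u = []"
  by (subst sorting_path.simps) simp

lemma sorting_path_Cons:
  assumes "\<exists>j. descent j u"
  obtains l where "descent l u" "sorting_path u = l # sorting_path (exchange l u)"
proof
  show "descent (LEAST j. descent j u) u"
    using assms by (auto intro: LeastI)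
  show "sorting_path u = (LEAST j. descent j u) # sorting_path (exchange (LEAST j. descent j u) u)"
    using assms by (subst sorting_path.simps) simp
qed

definition sorted_word :: "bool list \<Rightarrow> bool list" where
  "sorted_word u = replicate (trues u) True @ replicate (falses u) False"

lemma length_sorted_word [simp]: "length (sorted_word u) = length u"
  by (simp add: sorted_word_def trues_plus_falses)

lemma count_list_replicate: "count_list (replicate k x) y = (if x = y then k else 0)"
  by (induction k) auto

lemma count_list_sorted_word [simp]: "count_list (sorted_word u) b = count_list u b"
  by (cases b) (simp_all add: sorted_word_def count_list_replicate)

lemma sorted_word_cong: "trues u = trues v \<Longrightarrow> length u = length v \<Longrightarrow> sorted_word u = sorted_word v"
  using trues_plus_falses[of u] trues_plus_falses[of v] by (simp add: sorted_word_def)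

lemma no_descent_sorted:
  assumes "\<And>j. \<not> descent j u"
  shows "u = sorted_word u"
proof -
  from assms have "\<exists>a b. u = replicate a True @ replicate b False"
  proof (induction u)
    case (Cons c u)
    have "\<not> descent j u" for j
      using Cons.prems[of "Suc j"] by (auto simp: descent_def)
    with Cons.IH obtain a b where u: "u = replicate a True @ replicate b False" by blast
    show ?case
    proof (cases c)
      case True
      then have "c # u = replicate (Suc a) True @ replicate b False" by (simp add: u)
      then show ?thesis by blast
    next
      case False
      then have "a = 0"
        using Cons.prems[of 0] by (cases a) (auto simp: descent_def u)
      then have "c # u = replicate 0 True @ replicate (Suc b) False" by (simp add: u False)
      then show ?thesis by blast
    qed
  qed simp
  then show ?thesis
    by (auto simp: sorted_word_def count_list_replicate)
qed

text \<open>Descents at j and j + 1 would force the letter at j + 1 to be both True and False. Hence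
  different descents involve disjoint pairs of letters.\<close>

lemma descent_exchange:
  assumes "descent j u" "descent l u" "j \<noteq> l"
  shows "Suc j < l \<or> Suc l < j" "descent j (exchange l u)"
proof -
  show far: "Suc j < l \<or> Suc l < j"
    using assms by (auto simp: descent_def) (metis Suc_lessI linorder_neqE_nat)
  show "descent j (exchange l u)"
    using assms far by (auto simp: descent_def nth_exchange)
qed

section \<open>Arrows between consecutive residues\<close>

lemma entry_residues:
  "entry (residues n (p @ a # b # s)) (length p + 2) = (if a then Suc (trues p) else n - Suc (falses p))"
  "entry (residues n (p @ a # b # s)) (length p + 2 + 1) =
    (if b then Suc (trues (p @ [a])) else n - Suc (falses (p @ [a])))"
  by (simp_all add: entry_def residues_append nth_append)

text \<open>Two steps on the same side follow the arrows for True and run against them for False.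
  The bound on n keeps the second vertex away from 0 and excludes the double arrow of n = 2.\<close>

lemma arrow_along_arc:
  fixes a :: bool
  assumes "t + f + 3 \<le> n"
  defines "v \<equiv> if a then Suc t else n - Suc f" and "v' \<equiv> if a then Suc (Suc t) else n - Suc (Suc f)"
  shows "arrow n v v' \<longleftrightarrow> a" "arrow n v' v \<longleftrightarrow> \<not> a"
proof -
  have "n - Suc f = Suc (n - Suc (Suc f))" "n - Suc (Suc f) \<noteq> 0" "Suc (Suc (n - Suc (Suc f))) \<le> n"
    using assms(1) by simp_all
  then show "arrow n v v' \<longleftrightarrow> a" "arrow n v' v \<longleftrightarrow> \<not> a"
    using assms(1) by (cases a; simp add: v_def v'_def arrow_def)+
qed

lemma arrow_residues_eq:
  assumes "Suc (length w) = n" "Suc j < length w" "w ! j = w ! Suc j"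
  shows "arrow n (entry (residues n w) (j + 2)) (entry (residues n w) (j + 2 + 1)) \<longleftrightarrow> w ! j"
    "arrow n (entry (residues n w) (j + 2 + 1)) (entry (residues n w) (j + 2)) \<longleftrightarrow> \<not> w ! j"
proof -
  obtain p a b s where w: "w = p @ a # b # s" "length p = j" "w ! j = a" "w ! Suc j = b"
    using assms(2) by (rule split_at_pair)
  have "trues p + falses p + 3 \<le> n"
    using trues_plus_falses[of p] w(1,2) assms(1) by simp
  note arc = arrow_along_arc[OF this, of a]
  have "b = a"
    using assms(3) w(3,4) by simp
  then have "entry (residues n w) (j + 2) = (if a then Suc (trues p) else n - Suc (falses p))"
    "entry (residues n w) (j + 2 + 1) = (if a then Suc (Suc (trues p)) else n - Suc (Suc (falses p)))"
    using entry_residues[of n p a b s] w(1,2) by simp_all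
  then show "arrow n (entry (residues n w) (j + 2)) (entry (residues n w) (j + 2 + 1)) \<longleftrightarrow> w ! j"
    "arrow n (entry (residues n w) (j + 2 + 1)) (entry (residues n w) (j + 2)) \<longleftrightarrow> \<not> w ! j"
    unfolding w(3) using arc by simp_all
qed

text \<open>The last pair of letters is excluded: there only two vertices remain outside the arc,
  and they are neighbours. Earlier, another uncovered vertex lies between the two ends.\<close>

lemma arrow_residues_neq:
  assumes "Suc (length w) = n" "Suc (Suc j) < length w" "w ! j \<noteq> w ! Suc j"
  shows "\<not> arrow n (entry (residues n w) (j + 2)) (entry (residues n w) (j + 2 + 1))"
    "\<not> arrow n (entry (residues n w) (j + 2 + 1)) (entry (residues n w) (j + 2))"
proof -
  have "Suc j < length w"
    using assms(2) by simp
  then obtain p a b s where w: "w = p @ a # b # s" "length p = j" "w ! j = a" "w ! Suc j = b"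
    by (rule split_at_pair)
  have tf: "trues p + falses p + 4 \<le> n"
    using trues_plus_falses[of p] w(1,2) assms(1,2) by (cases s) simp_all
  have "a \<noteq> b"
    using assms(3) w(3,4) by simp
  moreover have "entry (residues n w) (j + 2) = (if a then Suc (trues p) else n - Suc (falses p))"
    "entry (residues n w) (j + 2 + 1) = (if b then Suc (trues (p @ [a])) else n - Suc (falses (p @ [a])))"
    using entry_residues[of n p a b s] w(1,2) by simp_all
  ultimately show "\<not> arrow n (entry (residues n w) (j + 2)) (entry (residues n w) (j + 2 + 1))"
    "\<not> arrow n (entry (residues n w) (j + 2 + 1)) (entry (residues n w) (j + 2))"
    using tf by (cases a; cases b; auto simp: arrow_def)+
qed

lemma arrow_residues_first:
  assumes "Suc (length w) = n" "w \<noteq> []"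
  shows "arrow n (entry (residues n w) 1) (entry (residues n w) (1 + 1)) \<longleftrightarrow> w ! 0 \<or> n = 2"
    "arrow n (entry (residues n w) (1 + 1)) (entry (residues n w) 1) \<longleftrightarrow> \<not> w ! 0 \<or> n = 2"
proof -
  obtain b w' where w: "w = b # w'"
    using assms(2) by (cases w) auto
  then have n: "2 \<le> n"
    using assms(1) by auto
  show "arrow n (entry (residues n w) 1) (entry (residues n w) (1 + 1)) \<longleftrightarrow> w ! 0 \<or> n = 2"
    "arrow n (entry (residues n w) (1 + 1)) (entry (residues n w) 1) \<longleftrightarrow> \<not> w ! 0 \<or> n = 2"
    using n by (cases b; auto simp: w residues_def entry_def arrow_def)+
qed

section \<open>Flipping the last letter, and induction along sorting paths\<close>

definition flip_last :: "bool list \<Rightarrow> bool list" where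
  "flip_last u = butlast u @ [\<not> last u]"

lemma flip_last_snoc: "flip_last (v @ [b]) = v @ [\<not> b]"
  by (simp add: flip_last_def)

lemma length_flip_last: "u \<noteq> [] \<Longrightarrow> length (flip_last u) = length u"
  by (simp add: flip_last_def)

lemma exchange_flip_last:
  assumes "Suc (Suc j) < length u"
  shows "exchange j (flip_last u) = flip_last (exchange j u)" "last (exchange j u) = last u"
    "flip_last u ! j = u ! j" "flip_last u ! Suc j = u ! Suc j"
proof -
  obtain v b where u: "u = v @ [b]"
    using assms by (cases u rule: rev_cases) auto
  then show "exchange j (flip_last u) = flip_last (exchange j u)" "last (exchange j u) = last u"
    "flip_last u ! j = u ! j" "flip_last u ! Suc j = u ! Suc j"
    using assms by (simp_all add: flip_last_snoc exchange_snoc nth_append)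
qed

lemma flip_last_flip_last: "u \<noteq> [] \<Longrightarrow> flip_last (flip_last u) = u"
  by (simp add: flip_last_def)

text \<open>By \<open>residues_last\<close> the final letter may be chosen opposite to the last
  letter \<open>b\<close> of \<open>u\<close>. Then flipping \<open>b\<close> is an exchange of two
  distinct letters at the end.\<close>

lemma residues_flip_last:
  assumes "length u + 2 = n" "u \<noteq> []"
  shows "residues n (flip_last u @ [True]) = swap_entries (n - 1) (residues n (u @ [True]))"
proof -
  obtain v b where u: "u = v @ [b]"
    using assms(2) by (cases u rule: rev_cases) auto
  have "residues n (u @ [True]) = residues n (v @ [b, \<not> b])"
    using residues_last[OF assms(1), of True "\<not> b"] u by simp
  moreover have "residues n (flip_last u @ [True]) = residues n (v @ [\<not> b, b])"
    using residues_last[of "v @ [\<not> b]" n True b] u assms(1) by (simp add: flip_last_snoc)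
  moreover have "length v + 2 = n - 1"
    using u assms(1) by simp
  ultimately show ?thesis
    using swap_residues[of b "\<not> b" v n "[]"] by simp
qed

text \<open>Combines well-founded induction on inversions with the particular descent chosen by
  \<open>sorting_path\<close>, so that transport can be unfolded by one step.\<close>

lemma sorting_induct [consumes 0, case_names sorted step]:
  assumes "\<And>u. (\<And>j. \<not> descent j u) \<Longrightarrow> P u"
    and "\<And>u l. \<lbrakk>descent l u; sorting_path u = l # sorting_path (exchange l u); P (exchange l u)\<rbrakk> \<Longrightarrow> P u"
  shows "P u"
proof (induction u rule: measure_induct_rule[of inversions])
  case (less u)
  show ?case
  proof (cases "\<exists>j. descent j u")
    case True
    then obtain l where "descent l u" "sorting_path u = l # sorting_path (exchange l u)"
      by (rule sorting_path_Cons)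
    then show ?thesis
      using assms(2) less inversions_exchange by blast
  qed (use assms(1) in blast)
qed

lemma descentD: "descent j u \<Longrightarrow> Suc j < length u" "descent j u \<Longrightarrow> u ! j \<noteq> u ! Suc j"
  by (auto simp: descent_def)

lemma sorted_word_exchange: "Suc j < length u \<Longrightarrow> sorted_word (exchange j u) = sorted_word u"
  by (simp add: sorted_word_def)

lemma descent_snoc: "descent j u \<Longrightarrow> descent j (u @ [b])"
  by (simp add: descent_def nth_append)

lemma count_list_remove1: "b \<in> set v \<Longrightarrow> count_list v c = count_list (remove1 b v) c + (if b = c then 1 else 0)"
  by (induction v) auto

lemma sorting_path_bound: "j \<in> set (sorting_path u) \<Longrightarrow> Suc j < length u"
proof (induction u rule: sorting_induct)
  case (step u l)
  then show ?case
    using descentD(1)[OF step(1)] by auto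
qed (simp add: sorting_path_Nil)

text \<open>The extended words have the same content and end differently, so \<open>v\<close>
  contains one more \<open>p\<close> than \<open>u\<close>.\<close>

lemma letter_in_word:
  assumes "length u = length v" "trues (u @ [p]) = trues (v @ [q])" "p \<noteq> q"
  shows "p \<in> set v"
proof (rule ccontr)
  assume "p \<notin> set v"
  then have "count_list v p = 0" by simp
  then show False
    using assms trues_plus_falses[of u] trues_plus_falses[of v] by (cases p; cases q) simp_all
qed

lemma sorted_word_replace:
  assumes "b \<in> set v"
  shows "sorted_word (sorted_word (remove1 b v) @ [b]) = sorted_word v"
    "\<lbrakk>length u = length v; trues (u @ [b]) = trues (v @ [\<not> b])\<rbrakk> \<Longrightarrow>
      sorted_word (sorted_word (remove1 b v) @ [\<not> b]) = sorted_word u"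
    "Suc (length (remove1 b v)) = length v"
proof -
  define r where "r = remove1 b v"
  have len: "Suc (length r) = length v"
    using length_pos_if_in_set[OF assms] assms by (simp add: length_remove1 r_def)
  then show "Suc (length (remove1 b v)) = length v"
    by (simp add: r_def)
  have c: "trues v = trues r + (if b then 1 else 0)"
    using count_list_remove1[OF assms, of True] by (simp add: r_def)
  have "trues (sorted_word r @ [b]) = trues v"
    using c by simp
  then show "sorted_word (sorted_word (remove1 b v) @ [b]) = sorted_word v"
    unfolding r_def[symmetric] using len by (intro sorted_word_cong) simp_all
  assume u: "length u = length v" "trues (u @ [b]) = trues (v @ [\<not> b])"
  have "trues (sorted_word r @ [\<not> b]) = trues u"
    using u(2) c by (cases b) simp_all
  then show "sorted_word (sorted_word (remove1 b v) @ [\<not> b]) = sorted_word u"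
    unfolding r_def[symmetric] using len u(1) by (intro sorted_word_cong) simp_all
qed

section \<open>Weight spaces of a cyclotomic module\<close>

text \<open>Only an abelian group with additive operators is assumed, with the relations stated at
  vectors. It will be instantiated by the quotient algebra under left multiplication by its
  generators; scalars enter only when spans are formed.\<close>

locale cyclotomic_klr_module = abelian_group M for M (structure) +
  fixes n :: nat and e :: "nat list \<Rightarrow> 'a \<Rightarrow> 'a" and y psi :: "nat \<Rightarrow> 'a \<Rightarrow> 'a"
  assumes n_gt_1: "1 < n"
    and e_hom: "i \<in> seqs n \<Longrightarrow> e i \<in> hom (add_monoid M) (add_monoid M)"
    and y_hom: "k \<in> {1..n} \<Longrightarrow> y k \<in> hom (add_monoid M) (add_monoid M)"
    and psi_hom: "k \<in> {1..n - 1} \<Longrightarrow> psi k \<in> hom (add_monoid M) (add_monoid M)"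
    and e_e: "\<lbrakk>i \<in> seqs n; j \<in> seqs n; z \<in> carrier M\<rbrakk> \<Longrightarrow>
      e i (e j z) = (if i = j then e i z else \<zero>)"
    and y_e: "\<lbrakk>k \<in> {1..n}; i \<in> seqs n; z \<in> carrier M\<rbrakk> \<Longrightarrow> y k (e i z) = e i (y k z)"
    and psi_e: "\<lbrakk>k \<in> {1..n - 1}; i \<in> seqs n; z \<in> carrier M\<rbrakk> \<Longrightarrow>
      psi k (e i z) = e (swap_entries k i) (psi k z)"
    and psi_y_far: "\<lbrakk>k \<in> {1..n - 1}; l \<in> {1..n}; l \<noteq> k; l \<noteq> k + 1; z \<in> carrier M\<rbrakk> \<Longrightarrow>
      psi k (y l z) = y l (psi k z)"
    and psi_psi_far: "\<lbrakk>k \<in> {1..n - 1}; l \<in> {1..n - 1}; k + 1 < l \<or> l + 1 < k; z \<in> carrier M\<rbrakk> \<Longrightarrow>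
      psi k (psi l z) = psi l (psi k z)"
    and psi_y: "\<lbrakk>k \<in> {1..n - 1}; i \<in> seqs n; z \<in> carrier M\<rbrakk> \<Longrightarrow>
      psi k (y (k + 1) (e i z)) = y k (psi k (e i z))"
    and y_psi: "\<lbrakk>k \<in> {1..n - 1}; i \<in> seqs n; z \<in> carrier M\<rbrakk> \<Longrightarrow>
      y (k + 1) (psi k (e i z)) = psi k (y k (e i z))"
    and braid: "\<lbrakk>k \<in> {1..n - 1}; k + 1 \<in> {1..n - 1}; i \<in> seqs n; z \<in> carrier M\<rbrakk> \<Longrightarrow>
      psi k (psi (k + 1) (psi k (e i z))) = psi (k + 1) (psi k (psi (k + 1) (e i z)))"
    and psi_sq_none: "\<lbrakk>k \<in> {1..n - 1}; i \<in> seqs n; z \<in> carrier M;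
        \<not> arrow n (entry i k) (entry i (k + 1)); \<not> arrow n (entry i (k + 1)) (entry i k)\<rbrakk> \<Longrightarrow>
      psi k (psi k (e i z)) = e i z"
    and psi_sq_right: "\<lbrakk>k \<in> {1..n - 1}; i \<in> seqs n; z \<in> carrier M;
        arrow n (entry i k) (entry i (k + 1)); \<not> arrow n (entry i (k + 1)) (entry i k)\<rbrakk> \<Longrightarrow>
      psi k (psi k (e i z)) = y (k + 1) (e i z) \<ominus> y k (e i z)"
    and psi_sq_left: "\<lbrakk>k \<in> {1..n - 1}; i \<in> seqs n; z \<in> carrier M;
        \<not> arrow n (entry i k) (entry i (k + 1)); arrow n (entry i (k + 1)) (entry i k)\<rbrakk> \<Longrightarrow>
      psi k (psi k (e i z)) = y k (e i z) \<ominus> y (k + 1) (e i z)"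
    and psi_sq_both: "\<lbrakk>k \<in> {1..n - 1}; i \<in> seqs n; z \<in> carrier M;
        arrow n (entry i k) (entry i (k + 1)); arrow n (entry i (k + 1)) (entry i k)\<rbrakk> \<Longrightarrow>
      psi k (psi k (e i z)) =
        y (k + 1) (y k (e i z) \<ominus> y (k + 1) (e i z)) \<ominus> y k (y k (e i z) \<ominus> y (k + 1) (e i z))"
    and cyclotomic_y: "\<lbrakk>i \<in> seqs n; entry i 1 = 0; z \<in> carrier M\<rbrakk> \<Longrightarrow> y 1 (e i z) = \<zero>"
    and cyclotomic_e: "\<lbrakk>i \<in> seqs n; entry i 1 \<noteq> 0; z \<in> carrier M\<rbrakk> \<Longrightarrow> e i z = \<zero>"
begin

lemma hom_zero: "f \<in> hom (add_monoid M) (add_monoid M) \<Longrightarrow> f \<zero> = \<zero>"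
  using hom_one[OF _ a_group a_group, of f] by simp

lemma hom_minus:
  "f \<in> hom (add_monoid M) (add_monoid M) \<Longrightarrow> z \<in> carrier M \<Longrightarrow> f (\<ominus> z) = \<ominus> f z"
  using group_hom.hom_inv[of "add_monoid M" "add_monoid M" f z] a_group
  by (simp add: group_hom_def group_hom_axioms_def a_inv_def)

lemma minus_zero_eq [simp]: "\<ominus> \<zero> = \<zero>"
  using r_neg[of \<zero>] by simp

lemma eq_zero_of_minus:
  assumes "\<zero> = a \<ominus> b \<or> \<zero> = b \<ominus> a" "b = \<zero>" "a \<in> carrier M"
  shows "a = \<zero>"
proof -
  have "\<zero> = a \<or> \<zero> = \<ominus> a"
    using assms by (simp add: minus_eq)
  then show ?thesis
    using minus_minus[OF assms(3)] minus_zero_eq by metis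
qed

lemma e_closed [simp]: "i \<in> seqs n \<Longrightarrow> z \<in> carrier M \<Longrightarrow> e i z \<in> carrier M"
  and y_closed [simp]: "k \<in> {1..n} \<Longrightarrow> z \<in> carrier M \<Longrightarrow> y k z \<in> carrier M"
  and psi_closed [simp]: "k \<in> {1..n - 1} \<Longrightarrow> z \<in> carrier M \<Longrightarrow> psi k z \<in> carrier M"
  using hom_in_carrier[OF e_hom] hom_in_carrier[OF y_hom] hom_in_carrier[OF psi_hom] by simp_all

lemma y_zero [simp]: "k \<in> {1..n} \<Longrightarrow> y k \<zero> = \<zero>"
  and psi_zero [simp]: "k \<in> {1..n - 1} \<Longrightarrow> psi k \<zero> = \<zero>"
  using hom_zero[OF y_hom] hom_zero[OF psi_hom] by simp_all

definition weight :: "nat list \<Rightarrow> 'a set" where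
  "weight i = {z \<in> carrier M. e i z = z}"

lemma weightD: "z \<in> weight i \<Longrightarrow> z \<in> carrier M" "z \<in> weight i \<Longrightarrow> e i z = z"
  by (simp_all add: weight_def)

lemma y_weight: "k \<in> {1..n} \<Longrightarrow> i \<in> seqs n \<Longrightarrow> z \<in> weight i \<Longrightarrow> y k z \<in> weight i"
  using y_e[of k i z] by (simp add: weight_def)

lemma psi_weight:
  "k \<in> {1..n - 1} \<Longrightarrow> i \<in> seqs n \<Longrightarrow> z \<in> weight i \<Longrightarrow> psi k z \<in> weight (swap_entries k i)"
  using psi_e[of k i z] by (simp add: weight_def)

lemma e_weight_eq:
  "i \<in> seqs n \<Longrightarrow> j \<in> seqs n \<Longrightarrow> z \<in> weight j \<Longrightarrow> e i z = (if i = j then z else \<zero>)"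
  using e_e[of i j z] by (auto simp: weight_def)

text \<open>An entry without neighbours among its predecessors can be moved to the front.\<close>

lemma weight_trivial:
  assumes "i \<in> seqs n" "p < n" "i ! p \<noteq> 0"
    and "\<And>x. x \<in> set (take p i) \<Longrightarrow> \<not> arrow n x (i ! p) \<and> \<not> arrow n (i ! p) x"
    and "z \<in> weight i"
  shows "z = \<zero>"
  using assms
proof (induction p arbitrary: i z)
  case 0
  then show ?case
    using cyclotomic_e[of i z] by (simp add: entry_def weight_def)
next
  case (Suc p)
  let ?i = "swap_entries (Suc p) i"
  have k: "Suc p \<in> {1..n - 1}" and len: "Suc p < length i"
    using Suc.prems by (simp_all add: length_seqs)
  have i: "?i \<in> seqs n"
    by (rule swap_entries_seqs[OF Suc.prems(1) k])
  have "?i ! p = i ! Suc p" "take p ?i = take p i"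
    using len by (simp_all add: swap_entries_def entry_def nth_list_update)
  moreover have "set (take p i) \<subseteq> set (take (Suc p) i)"
    by (rule set_take_subset_set_take) simp
  ultimately have zero: "psi (Suc p) z = \<zero>"
    using Suc.IH[OF i, of "psi (Suc p) z"] Suc.prems psi_weight[OF k Suc.prems(1,5)] by auto
  \<comment> \<open>The entry being moved is not adjacent to the one it passes, so this psi squares
    to the identity and the vanishing of \<open>psi (Suc p) z\<close> forces \<open>z\<close> to
    vanish.\<close>
  have "i ! p \<in> set (take (Suc p) i)"
    using len by (simp add: take_Suc_conv_app_nth)
  then have "psi (Suc p) (psi (Suc p) z) = z"
    using psi_sq_none[OF k Suc.prems(1) weightD(1)[OF Suc.prems(5)]] Suc.prems(4)[of "i ! p"]
      weightD(2)[OF Suc.prems(5)] by (simp add: entry_def)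
  then show ?case
    using zero k by simp
qed

lemma not_adjacent_to_arc:
  assumes "a \<in> {0..t} \<union> {n - f..<n}" "Suc t < b" "b < n - Suc f"
  shows "\<not> arrow n a b \<and> \<not> arrow n b a"
  using assms by (auto simp: arrow_def)

lemma weight_residues:
  assumes "i \<in> seqs n" "z \<in> weight i" "z \<noteq> \<zero>"
  obtains w where "Suc (length w) = n" "i = residues n w"
proof -
  have len: "length i = n"
    using assms(1) by (rule length_seqs)
  have "\<exists>w. length w = k \<and> take (Suc k) i = residues n w" if "k < n" for k
    using that
  proof (induction k)
    case 0
    have "i ! 0 = 0"
      using weight_trivial[OF assms(1) 0 _ _ assms(2)] assms(3) by auto
    then show ?case
      using len 0 by (intro exI[of _ "[]"]) (simp add: residues_def take_Suc_conv_app_nth)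
  next
    case (Suc k)
    then obtain w where w: "length w = k" "take (Suc k) i = residues n w"
      by auto
    let ?a = "i ! Suc k"
    have set: "set (take (Suc k) i) = {0..trues w} \<union> {n - falses w..<n}"
      using w Suc.prems by (simp add: set_residues)
    have "?a \<notin> set (take (Suc k) i)"
      using assms(1) Suc.prems len by (auto simp: seqs_iff in_set_conv_nth nth_eq_iff_index_eq)
    moreover have "?a < n"
      using assms(1) Suc.prems len nth_mem[of "Suc k" i] by (auto simp: seqs_iff)
    ultimately have a: "trues w < ?a" "?a < n - falses w"
      unfolding set by auto
    \<comment> \<open>A vertex strictly between the two possible extensions has no neighbour in the
      arc, so \<open>weight_trivial\<close> would make \<open>z\<close> zero.\<close>
    have "\<not> (Suc (trues w) < ?a \<and> ?a < n - Suc (falses w))"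
      using weight_trivial[OF assms(1) Suc.prems _ _ assms(2)] assms(3) not_adjacent_to_arc a
      unfolding set by auto
    then have "?a = Suc (trues w) \<or> ?a = n - Suc (falses w)"
      using a by linarith
    then obtain b where "?a = (if b then Suc (trues w) else n - Suc (falses w))"
      by metis
    then have "take (Suc (Suc k)) i = residues n (w @ [b])"
      using Suc.prems len w by (simp add: take_Suc_conv_app_nth[of "Suc k"] residues_append)
    then show ?case
      using w by (intro exI[of _ "w @ [b]"]) simp
  qed
  from this[of "n - 1"] n_gt_1 len obtain w where "length w = n - 1" "i = residues n w"
    by auto
  with n_gt_1 show ?thesis
    by (intro that) simp_all
qed

subsection \<open>Weight spaces indexed by words\<close>

text \<open>The choice of True is immaterial: by \<open>residues_last\<close> the final vertex is
  forced. \<open>wspace_eq\<close> allows either letter, which later lets the last two letters be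
  taken equal or distinct as convenient.\<close>

definition wspace :: "bool list \<Rightarrow> 'a set" where
  "wspace u = weight (residues n (u @ [True]))"

definition is_word :: "bool list \<Rightarrow> bool" where
  "is_word u \<longleftrightarrow> length u + 2 = n"

lemma is_word_exchange [simp]: "is_word (exchange j u) = is_word u"
  by (simp add: is_word_def)

lemma is_word_sorted [simp]: "is_word (sorted_word u) = is_word u"
  by (simp add: is_word_def)

lemma residues_word_seqs: "is_word u \<Longrightarrow> residues n (u @ [b]) \<in> seqs n"
  by (rule residues_in_seqs) (simp add: is_word_def)

lemma wspace_eq: "is_word u \<Longrightarrow> wspace u = weight (residues n (u @ [b]))"
  unfolding wspace_def is_word_def by (metis residues_last)

lemma wspace_carrier: "z \<in> wspace u \<Longrightarrow> z \<in> carrier M"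
  by (simp add: wspace_def weight_def)

lemma wspace_zero: "is_word u \<Longrightarrow> \<zero> \<in> wspace u"
  using hom_zero[OF e_hom] by (simp add: wspace_def weight_def residues_word_seqs)

lemma y_wspace: "is_word u \<Longrightarrow> k \<in> {1..n} \<Longrightarrow> z \<in> wspace u \<Longrightarrow> y k z \<in> wspace u"
  by (simp add: wspace_def y_weight residues_word_seqs)

lemma psi_exchange_wspace:
  assumes "is_word u" "Suc j < length u" "u ! j \<noteq> u ! Suc j" "z \<in> wspace u"
  shows "psi (j + 2) z \<in> wspace (exchange j u)"
proof -
  have "residues n (exchange j u @ [True]) = swap_entries (j + 2) (residues n (u @ [True]))"
    using residues_exchange[of j "u @ [True]"] assms by (simp add: exchange_snoc nth_append)
  moreover have "j + 2 \<in> {1..n - 1}"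
    using assms by (auto simp: is_word_def)
  ultimately show ?thesis
    using psi_weight[OF _ residues_word_seqs[OF assms(1)]] assms(4) by (simp add: wspace_def)
qed

lemma psi_exchange_involution:
  assumes "is_word u" "Suc j < length u" "u ! j \<noteq> u ! Suc j" "z \<in> wspace u"
  shows "psi (j + 2) (psi (j + 2) z) = z"
proof -
  let ?i = "residues n (u @ [True])"
  have "\<not> arrow n (entry ?i (j + 2)) (entry ?i (j + 2 + 1))"
    "\<not> arrow n (entry ?i (j + 2 + 1)) (entry ?i (j + 2))"
    using assms by (intro arrow_residues_neq; simp add: is_word_def nth_append)+
  moreover have "j + 2 \<in> {1..n - 1}"
    using assms by (auto simp: is_word_def)
  ultimately show ?thesis
    using psi_sq_none[of "j + 2" ?i z] residues_word_seqs[OF assms(1)] assms(4)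
    by (simp add: wspace_def weight_def)
qed

text \<open>After the exchange the farther vertex \<open>x'\<close> is reached before
  \<open>x\<close>, while it still has no neighbour in the arc of \<open>p\<close>. The target
  weight space is therefore trivial.\<close>

lemma psi_equal_letters:
  assumes "is_word u" "Suc j < length u" "u ! j = u ! Suc j" "z \<in> wspace u"
  shows "psi (j + 2) z = \<zero>"
proof -
  let ?i = "residues n (u @ [True])"
  obtain p a b s where "u = p @ a # b # s" and p: "length p = j" and "u ! j = a" "u ! Suc j = b"
    using assms(2) by (rule split_at_pair)
  then have u: "u = p @ a # a # s" "length p = j"
    using assms(3) by simp_all
  define x where "x = (if a then Suc (trues p) else n - Suc (falses p))"
  define x' where "x' = (if a then Suc (Suc (trues p)) else n - Suc (Suc (falses p)))"
  obtain s' where i: "?i = residues n p @ x # x' # s'"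
    using residues_append[of n p "a # a # s @ [True]"] u unfolding x_def x'_def
    by (cases a) auto
  have tf: "trues p + falses p + 4 \<le> n"
    using trues_plus_falses[of p] u assms(1,2) by (simp add: is_word_def)
  have k: "j + 2 \<in> {1..n - 1}"
    using assms by (auto simp: is_word_def)
  have i': "swap_entries (j + 2) ?i = residues n p @ x' # x # s'"
    using swap_entries_append[of "residues n p" x x' s'] u(2) i by simp
  have x': "x' \<noteq> 0" "Suc (trues p) < x'" "x' < n - Suc (falses p)"
    using tf unfolding x'_def by auto
  have "length p < n"
    using tf trues_plus_falses[of p] by linarith
  moreover have "residues n p @ x' # x # s' \<in> seqs n"
    by (rule swap_entries_seqs[OF residues_word_seqs[OF assms(1), of True] k, unfolded i'])
  moreover have "psi (j + 2) z \<in> weight (residues n p @ x' # x # s')"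
    using psi_weight[OF k residues_word_seqs[OF assms(1), of True], unfolded i'] assms(4)
    by (simp add: wspace_def)
  ultimately show ?thesis
    using weight_trivial[of "residues n p @ x' # x # s'" "Suc j" "psi (j + 2) z"]
      k x' u(2) not_adjacent_to_arc[of _ "trues p" "falses p" x']
    by (auto simp: nth_append set_residues)
qed

lemma residues_word_Cons:
  assumes "is_word u"
  obtains a s where "residues n (u @ [True]) = 0 # (if a then 1 else n - 1) # s"
proof (cases u)
  case Nil
  then show ?thesis
    by (intro that[of True "[]"]) (simp_all add: residues_def)
next
  case (Cons a u')
  then show ?thesis
    using assms
    by (cases a; intro that[of a]) (auto simp: residues_def is_word_def)
qed

text \<open>The exchanged sequence begins with a nonzero vertex, and such idempotents are killed by
  the cyclotomic relation.\<close>

lemma psi_first: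
  assumes "is_word u" "z \<in> wspace u"
  shows "psi 1 z = \<zero>"
proof -
  obtain a s where i: "residues n (u @ [True]) = 0 # (if a then 1 else n - 1) # s"
    using assms(1) by (rule residues_word_Cons)
  then have "swap_entries 1 (residues n (u @ [True])) = (if a then 1 else n - 1) # 0 # s"
    using swap_entries_append[of "[]"] by simp
  moreover have k: "1 \<in> {1..n - 1}"
    using n_gt_1 by simp
  ultimately show ?thesis
    using weight_trivial[OF swap_entries_seqs[OF residues_word_seqs[OF assms(1), of True] k], of 0 "psi 1 z"]
      psi_weight[OF k residues_word_seqs[OF assms(1)], of z True] assms(2) n_gt_1
    by (auto simp: wspace_def)
qed

text \<open>The dot at position 1 vanishes by the cyclotomic relation, and this passes from k to k +
  1. If \<open>psi k\<close> kills \<open>z\<close>, its square, plus or minus the difference of the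
  two dots, is zero. If the letters are distinct, \<open>psi k\<close> is invertible and carries the
  dot at k + 1 to the dot at k on the exchanged word; hence the induction is over all words.\<close>

lemma y_trivial:
  assumes "is_word u" "k \<in> {1..n - 1}" "z \<in> wspace u"
  shows "y k z = \<zero>"
  using assms
proof (induction k arbitrary: u z)
  case (Suc k)
  let ?i = "residues n (u @ [True])"
  note i = residues_word_seqs[OF Suc.prems(1), of True]
  have z: "z \<in> carrier M" "e ?i z = z"
    using Suc.prems(3) by (simp_all add: wspace_def weight_def)
  have "k = 0 \<or> k = 1 \<or> k = (k - 2) + 2"
    by arith
  then consider "k = 0" | "k = 1" | j where "k = j + 2"
    by blast
  then show ?case
  proof cases
    case 1
    then show ?thesis
      using cyclotomic_y[OF i _ z(1)] z(2) by (simp add: entry_def residues_def)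
  next
    case 2
    have "n > 2"
      using Suc.prems(2) 2 by simp
    have k: "1 \<in> {1..n - 1}"
      using n_gt_1 by simp
    have yz: "y 1 z = \<zero>" "y 2 z \<in> carrier M"
      using Suc.IH[OF Suc.prems(1) _ Suc.prems(3)] 2 k z \<open>n > 2\<close> by simp_all
    have "psi 1 (psi 1 z) = \<zero>"
      using psi_first[OF Suc.prems(1,3)] k by simp
    moreover have "u @ [True] \<noteq> []" "Suc (length (u @ [True])) = n"
      using Suc.prems(1) by (simp_all add: is_word_def)
    note arr = arrow_residues_first[OF this(2,1)]
    ultimately have "\<zero> = y 2 z \<ominus> y 1 z \<or> \<zero> = y 1 z \<ominus> y 2 z"
      using psi_sq_right[OF k i z(1)] psi_sq_left[OF k i z(1)] z(2) \<open>n > 2\<close> unfolding arr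
      by (cases "(u @ [True]) ! 0") (simp_all add: numeral_2_eq_2)
    then have "y 2 z = \<zero>"
      using yz by (rule eq_zero_of_minus)
    then show ?thesis
      using 2 by (simp add: numeral_2_eq_2)
  next
    case 3
    have k: "k \<in> {1..n - 1}" and k': "k \<in> {1..n}" "Suc k \<in> {1..n}" and j: "Suc j < length u"
      using 3 Suc.prems by (auto simp: is_word_def)
    have yk: "y k z = \<zero>"
      using Suc.IH[OF Suc.prems(1) k Suc.prems(3)] .
    show ?thesis
    proof (cases "u ! j = u ! Suc j")
      case True
      have "Suc (length (u @ [True])) = n" "Suc j < length (u @ [True])"
        "(u @ [True]) ! j = (u @ [True]) ! Suc j"
        using Suc.prems(1) j True by (simp_all add: is_word_def nth_append)
      note arr = arrow_residues_eq[OF this, folded 3]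
      have "psi k (psi k z) = \<zero>"
        using psi_equal_letters[OF Suc.prems(1) j True Suc.prems(3)] 3 k by simp
      then have "\<zero> = y (k + 1) z \<ominus> y k z \<or> \<zero> = y k z \<ominus> y (k + 1) z"
        using psi_sq_right[OF k i z(1)] psi_sq_left[OF k i z(1)] z(2) unfolding arr
        by (cases "(u @ [True]) ! j") simp_all
      then have "y (k + 1) z = \<zero>"
        by (rule eq_zero_of_minus[OF _ yk y_closed[OF _ z(1)]]) (use k'(2) in simp)
      then show ?thesis
        by simp
    next
      case False
      let ?u = "exchange j u"
      have pz: "psi k z \<in> wspace ?u" "psi k (psi k z) = z"
        using psi_exchange_wspace[OF Suc.prems(1) j False Suc.prems(3)]
          psi_exchange_involution[OF Suc.prems(1) j False Suc.prems(3)] 3 by simp_all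
      have "y k (psi k z) = \<zero>"
        using Suc.IH[of ?u "psi k z"] Suc.prems(1) k pz(1) by simp
      then have "y (k + 1) (psi k (psi k z)) = \<zero>"
        using y_psi[OF k residues_word_seqs[of ?u True] wspace_carrier[OF pz(1)]] Suc.prems(1) pz(1) k
        by (simp add: wspace_def weight_def)
      then show ?thesis
        using pz(2) by simp
    qed
  qed
qed simp

section \<open>Relations at the last position\<close>

lemma psi_last_wspace:
  assumes "is_word (v @ [b])" "z \<in> wspace (v @ [b])"
  shows "psi (n - 1) z \<in> wspace (v @ [\<not> b])"
proof -
  have k: "n - 1 \<in> {1..n - 1}" and len: "length v + 2 = n - 1" and word: "is_word (v @ [\<not> b])"
    using assms(1) by (auto simp: is_word_def)
  have "swap_entries (n - 1) (residues n (v @ [b, \<not> b])) = residues n (v @ [\<not> b, b])"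
    using swap_residues[of b "\<not> b" v n "[]"] len by simp
  then show ?thesis
    using psi_weight[OF k residues_word_seqs[OF assms(1), of "\<not> b"], of z] assms(2)
    by (simp add: wspace_eq[OF assms(1), of "\<not> b"] wspace_eq[OF word, of b])
qed

text \<open>With the forced final letter chosen equal to \<open>b\<close>, the last two vertices are
  joined by a single arrow whose direction is given by \<open>b\<close>. The quadratic relation then
  leaves only \<open>y n\<close>, because \<open>y (n - 1)\<close> vanishes.\<close>

lemma psi_last_sq:
  assumes "is_word (v @ [b])" "z \<in> wspace (v @ [b])"
  shows "psi (n - 1) (psi (n - 1) z) = (if b then y n z else \<ominus> y n z)"
proof -
  let ?i = "residues n (v @ [b, b])"
  have k: "n - 1 \<in> {1..n - 1}" and len: "length v + 2 = n - 1" "length v + 3 = n"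
    using assms(1) by (auto simp: is_word_def)
  have i: "?i \<in> seqs n" "z \<in> weight ?i"
    using residues_word_seqs[OF assms(1), of b] assms(2) wspace_eq[OF assms(1), of b] by simp_all
  have z: "z \<in> carrier M" "e ?i z = z" "y (n - 1) z = \<zero>"
    using i y_trivial[OF assms(1) k assms(2)] by (simp_all add: weight_def)
  have "Suc (length (v @ [b, b])) = n" "Suc (length v) < length (v @ [b, b])"
    "(v @ [b, b]) ! length v = (v @ [b, b]) ! Suc (length v)"
    using len by (simp_all add: nth_append)
  note arr = arrow_residues_eq[OF this, unfolded len]
  have yz: "y n z \<in> carrier M" "n - 1 + 1 = n"
    using n_gt_1 z by simp_all
  show ?thesis
    using psi_sq_right[OF k i(1) z(1)] psi_sq_left[OF k i(1) z(1)] z(2,3) yz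
    unfolding arr by (cases b) (simp_all add: minus_eq nth_append)
qed

text \<open>Passing \<open>y n\<close> through \<open>psi (n - 1)\<close> in either direction turns
  it into \<open>y (n - 1)\<close>, which is zero on both words.\<close>

lemma y_last_psi_last:
  assumes "is_word (v @ [b])" "z \<in> wspace (v @ [b])"
  shows "y n (psi (n - 1) z) = \<zero>" "psi (n - 1) (y n z) = \<zero>"
proof -
  have k: "n - 1 \<in> {1..n - 1}" "n - 1 + 1 = n" and word: "is_word (v @ [\<not> b])"
    using assms(1) by (auto simp: is_word_def)
  note i = residues_word_seqs[OF assms(1), of True]
  have z: "z \<in> carrier M" "e (residues n ((v @ [b]) @ [True])) z = z"
    using assms(2) by (simp_all add: wspace_def weight_def)
  show "y n (psi (n - 1) z) = \<zero>"
    using y_psi[OF k(1) i z(1)] y_trivial[OF assms(1) k(1) assms(2)] k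
    unfolding z(2) k(2) by simp
  show "psi (n - 1) (y n z) = \<zero>"
    using psi_y[OF k(1) i z(1)] y_trivial[OF word k(1) psi_last_wspace[OF assms]]
    unfolding z(2) k(2) by simp
qed

text \<open>For n = 2 the double arrow gives minus the square of \<open>y 2\<close> as the square of
  \<open>psi 1\<close>, which is zero. Otherwise one factor \<open>y n\<close> is replaced, up to
  sign, by the square of \<open>psi (n - 1)\<close>, and the other factor annihilates it.\<close>

lemma y_last_sq:
  assumes "is_word u" "z \<in> wspace u"
  shows "y n (y n z) = \<zero>"
proof (cases u rule: rev_cases)
  case Nil
  then have n: "n = 2"
    using assms(1) by (simp add: is_word_def)
  have i: "residues n (u @ [True]) = [0, 1]"
    using Nil by (simp add: residues_def)
  have k: "1 \<in> {1..n - 1}" "n \<in> {1..n}"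
    using n by simp_all
  have z: "z \<in> carrier M" "e (residues n (u @ [True])) z = z"
    using assms(2) by (simp_all add: wspace_def weight_def)
  have arr: "arrow n (entry [0, 1] 1) (entry [0, 1] (1 + 1))" "arrow n (entry [0, 1] (1 + 1)) (entry [0, 1] 1)"
    using n by (simp_all add: arrow_def entry_def)
  have yz: "y n z \<in> wspace u" "y n z \<in> carrier M" "y n (y n z) \<in> carrier M"
    using y_wspace[OF assms(1) k(2) assms(2)] k z by simp_all
  have "psi 1 (psi 1 z) =
      y (1 + 1) (y 1 z \<ominus> y (1 + 1) z) \<ominus> y 1 (y 1 z \<ominus> y (1 + 1) z)"
    using psi_sq_both[OF k(1) residues_word_seqs[OF assms(1), of True] z(1)] arr z(2) unfolding i by simp
  moreover have "psi 1 (psi 1 z) = \<zero>"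
    using psi_first[OF assms] k(1) by simp
  moreover have "y 1 z = \<zero>" "y 1 (y n z) = \<zero>"
    using y_trivial[OF assms(1) k(1)] assms(2) yz(1) by simp_all
  ultimately have "\<zero> = \<ominus> y n (y n z)"
    using hom_minus[OF y_hom] yz n by (simp add: minus_eq numeral_2_eq_2)
  then show ?thesis
    using minus_minus[OF yz(3)] minus_zero_eq by metis
next
  case (snoc v b)
  have n: "n \<in> {1..n}"
    using n_gt_1 by simp
  have z': "psi (n - 1) z \<in> wspace (v @ [\<not> b])" and word: "is_word (v @ [\<not> b])"
    using psi_last_wspace[of v b z] assms snoc by (simp_all add: is_word_def)
  have yz: "y n z \<in> carrier M" "y n (y n z) \<in> carrier M"
    using wspace_carrier[OF assms(2)] n by simp_all
  have "y n (if b then y n z else \<ominus> y n z) = \<zero>"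
    using y_last_psi_last(1)[OF word z'] psi_last_sq[of v b z] assms snoc by simp
  then have "y n (y n z) = \<zero> \<or> \<ominus> y n (y n z) = \<zero>"
    using hom_minus[OF y_hom[OF n] yz(1)] by (simp split: if_splits)
  then show ?thesis
    using minus_minus[OF yz(2)] minus_zero_eq by metis
qed

text \<open>The other side of the braid relation starts by applying \<open>psi (n - 2)\<close> to
  two equal letters, which gives zero.\<close>

lemma psi_braid_trivial:
  assumes "is_word (v @ [b, b])" "z \<in> wspace (v @ [b, b])"
  shows "psi (n - 1) (psi (length v + 2) (psi (n - 1) z)) = \<zero>"
proof -
  have n: "n = length v + 4"
    using assms(1) by (simp add: is_word_def)
  have k: "length v + 2 \<in> {1..n - 1}" "length v + 2 + 1 \<in> {1..n - 1}" "length v + 2 + 1 = n - 1"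
    using n by simp_all
  have z: "z \<in> carrier M" "e (residues n ((v @ [b, b]) @ [True])) z = z"
    using assms(2) by (simp_all add: wspace_def weight_def)
  have "psi (length v + 2) z = \<zero>"
    using psi_equal_letters[OF assms(1) _ _ assms(2), of "length v"] by (simp add: nth_append)
  then show ?thesis
    using braid[OF k(1,2) residues_word_seqs[OF assms(1), of True] z(1)] k psi_zero
    unfolding z(2) k(3) by simp
qed

subsection \<open>Transport along words\<close>

text \<open>\<open>foldr\<close> applies the last exchange of the path first, so this goes from the
  sorted word back to \<open>u\<close>.\<close>

definition transport :: "bool list \<Rightarrow> 'a \<Rightarrow> 'a" where
  "transport u h = foldr (\<lambda>j. psi (j + 2)) (sorting_path u) h"

definition untransport :: "bool list \<Rightarrow> 'a \<Rightarrow> 'a" where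
  "untransport u z = foldr (\<lambda>j. psi (j + 2)) (rev (sorting_path u)) z"

lemma transport_sorted: "(\<And>j. \<not> descent j u) \<Longrightarrow> transport u h = h"
  and untransport_sorted: "(\<And>j. \<not> descent j u) \<Longrightarrow> untransport u h = h"
  by (simp_all add: transport_def untransport_def sorting_path_Nil)

lemma transport_step:
    "sorting_path u = l # sorting_path (exchange l u) \<Longrightarrow>
      transport u h = psi (l + 2) (transport (exchange l u) h)"
  and untransport_step:
    "sorting_path u = l # sorting_path (exchange l u) \<Longrightarrow>
      untransport u z = untransport (exchange l u) (psi (l + 2) z)"
  by (simp_all add: transport_def untransport_def)

lemma transport_wspace:
  "is_word u \<Longrightarrow> h \<in> wspace (sorted_word u) \<Longrightarrow> transport u h \<in> wspace u"
proof (induction u rule: sorting_induct)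
  case (sorted u)
  then show ?case
    using no_descent_sorted[of u] by (simp add: transport_sorted)
next
  case (step u l)
  note l = descentD[OF step(1)]
  then show ?case
    using psi_exchange_wspace[of "exchange l u" l "transport (exchange l u) h"] step
    by (simp add: transport_step[OF step(2)] nth_exchange sorted_word_exchange)
qed

lemma untransport_wspace:
  "is_word u \<Longrightarrow> z \<in> wspace u \<Longrightarrow> untransport u z \<in> wspace (sorted_word u)"
proof (induction u arbitrary: z rule: sorting_induct)
  case (sorted u)
  then show ?case
    using no_descent_sorted[of u] by (simp add: untransport_sorted)
next
  case (step u l)
  note l = descentD[OF step(1)]
  show ?case
    using psi_exchange_wspace[OF step(4) l step(5)] step l
    by (simp add: untransport_step[OF step(2)] sorted_word_exchange)
qed

lemma transport_untransport:
  "is_word u \<Longrightarrow> z \<in> wspace u \<Longrightarrow> transport u (untransport u z) = z"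
proof (induction u arbitrary: z rule: sorting_induct)
  case (step u l)
  note l = descentD[OF step(1)]
  show ?case
    using psi_exchange_wspace[OF step(4) l step(5)] psi_exchange_involution[OF step(4) l step(5)] step
    by (simp add: transport_step[OF step(2)] untransport_step[OF step(2)])
qed (simp add: transport_sorted untransport_sorted)

lemma untransport_transport:
  "is_word u \<Longrightarrow> h \<in> wspace (sorted_word u) \<Longrightarrow> untransport u (transport u h) = h"
proof (induction u rule: sorting_induct)
  case (step u l)
  note l = descentD[OF step(1)]
  have "h \<in> wspace (sorted_word (exchange l u))"
    using step(5) l by (simp add: sorted_word_exchange)
  then show ?case
    using psi_exchange_involution[of "exchange l u" l "transport (exchange l u) h"] step l
      transport_wspace[of "exchange l u" h]
    by (simp add: transport_step[OF step(2)] untransport_step[OF step(2)] nth_exchange)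
qed (simp add: transport_sorted untransport_sorted)

lemma transport_y_last:
  "is_word u \<Longrightarrow> h \<in> wspace (sorted_word u) \<Longrightarrow> y n (transport u h) = transport u (y n h)"
proof (induction u rule: sorting_induct)
  case (step u l)
  note l = descentD[OF step(1)]
  have h: "h \<in> wspace (sorted_word (exchange l u))"
    using step(5) l by (simp add: sorted_word_exchange)
  then have "transport (exchange l u) h \<in> carrier M"
    using transport_wspace[of "exchange l u" h] step(4) by (simp add: wspace_carrier)
  moreover have "l + 2 \<in> {1..n - 1}" "n \<in> {1..n}" "n \<noteq> l + 2" "n \<noteq> l + 2 + 1"
    using l(1) step(4) by (auto simp: is_word_def)
  ultimately show ?case
    using psi_y_far[of "l + 2" n "transport (exchange l u) h"] step(3,4) h
    by (simp add: transport_step[OF step(2)])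
qed (simp add: transport_sorted)

lemma untransport_y_last:
  assumes "is_word u" "z \<in> wspace u"
  shows "y n (untransport u z) = untransport u (y n z)"
proof -
  have n: "n \<in> {1..n}"
    using n_gt_1 by simp
  let ?h = "untransport u z"
  have h: "?h \<in> wspace (sorted_word u)"
    by (rule untransport_wspace[OF assms])
  have "untransport u (y n z) = untransport u (transport u (y n ?h))"
    using transport_y_last[OF assms(1) h] transport_untransport[OF assms] by simp
  also have "\<dots> = y n ?h"
    by (rule untransport_transport[OF assms(1) y_wspace[OF _ n h]]) (use assms(1) in simp)
  finally show ?thesis ..
qed

lemma transport_zero: "is_word u \<Longrightarrow> transport u \<zero> = \<zero>"
proof (induction u rule: sorting_induct)
  case (step u l)
  then have "l + 2 \<in> {1..n - 1}"
    using descentD(1)[OF step(1)] by (auto simp: is_word_def)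
  then show ?case
    using step(3,4) by (simp add: transport_step[OF step(2)])
qed (simp add: transport_sorted)

lemma untransport_zero: "is_word u \<Longrightarrow> untransport u \<zero> = \<zero>"
  using untransport_transport[of u \<zero>] transport_zero[of u] wspace_zero by simp

text \<open>
  Distinct descents of a word are never adjacent, so the generators exchanging them commute
  and every choice of descents produces the same element.
\<close>

lemma transport_descent:
  "\<lbrakk>descent j u; is_word u; h \<in> wspace (sorted_word u)\<rbrakk> \<Longrightarrow>
    transport u h = psi (j + 2) (transport (exchange j u) h)"
proof (induction u arbitrary: j rule: measure_induct_rule[of inversions])
  case (less u)
  have "\<exists>j. descent j u"
    using less.prems(1) by blast
  then obtain l where l: "descent l u" "sorting_path u = l # sorting_path (exchange l u)"
    by (rule sorting_path_Cons)
  note lj = descentD(1)[OF l(1)] descentD(1)[OF less.prems(1)]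
  show ?case
  proof (cases "j = l")
    case False
    have far: "Suc j < l \<or> Suc l < j"
      and d: "descent j (exchange l u)" "descent l (exchange j u)"
      using descent_exchange[OF less.prems(1) l(1) False]
        descent_exchange[OF l(1) less.prems(1) False[symmetric]] by blast+
    let ?w = "exchange j (exchange l u)"
    have w: "exchange l (exchange j u) = ?w"
      using exchange_commute[of j u l] lj far by metis
    have h: "h \<in> wspace (sorted_word (exchange l u))" "h \<in> wspace (sorted_word (exchange j u))"
      "h \<in> wspace (sorted_word ?w)"
      using less.prems(3) lj by (simp_all add: sorted_word_exchange)
    have k: "j + 2 \<in> {1..n - 1}" "l + 2 \<in> {1..n - 1}" "j + 2 + 1 < l + 2 \<or> l + 2 + 1 < j + 2"
      using lj less.prems(2) far by (auto simp: is_word_def)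
    have "transport ?w h \<in> carrier M"
      using transport_wspace[of ?w h] h(3) less.prems(2) by (simp add: wspace_carrier)
    then have "psi (l + 2) (psi (j + 2) (transport ?w h)) = psi (j + 2) (psi (l + 2) (transport ?w h))"
      using psi_psi_far[OF k] by simp
    moreover have "transport (exchange l u) h = psi (j + 2) (transport ?w h)"
      using less.IH[OF inversions_exchange[OF l(1)] d(1)] h(1) less.prems(2) by simp
    moreover have "transport (exchange j u) h = psi (l + 2) (transport ?w h)"
      using less.IH[OF inversions_exchange[OF less.prems(1)] d(2)] h(2) less.prems(2) w by simp
    ultimately show ?thesis
      by (simp add: transport_step[OF l(2)])
  qed (use transport_step[OF l(2)] in simp)
qed

text \<open>Exactly one of \<open>u\<close> and \<open>exchange j u\<close> has a descent at j. The
  claim is \<open>transport_descent\<close> for that word, combined with the involution property if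
  the word is \<open>u\<close>.\<close>

lemma transport_exchange:
  assumes "is_word u" "Suc j < length u" "u ! j \<noteq> u ! Suc j" "h \<in> wspace (sorted_word u)"
  shows "psi (j + 2) (transport u h) = transport (exchange j u) h"
proof (cases "u ! j")
  case True
  then have "descent j (exchange j u)"
    using assms(2,3) by (auto simp: descent_def nth_exchange)
  then show ?thesis
    using transport_descent[of j "exchange j u" h] assms by (simp add: sorted_word_exchange)
next
  case False
  then have d: "descent j u"
    using assms(2,3) by (auto simp: descent_def)
  have "transport (exchange j u) h \<in> wspace (exchange j u)"
    using assms by (intro transport_wspace) (simp_all add: sorted_word_exchange)
  then have "psi (j + 2) (psi (j + 2) (transport (exchange j u) h)) = transport (exchange j u) h"
    using assms by (intro psi_exchange_involution[of "exchange j u"]) (auto simp: nth_exchange)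
  then show ?thesis
    by (simp add: transport_descent[OF d assms(1,4)])
qed

text \<open>
  \<^term>\<open>psi (n - 1)\<close> flips the last letter of a word. The element \<open>twist b v h\<close> is the effect of
  flipping a letter \<open>b\<close>, transported between the sorted words before and after the flip.
\<close>

definition twist :: "bool \<Rightarrow> bool list \<Rightarrow> 'a \<Rightarrow> 'a" where
  "twist b v h = (let s = sorted_word (remove1 b v)
    in untransport (s @ [\<not> b]) (psi (n - 1) (transport (s @ [b]) h)))"

lemma sorted_word_replace_last:
  assumes "is_word v" "b \<in> set v" "is_word (u @ [b])" "trues (u @ [b]) = trues v"
  shows "sorted_word u = sorted_word (remove1 b v)" "is_word (sorted_word (remove1 b v) @ [c])"
    "sorted_word (sorted_word (remove1 b v) @ [b]) = sorted_word v"
proof -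
  have len: "length (remove1 b v) = length u"
    using assms by (simp add: is_word_def length_remove1)
  show "sorted_word u = sorted_word (remove1 b v)"
    using count_list_remove1[OF assms(2), of True] len assms(4) by (intro sorted_word_cong) (auto split: if_splits)
  show "is_word (sorted_word (remove1 b v) @ [c])"
    using len assms(3) by (simp add: is_word_def)
  show "sorted_word (sorted_word (remove1 b v) @ [b]) = sorted_word v"
    using count_list_remove1[OF assms(2), of True] len assms
    by (intro sorted_word_cong) (auto simp: is_word_def split: if_splits)
qed

text \<open>By \<open>transport_descent\<close>, descents inside \<open>u\<close> may be treated
  first, and their psi are far enough from position n - 1 to commute with the flip. This reduces to
  sorted \<open>u\<close>, where the claim is the definition of \<open>twist\<close>. So a flip
  depends on \<open>u\<close> only through its content.\<close>

lemma psi_last_transport: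
  assumes v: "is_word v" "b \<in> set v" "h \<in> wspace (sorted_word v)"
  shows "\<lbrakk>is_word (u @ [b]); trues (u @ [b]) = trues v\<rbrakk> \<Longrightarrow>
    psi (n - 1) (transport (u @ [b]) h) = transport (u @ [\<not> b]) (twist b v h)"
proof (induction u rule: sorting_induct)
  case (sorted u)
  let ?s = "sorted_word (remove1 b v)"
  note s = sorted_word_replace_last[OF v(1,2) sorted(2,3)]
  have u: "u = ?s"
    using no_descent_sorted[OF sorted(1)] s(1) by simp
  have "transport (?s @ [b]) h \<in> wspace (?s @ [b])"
    by (rule transport_wspace) (use s v(3) in simp_all)
  then have "psi (n - 1) (transport (?s @ [b]) h) \<in> wspace (?s @ [\<not> b])"
    by (rule psi_last_wspace[OF s(2)])
  then show ?case
    using transport_untransport[OF s(2)] unfolding u by (simp add: twist_def Let_def)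
next
  case (step u l)
  note l = descentD(1)[OF step(1)]
  let ?u = "exchange l u"
  have word: "is_word (?u @ [b])" "is_word (?u @ [\<not> b])" "is_word (u @ [\<not> b])"
    and tr: "trues (?u @ [b]) = trues v"
    using step(4,5) l by (simp_all add: is_word_def)
  have h: "h \<in> wspace (sorted_word (u @ [b]))"
    using v(1,3) step(4,5) sorted_word_cong[of "u @ [b]" v] by (simp add: is_word_def)
  have ex: "exchange l (u @ [c]) = ?u @ [c]" for c
    using l by (rule exchange_snoc)
  have tw: "twist b v h \<in> wspace (sorted_word (u @ [\<not> b]))"
  proof -
    let ?s = "sorted_word (remove1 b v)"
    note s = sorted_word_replace_last[OF v(1,2) step(4,5)]
    have "transport (?s @ [b]) h \<in> wspace (?s @ [b])"
      by (rule transport_wspace) (use s v(3) in simp_all)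
    then have "twist b v h \<in> wspace (sorted_word (?s @ [\<not> b]))"
      unfolding twist_def Let_def by (intro untransport_wspace[OF s(2)] psi_last_wspace[OF s(2)])
    moreover have "trues (remove1 b v) = trues u" "length (remove1 b v) = length u"
      using arg_cong[OF s(1), of trues] arg_cong[OF s(1), of length] by simp_all
    then have "sorted_word (?s @ [\<not> b]) = sorted_word (u @ [\<not> b])"
      by (intro sorted_word_cong) simp_all
    ultimately show ?thesis by simp
  qed
  have carr: "transport (?u @ [b]) h \<in> wspace (?u @ [b])"
    using h word l sorted_word_exchange[of l "u @ [b]"] by (intro transport_wspace) (simp_all add: ex)
  have k: "n - 1 \<in> {1..n - 1}" "l + 2 \<in> {1..n - 1}" "n - 1 + 1 < l + 2 \<or> l + 2 + 1 < n - 1"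
    using l step(4) by (auto simp: is_word_def)
  have "psi (n - 1) (transport (u @ [b]) h) = psi (n - 1) (psi (l + 2) (transport (?u @ [b]) h))"
    using transport_descent[OF descent_snoc[OF step(1)] step(4) h] by (simp add: ex)
  also have "\<dots> = psi (l + 2) (psi (n - 1) (transport (?u @ [b]) h))"
    by (rule psi_psi_far[OF k wspace_carrier[OF carr]])
  also have "\<dots> = psi (l + 2) (transport (?u @ [\<not> b]) (twist b v h))"
    using step(3)[OF word(1) tr] by simp
  also have "\<dots> = transport (u @ [\<not> b]) (twist b v h)"
    using transport_descent[OF descent_snoc[OF step(1)] word(3) tw] by (simp add: ex)
  finally show ?case .
qed

lemma twist_wspace:
  assumes v: "is_word v" "b \<in> set v" "h \<in> wspace (sorted_word v)"
    and u: "is_word u" "trues (u @ [b]) = trues (v @ [\<not> b])"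
  shows "twist b v h \<in> wspace (sorted_word u)"
proof -
  let ?s = "remove1 b v"
  have len: "Suc (length ?s) = length v"
    using v(2) by (simp add: length_remove1) (metis Suc_pred length_pos_if_in_set)
  have s: "is_word (?s @ [b])" "trues (?s @ [b]) = trues v"
    using len v(1) count_list_remove1[OF v(2), of True] by (auto simp: is_word_def)
  note s' = sorted_word_replace_last[OF v(1,2) s]
  have "transport (sorted_word ?s @ [b]) h \<in> wspace (sorted_word ?s @ [b])"
    by (rule transport_wspace) (use s' v(3) in simp_all)
  then have "twist b v h \<in> wspace (sorted_word (sorted_word ?s @ [\<not> b]))"
    unfolding twist_def Let_def by (intro untransport_wspace[OF s'(2)] psi_last_wspace[OF s'(2)])
  moreover have "sorted_word (sorted_word ?s @ [\<not> b]) = sorted_word u"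
    using s u v(1) by (intro sorted_word_cong) (auto simp: is_word_def split: if_splits)
  ultimately show ?thesis by simp
qed

lemma y_last_twist:
  assumes v: "is_word v" "b \<in> set v" "h \<in> wspace (sorted_word v)"
  shows "y n (twist b v h) = \<zero>"
proof -
  let ?s = "remove1 b v"
  have len: "Suc (length ?s) = length v"
    using v(2) by (simp add: length_remove1) (metis Suc_pred length_pos_if_in_set)
  have s: "is_word (?s @ [b])" "trues (?s @ [b]) = trues v"
    using len v(1) count_list_remove1[OF v(2), of True] by (auto simp: is_word_def)
  note s' = sorted_word_replace_last[OF v(1,2) s]
  have t: "transport (sorted_word ?s @ [b]) h \<in> wspace (sorted_word ?s @ [b])"
    by (rule transport_wspace) (use s' v(3) in simp_all)
  show ?thesis
    using untransport_y_last[OF s'(2) psi_last_wspace[OF s'(2) t]]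
      y_last_psi_last(1)[OF s'(2) t] untransport_zero[OF s'(2)]
    by (simp add: twist_def Let_def)
qed

text \<open>Choose a word ending in \<open>b, b\<close>. Flipping the last letter, exchanging the
  last two and flipping again realises both twists, and this composite is zero by
  \<open>psi_braid_trivial\<close>.\<close>

lemma twist_twist:
  assumes v: "is_word v" "b \<in> set v" "h \<in> wspace (sorted_word v)"
    and u: "is_word (u @ [b])" "trues (u @ [b, b]) = trues (v @ [\<not> b])"
  shows "twist b (u @ [b]) (twist b v h) = \<zero>"
proof -
  let ?h = "twist b v h"
  have h: "?h \<in> wspace (sorted_word (u @ [b]))"
    using twist_wspace[OF v u(1)] u(2) by simp
  \<comment> \<open>This is the letter created by the first flip. Removing it leaves the common part
    \<open>t\<close> of all words below.\<close>
  have "(\<not> b) \<in> set u"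
  proof (rule ccontr)
    assume "(\<not> b) \<notin> set u"
    then have "count_list u (\<not> b) = 0" by simp
    then show False
      using u v(1) trues_plus_falses[of u] trues_plus_falses[of v] by (cases b) (auto simp: is_word_def)
  qed
  define t where "t = remove1 (\<not> b) u"
  have len: "Suc (length t) = length u"
    using \<open>(\<not> b) \<in> set u\<close> unfolding t_def by (simp add: length_remove1) (metis Suc_pred length_pos_if_in_set)
  have tr: "trues u = trues t + (if b then 0 else 1)"
    using count_list_remove1[OF \<open>(\<not> b) \<in> set u\<close>, of True] by (simp add: t_def)
  have words: "is_word ((t @ [b]) @ [b])" "is_word (t @ [b, b])" "is_word (t @ [b, \<not> b])"
    "is_word (t @ [\<not> b, b])" "is_word ((t @ [\<not> b]) @ [b])" "is_word (t @ [\<not> b, \<not> b])"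
    using len u(1) by (simp_all add: is_word_def)
  have tr': "trues ((t @ [b]) @ [b]) = trues v" "trues ((t @ [\<not> b]) @ [b]) = trues (u @ [b])"
    using tr u(2) by (auto split: if_splits)
  have h': "h \<in> wspace (sorted_word (t @ [b, b]))"
    using v(1,3) words(2) tr'(1) sorted_word_cong[of "t @ [b, b]" v] by (simp add: is_word_def)
  have hs: "?h \<in> wspace (sorted_word (t @ [b, \<not> b]))"
    using h words(3) u(1) tr'(2) sorted_word_cong[of "t @ [b, \<not> b]" "u @ [b]"]
    by (auto simp: is_word_def split: if_splits)
  have "psi (n - 1) (transport (t @ [b, b]) h) = transport (t @ [b, \<not> b]) ?h"
    using psi_last_transport[OF v words(1) tr'(1)] by simp
  moreover have "psi (length t + 2) (transport (t @ [b, \<not> b]) ?h) = transport (t @ [\<not> b, b]) ?h"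
    using transport_exchange[OF words(3) _ _ hs, of "length t"] exchange_append[of t b "\<not> b" "[]"]
    by (simp add: nth_append)
  moreover have "psi (n - 1) (transport (t @ [\<not> b, b]) ?h)
      = transport (t @ [\<not> b, \<not> b]) (twist b (u @ [b]) ?h)"
    using psi_last_transport[OF u(1) _ h words(5) tr'(2)] by simp
  moreover have "transport (t @ [b, b]) h \<in> wspace (t @ [b, b])"
    by (rule transport_wspace[OF words(2) h'])
  ultimately have zero: "transport (t @ [\<not> b, \<not> b]) (twist b (u @ [b]) ?h) = \<zero>"
    using psi_braid_trivial[OF words(2)] by metis
  have "twist b (u @ [b]) ?h \<in> wspace (sorted_word (t @ [\<not> b, \<not> b]))"
    by (rule twist_wspace[OF u(1) _ h words(6)]) (use tr'(2) in \<open>auto split: if_splits\<close>)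
  then show ?thesis
    using untransport_transport[OF words(6)] zero untransport_zero[OF words(6)] by metis
qed

subsection \<open>The submodule generated by a weight vector\<close>

text \<open>The letters \<open>p\<close> and \<open>q\<close> encode the degree: different letters
  give the degree 1 element, which flips a \<open>p\<close> of \<open>v\<close>; two Trues give
  degree 0 and two Falses degree 2.\<close>

definition basis_vector :: "bool list \<Rightarrow> bool \<Rightarrow> bool list \<Rightarrow> bool \<Rightarrow> 'a \<Rightarrow> 'a" where
  "basis_vector u p v q g =
    (if p \<noteq> q then transport u (twist p v (untransport v g))
     else if p then transport u (untransport v g)
     else y n (transport u (untransport v g)))"

text \<open>Zero and signed basis vectors suffice instead of linear combinations, because the
  generators preserve this set.\<close>

definition spanned :: "bool list \<Rightarrow> 'a \<Rightarrow> 'a \<Rightarrow> bool" where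
  "spanned v g z \<longleftrightarrow> z = \<zero> \<or>
    (\<exists>u p q. is_word u \<and> trues (u @ [p]) = trues (v @ [q]) \<and>
      (z = basis_vector u p v q g \<or> z = \<ominus> basis_vector u p v q g))"

context
  fixes v g
  assumes v: "is_word v" and g: "g \<in> wspace v"
begin

lemma letter_in_generator:
  assumes "is_word u" "trues (u @ [p]) = trues (v @ [q])" "p \<noteq> q"
  shows "p \<in> set v"
  using letter_in_word[OF _ assms(2,3)] assms(1) v by (simp add: is_word_def)

lemma untransport_generator: "untransport v g \<in> wspace (sorted_word v)"
  by (rule untransport_wspace[OF v g])

lemma twist_generator:
  assumes "is_word u" "trues (u @ [p]) = trues (v @ [q])" "p \<noteq> q"
  shows "twist p v (untransport v g) \<in> wspace (sorted_word u)"
proof -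
  have "q = (\<not> p)"
    using assms(3) by blast
  then show ?thesis
    using twist_wspace[OF v letter_in_generator[OF assms] untransport_generator assms(1)] assms(2) by simp
qed

lemma untransport_generator':
  assumes "is_word u" "trues (u @ [p]) = trues (v @ [q])" "p = q"
  shows "untransport v g \<in> wspace (sorted_word u)"
  using untransport_generator sorted_word_cong[of u v] assms v by (simp add: is_word_def)

lemma basis_vector_wspace:
  assumes "is_word u" "trues (u @ [p]) = trues (v @ [q])"
  shows "basis_vector u p v q g \<in> wspace u"
proof -
  have "n \<in> {1..n}"
    using n_gt_1 by simp
  then show ?thesis
    using twist_generator[OF assms] untransport_generator'[OF assms] transport_wspace[OF assms(1)]
      y_wspace[OF assms(1)] by (simp add: basis_vector_def)
qed

lemma spanned_generator: "spanned v g g"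
proof -
  have "g = basis_vector v True v True g"
    using transport_untransport[OF v g] by (simp add: basis_vector_def)
  then show ?thesis
    using v unfolding spanned_def by blast
qed

lemma spannedI:
  "\<lbrakk>is_word u; trues (u @ [p]) = trues (v @ [q]);
    z = basis_vector u p v q g \<or> z = \<ominus> basis_vector u p v q g\<rbrakk> \<Longrightarrow> spanned v g z"
  unfolding spanned_def by blast

lemma e_basis_vector:
  assumes "is_word u" "trues (u @ [p]) = trues (v @ [q])" "i \<in> seqs n"
  shows "spanned v g (e i (basis_vector u p v q g))"
  using e_weight_eq[OF assms(3) residues_word_seqs[OF assms(1), of True]] basis_vector_wspace[OF assms(1,2)]
    assms(1,2) unfolding spanned_def wspace_def by metis

lemma y_basis_vector:
  assumes "is_word u" "trues (u @ [p]) = trues (v @ [q])" "k \<in> {1..n}"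
  shows "spanned v g (y k (basis_vector u p v q g))"
proof (cases "k = n")
  case True
  consider "p" "q" | "\<not> p" "\<not> q" | "p \<noteq> q"
    by blast
  then show ?thesis
  proof cases
    case 1
    then have "y k (basis_vector u p v q g) = basis_vector u False v False g"
      by (simp add: basis_vector_def True)
    moreover have "trues (u @ [False]) = trues (v @ [False])"
      using assms(2) 1 by simp
    ultimately show ?thesis
      using assms(1) unfolding spanned_def by blast
  next
    case 2
    have "transport u (untransport v g) \<in> wspace u"
      by (rule transport_wspace[OF assms(1) untransport_generator'[OF assms(1,2)]]) (use 2 in simp)
    then show ?thesis
      using 2 y_last_sq[OF assms(1)] by (simp add: basis_vector_def True spanned_def)
  next
    case 3
    then show ?thesis
      using transport_y_last[OF assms(1) twist_generator[OF assms(1,2) 3]]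
        y_last_twist[OF v letter_in_generator[OF assms(1,2) 3] untransport_generator]
        transport_zero[OF assms(1)]
      by (simp add: basis_vector_def True spanned_def)
  qed
next
  case False
  then have "k \<in> {1..n - 1}"
    using assms(3) by auto
  then show ?thesis
    using y_trivial[OF assms(1) _ basis_vector_wspace[OF assms(1,2)]] by (simp add: spanned_def)
qed

lemma psi_exchange_basis_vector:
  assumes "is_word u" "trues (u @ [p]) = trues (v @ [q])" "Suc j < length u" "u ! j \<noteq> u ! Suc j"
  shows "psi (j + 2) (basis_vector u p v q g) = basis_vector (exchange j u) p v q g"
proof -
  note ex = transport_exchange[OF assms(1,3,4)]
  show ?thesis
  proof (cases "p = q")
    case True
    note h = untransport_generator'[OF assms(1,2) True]
    have "j + 2 \<in> {1..n - 1}" "n \<in> {1..n}" "n \<noteq> j + 2" "n \<noteq> j + 2 + 1"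
      using assms(1,3) n_gt_1 by (auto simp: is_word_def)
    then have "psi (j + 2) (y n (transport u (untransport v g)))
        = y n (psi (j + 2) (transport u (untransport v g)))"
      using psi_y_far wspace_carrier[OF transport_wspace[OF assms(1) h]] by blast
    then show ?thesis
      using True ex[OF h] by (simp add: basis_vector_def)
  next
    case False
    then show ?thesis
      using ex[OF twist_generator[OF assms(1,2) False]] by (simp add: basis_vector_def)
  qed
qed

text \<open>From degree 0 a flip leads to degree 1; in degree 2 it gives zero. In degree 1 it either
  undoes the earlier flip, leaving \<open>y n\<close> up to sign, or flips a second letter of the
  same kind, which is zero by \<open>twist_twist\<close>.\<close>

lemma psi_last_basis_vector:
  assumes "is_word (u @ [c])" "trues ((u @ [c]) @ [p]) = trues (v @ [q])"
  shows "spanned v g (psi (n - 1) (basis_vector (u @ [c]) p v q g))"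
proof -
  let ?h = "untransport v g"
  have word: "is_word (u @ [d])" for d
    using assms(1) by (simp add: is_word_def)
  consider "p" "q" | "\<not> p" "\<not> q" | "q = (\<not> p)" "c = q" | "q = (\<not> p)" "c = p"
    by blast
  then show ?thesis
  proof cases
    case 1
    have tr: "trues ((u @ [\<not> c]) @ [c]) = trues (v @ [\<not> c])" "trues (u @ [c]) = trues v"
      using assms(2) 1 by (auto split: if_splits)
    have "c \<in> set v"
      by (rule letter_in_generator[OF word tr(1)]) simp
    then have "psi (n - 1) (basis_vector (u @ [c]) p v q g) = basis_vector (u @ [\<not> c]) c v (\<not> c) g"
      using psi_last_transport[OF v _ untransport_generator assms(1) tr(2)] 1 by (simp add: basis_vector_def)
    then show ?thesis
      using word tr(1) unfolding spanned_def by blast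
  next
    case 2
    have "transport (u @ [c]) ?h \<in> wspace (u @ [c])"
      by (rule transport_wspace[OF assms(1) untransport_generator'[OF assms]]) (use 2 in simp)
    then show ?thesis
      using y_last_psi_last(2)[OF assms(1)] 2 by (simp add: basis_vector_def spanned_def)
  next
    case 3
    have p: "p \<in> set v"
      by (rule letter_in_generator[OF assms]) (use 3 in simp)
    have tr: "trues (u @ [p]) = trues v" "trues ((u @ [p]) @ [b]) = trues (v @ [b])" for b
      using assms(2) 3 by (auto split: if_splits)
    note h = untransport_generator'[OF word tr(2) refl]
    have t: "transport (u @ [p]) ?h \<in> wspace (u @ [p])"
      by (rule transport_wspace[OF word h])
    have "psi (n - 1) (basis_vector (u @ [c]) p v q g) = psi (n - 1) (psi (n - 1) (transport (u @ [p]) ?h))"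
      using psi_last_transport[OF v p untransport_generator word tr(1)] 3 by (simp add: basis_vector_def)
    also have "\<dots> = (if p then y n (transport (u @ [p]) ?h) else \<ominus> y n (transport (u @ [p]) ?h))"
      by (rule psi_last_sq[OF word t])
    also have "y n (transport (u @ [p]) ?h) = basis_vector (u @ [p]) False v False g"
      by (simp add: basis_vector_def)
    finally have "psi (n - 1) (basis_vector (u @ [c]) p v q g) = basis_vector (u @ [p]) False v False g \<or>
        psi (n - 1) (basis_vector (u @ [c]) p v q g) = \<ominus> basis_vector (u @ [p]) False v False g"
      by (cases p) simp_all
    then show ?thesis
      by (rule spannedI[OF word tr(2)])
  next
    case 4
    have p: "p \<in> set v"
      by (rule letter_in_generator[OF assms]) (use 4 in simp)
    have tr: "trues (u @ [p, p]) = trues (v @ [\<not> p])"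
      using assms(2) 4 by simp
    have "twist p v ?h \<in> wspace (sorted_word (u @ [p]))"
      by (rule twist_generator[OF word, of _ _ "\<not> p"]) (use tr in simp_all)
    then have "psi (n - 1) (transport (u @ [p]) (twist p v ?h)) =
        transport (u @ [\<not> p]) (twist p (u @ [p]) (twist p v ?h))"
      by (intro psi_last_transport word refl) simp_all
    also have "\<dots> = \<zero>"
      using twist_twist[OF v p untransport_generator word tr] transport_zero[OF word] by simp
    finally show ?thesis
      using 4 by (simp add: basis_vector_def spanned_def)
  qed
qed

lemma psi_basis_vector:
  assumes "is_word u" "trues (u @ [p]) = trues (v @ [q])" "k \<in> {1..n - 1}"
  shows "spanned v g (psi k (basis_vector u p v q g))"
proof -
  note b = basis_vector_wspace[OF assms(1,2)]
  have "k = 1 \<or> k = n - 1 \<or> k = (k - 2) + 2 \<and> Suc (k - 2) < length u"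
    using assms(1,3) by (auto simp: is_word_def)
  then consider "k = 1" | "k \<noteq> 1" "k = n - 1" | j where "k = j + 2" "Suc j < length u"
    by blast
  then show ?thesis
  proof cases
    case 1
    then show ?thesis
      using psi_first[OF assms(1) b] by (simp add: spanned_def)
  next
    case 2
    then have "u \<noteq> []"
      using assms(1) by (auto simp: is_word_def)
    then show ?thesis
      using psi_last_basis_vector[of "butlast u" "last u" p q] assms(1,2) 2 by simp
  next
    case 3
    show ?thesis
    proof (cases "u ! j = u ! Suc j")
      case True
      then show ?thesis
        using psi_equal_letters[OF assms(1) 3(2) True b] 3 by (simp add: spanned_def)
    next
      case False
      moreover have "trues (exchange j u @ [p]) = trues (v @ [q])"
        using assms(2) 3(2) by simp
      ultimately show ?thesis
        using psi_exchange_basis_vector[OF assms(1,2) 3(2)] 3(1) assms(1) is_word_exchange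
        unfolding spanned_def by metis
    qed
  qed
qed

lemma spanned_hom:
  assumes f: "f \<in> hom (add_monoid M) (add_monoid M)"
    and basis: "\<And>u p q. is_word u \<Longrightarrow> trues (u @ [p]) = trues (v @ [q]) \<Longrightarrow>
      spanned v g (f (basis_vector u p v q g))"
    and "spanned v g z"
  shows "spanned v g (f z)"
proof -
  have neg: "spanned v g (\<ominus> z)" if "spanned v g z" for z
  proof -
    have "\<ominus> (\<ominus> basis_vector u p v q g) = basis_vector u p v q g"
      if "is_word u" "trues (u @ [p]) = trues (v @ [q])" for u p q
      by (rule minus_minus[OF wspace_carrier[OF basis_vector_wspace[OF that]]])
    with that show ?thesis
      unfolding spanned_def by (metis minus_zero_eq)
  qed
  from assms(3) consider "z = \<zero>"
    | u p q where "is_word u" "trues (u @ [p]) = trues (v @ [q])"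
        "z = basis_vector u p v q g \<or> z = \<ominus> basis_vector u p v q g"
    unfolding spanned_def by blast
  then show ?thesis
  proof cases
    case 1
    then show ?thesis
      using hom_zero[OF f] by (simp add: spanned_def)
  next
    case 2
    have "f (\<ominus> basis_vector u p v q g) = \<ominus> f (basis_vector u p v q g)"
      by (rule hom_minus[OF f wspace_carrier[OF basis_vector_wspace[OF 2(1,2)]]])
    then show ?thesis
      using 2(3) basis[OF 2(1,2)] neg by auto
  qed
qed

lemma spanned_generators:
  assumes "spanned v g z"
  shows "i \<in> seqs n \<Longrightarrow> spanned v g (e i z)" "k \<in> {1..n} \<Longrightarrow> spanned v g (y k z)"
    "k \<in> {1..n - 1} \<Longrightarrow> spanned v g (psi k z)"
  using spanned_hom[OF e_hom e_basis_vector assms] spanned_hom[OF y_hom y_basis_vector assms]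
    spanned_hom[OF psi_hom psi_basis_vector assms] by blast+

end
end

section \<open>A representation\<close>

text \<open>
  A row \<open>(u, d, t)\<close> stands for an element of degree \<open>t\<close> at the word \<open>u\<close> in the projective module
  generated in degree 0 at a word with \<open>d\<close> letters \<^term>\<open>True\<close>. Each generator acts by a matrix with at
  most one nonzero entry in each row, so \<open>gen_action\<close> reads off the value at the column of that entry.
\<close>

type_synonym row = "bool list \<times> nat \<times> nat"

text \<open>In degree 2, both \<open>y n\<close> and the square of \<open>psi (n - 1)\<close> must
  read the degree 0 value at the same word. \<open>gen_action\<close> lets psi enter degree 0 only
  at words with \<open>d\<close> letters True, whence the condition.\<close>

definition rows :: "nat \<Rightarrow> row set" where
  "rows n = {(u, d, t). length u + 2 = n \<and> (t = 2 \<longrightarrow> trues u = d)}"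

fun gen_action :: "nat \<Rightarrow> klr_gen \<Rightarrow> (row \<Rightarrow> 'k :: field) \<Rightarrow> row \<Rightarrow> 'k" where
  "gen_action n (Gen_e i) f (u, d, t) = (if residues n (u @ [True]) = i then f (u, d, t) else 0)"
| "gen_action n (Gen_y k) f (u, d, t) = (if k = n \<and> t = 2 then f (u, d, 0) else 0)"
| "gen_action n (Gen_psi k) f (u, d, t) =
    (if k = 1 then 0
     else if k < n - 1 then
       if u ! (k - 2) \<noteq> u ! (k - 1) then f (exchange (k - 2) u, d, t) else 0
     else if t = 1 then if trues (flip_last u) = d then f (flip_last u, d, 0) else 0
     else if t = 2 then if last u then f (flip_last u, d, 1) else - f (flip_last u, d, 1)
     else 0)"

definition word_action :: "nat \<Rightarrow> klr_gen list \<Rightarrow> (row \<Rightarrow> 'k :: field) \<Rightarrow> row \<Rightarrow> 'k" where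
  "word_action n gs f = foldr (gen_action n) gs f"

definition action :: "nat \<Rightarrow> ('k :: field, klr_gen) ncpoly \<Rightarrow> (row \<Rightarrow> 'k) \<Rightarrow> row \<Rightarrow> 'k" where
  "action n p f r = (\<Sum>w\<in>Poly_Mapping.keys p. Poly_Mapping.lookup p w * word_action n (letters w) f r)"

section \<open>Linearity and multiplicativity of the action of the free algebra\<close>

lemma gen_action_linear:
  "gen_action n g (\<lambda>r. a * f r + h r) r = a * gen_action n g f r + gen_action n g h r"
  by (cases r; cases g) (auto simp: algebra_simps)

lemma word_action_linear:
  "word_action n gs (\<lambda>r. a * f r + h r) r = a * word_action n gs f r + word_action n gs h r"
proof (induction gs arbitrary: r)
  case (Cons g gs)
  have "word_action n gs (\<lambda>r. a * f r + h r) = (\<lambda>r. a * word_action n gs f r + word_action n gs h r)"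
    using Cons.IH by blast
  then show ?case
    by (simp add: word_action_def gen_action_linear)
qed (simp add: word_action_def)

lemma word_action_zero: "word_action n gs (\<lambda>_. 0) r = 0"
  using word_action_linear[of n gs "- 1" "\<lambda>_. 0" "\<lambda>_. 0" r] by simp

lemma word_action_scale: "word_action n gs (\<lambda>r. a * f r) r = a * word_action n gs f r"
  using word_action_linear[of n gs a f "\<lambda>_. 0" r] by (simp add: word_action_zero)

lemma word_action_append: "word_action n (gs @ hs) f = word_action n gs (word_action n hs f)"
  by (simp add: word_action_def)

lemma action_superset:
  assumes "finite A" "Poly_Mapping.keys p \<subseteq> A"
  shows "action n p f r = (\<Sum>w\<in>A. Poly_Mapping.lookup p w * word_action n (letters w) f r)"
  unfolding action_def using assms
  by (intro sum.mono_neutral_left) (auto simp: in_keys_iff)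

lemma action_add: "action n (p + q) f r = action n p f r + action n q f r"
proof -
  let ?A = "Poly_Mapping.keys p \<union> Poly_Mapping.keys q"
  show ?thesis
    using action_superset[of ?A p n f r] action_superset[of ?A q n f r]
      action_superset[of ?A "p + q" n f r] Poly_Mapping.keys_add[of p q]
    by (simp add: lookup_add distrib_right sum.distrib)
qed

lemma action_zero [simp]: "action n 0 f r = 0"
  by (simp add: action_def)

lemma action_uminus: "action n (- p) f r = - action n p f r"
  using action_add[of n p "- p" f r] by (simp add: eq_neg_iff_add_eq_0 add.commute)

lemma action_diff: "action n (p - q) f r = action n p f r - action n q f r"
  using action_add[of n p "- q" f r] by (simp add: action_uminus)

lemma action_sum: "action n (\<Sum>i\<in>S. p i) f r = (\<Sum>i\<in>S. action n (p i) f r)"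
  by (induction S rule: infinite_finite_induct) (simp_all add: action_add)

lemma action_single: "action n (Poly_Mapping.single w c) f r = c * word_action n (letters w) f r"
  by (simp add: action_def)

lemma action_one [simp]: "action n 1 f r = f r"
  using action_single[of n 0 1 f r, unfolded single_one] by (simp add: word_action_def zero_free_mon_def)

lemma action_gen [simp]: "action n (gen g) f = gen_action n g f"
  by (rule ext) (simp add: gen_def action_single word_action_def)

lemma action_linear:
  "action n p (\<lambda>r. a * f r + h r) r = a * action n p f r + action n p h r"
  unfolding action_def word_action_linear by (simp add: algebra_simps sum.distrib sum_distrib_left)

lemma ncpoly_induct [case_names zero single add]:
  fixes p :: "('k :: field, 'g) ncpoly"
  assumes "P 0" "\<And>w c. P (Poly_Mapping.single w c)" "\<And>p q. P p \<Longrightarrow> P q \<Longrightarrow> P (p + q)"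
  shows "P p"
proof (induction p rule: update_induct)
  case const
  show ?case by (rule assms(1))
next
  case (update f k v)
  have "Poly_Mapping.update k v f = Poly_Mapping.single k v + f"
    using update.hyps
    by (intro poly_mapping_eqI) (auto simp: lookup_update lookup_add lookup_single when_def in_keys_iff)
  then show ?case
    using assms(2,3) update.IH by simp
qed

lemma action_mult: "action n (p * q) f r = action n p (action n q f) r"
proof (induction p rule: ncpoly_induct)
  case (single w c)
  show ?case
  proof (induction q rule: ncpoly_induct)
    case (single v d)
    have "action n (Poly_Mapping.single v d) f = (\<lambda>r. d * word_action n (letters v) f r)"
      by (rule ext) (simp add: action_single)
    then show ?case
      by (simp add: mult_single action_single word_action_scale word_action_append plus_free_mon_def)
  next
    case (add q q')
    have "action n (q + q') f = (\<lambda>r. 1 * action n q f r + action n q' f r)"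
      by (rule ext) (simp add: action_add)
    then show ?case
      using add action_linear[of n "Poly_Mapping.single w c" 1 "action n q f" "action n q' f" r]
      by (simp add: distrib_left action_add)
  next
    case zero
    have "action n 0 f = (\<lambda>_. 0)"
      by (rule ext) simp
    then show ?case
      by (simp add: action_single word_action_zero)
  qed
qed (simp_all add: distrib_right action_add)

section \<open>Verification of the defining relations on rows\<close>

lemma residues_exchange_iff:
  assumes "length u + 2 = n" "2 \<le> k" "k < n - 1" "u ! (k - 2) \<noteq> u ! (k - 1)" "i \<in> seqs n"
  shows "residues n (exchange (k - 2) u @ [True]) = i \<longleftrightarrow> residues n (u @ [True]) = swap_entries k i"
proof -
  have j: "Suc (k - 2) < length u" "Suc (k - 2) = k - 1" and k: "k \<in> {1..n - 1}" and "k - 2 + 2 = k"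
    using assms by auto
  have "residues n (exchange (k - 2) u @ [True]) = swap_entries k (residues n (u @ [True]))"
    using residues_exchange[of "k - 2" "u @ [True]" n] assms(4) j \<open>k - 2 + 2 = k\<close>
    by (simp add: exchange_snoc nth_append)
  moreover have "residues n (u @ [True]) \<in> seqs n"
    using assms(1) by (intro residues_in_seqs) simp
  ultimately show ?thesis
    using swap_entries_involution[OF _ k] assms(5) by metis
qed

lemma residues_flip_last_iff:
  assumes "length u + 2 = n" "u \<noteq> []" "i \<in> seqs n"
  shows "residues n (flip_last u @ [True]) = i \<longleftrightarrow> residues n (u @ [True]) = swap_entries (n - 1) i"
proof -
  have k: "n - 1 \<in> {1..n - 1}"
    using assms by auto
  have "residues n (u @ [True]) \<in> seqs n"
    using assms(1) by (intro residues_in_seqs) simp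
  then show ?thesis
    using swap_entries_involution[OF _ k] assms(3) residues_flip_last[OF assms(1,2)] by metis
qed

text \<open>The only sign in \<open>gen_action\<close> sits between degrees 1 and 2. It makes the
  square at the last position \<open>y n\<close> or its negative according to the last letter, in
  agreement with \<open>psi_last_sq\<close>.\<close>

lemma psi_sq_action:
  assumes u: "length u + 2 = n" "t = 2 \<longrightarrow> trues u = d" and k: "k \<in> {1..n - 1}"
  shows "gen_action n (Gen_psi k) (gen_action n (Gen_psi k) f) (u, d, t) =
    (if 1 < k \<and> k < n - 1 then if u ! (k - 2) \<noteq> u ! (k - 1) then f (u, d, t) else 0
     else if 1 < k \<and> t = 2 then if last u then f (u, d, 0) else - f (u, d, 0)
     else 0)"
proof -
  consider "k = 1" | "1 < k" "k < n - 1" | "1 < k" "k = n - 1"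
    using k by fastforce
  then show ?thesis
  proof cases
    case 2
    then have "Suc (k - 2) < length u" "Suc (k - 2) = k - 1"
      using u(1) by auto
    then show ?thesis
      using 2 by (simp add: nth_exchange)
  next
    case 3
    then have "u \<noteq> []"
      using u(1) by auto
    then show ?thesis
      using 3 u(2) by (simp add: flip_last_flip_last)
  qed simp
qed

lemma arrow_residues_word:
  assumes "length u + 2 = n" "k \<in> {1..n - 1}" "residues n (u @ [True]) = i"
  defines "right \<equiv> arrow n (entry i k) (entry i (k + 1))" and "left \<equiv> arrow n (entry i (k + 1)) (entry i k)"
  shows "n = 2 \<Longrightarrow> right \<and> left"
    "k = 1 \<Longrightarrow> n > 2 \<Longrightarrow> right \<longleftrightarrow> \<not> left"
    "1 < k \<Longrightarrow> k < n - 1 \<Longrightarrow> u ! (k - 2) = u ! (k - 1) \<Longrightarrow> right \<longleftrightarrow> \<not> left"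
    "1 < k \<Longrightarrow> k < n - 1 \<Longrightarrow> u ! (k - 2) \<noteq> u ! (k - 1) \<Longrightarrow> \<not> right \<and> \<not> left"
    "1 < k \<Longrightarrow> k = n - 1 \<Longrightarrow> (right \<longleftrightarrow> last u) \<and> (left \<longleftrightarrow> \<not> last u)"
proof -
  have len: "Suc (length (u @ [b])) = n" for b
    using assms(1) by simp
  show "n = 2 \<Longrightarrow> right \<and> left"
    using arrow_residues_first[OF len, of True] assms(2,3) by (auto simp: right_def left_def numeral_2_eq_2)
  show "k = 1 \<Longrightarrow> n > 2 \<Longrightarrow> right \<longleftrightarrow> \<not> left"
    using arrow_residues_first[OF len, of True] assms(3) by (auto simp: right_def left_def numeral_2_eq_2)
  have k: "k - 2 + 2 = k" "Suc (k - 2) = k - 1" if "1 < k"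
    using that by auto
  have inner: "k - 1 < length (u @ [True])" "Suc (k - 1) < length (u @ [True])"
    "(u @ [True]) ! (k - 2) = u ! (k - 2)" "(u @ [True]) ! (k - 1) = u ! (k - 1)"
    if "1 < k" "k < n - 1"
    using that assms(1) by (auto simp: nth_append)
  show "right \<longleftrightarrow> \<not> left" if "1 < k" "k < n - 1" "u ! (k - 2) = u ! (k - 1)"
    using arrow_residues_eq[OF len[of True], of "k - 2", unfolded k[OF that(1)] inner(3,4)[OF that(1,2)] assms(3)]
      inner(1)[OF that(1,2)] that(3) unfolding right_def left_def by blast
  show "\<not> right \<and> \<not> left" if "1 < k" "k < n - 1" "u ! (k - 2) \<noteq> u ! (k - 1)"
    using arrow_residues_neq[OF len[of True], of "k - 2", unfolded k[OF that(1)] inner(3,4)[OF that(1,2)] assms(3)]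
      inner(2)[OF that(1,2)] that(3) unfolding right_def left_def by blast
  show "(right \<longleftrightarrow> last u) \<and> (left \<longleftrightarrow> \<not> last u)" if "1 < k" "k = n - 1"
  proof -
    have "u \<noteq> []"
      using that assms(1) by auto
    then obtain v b where v: "u = v @ [b]"
      by (cases u rule: rev_cases) auto
    \<comment> \<open>Taking the forced final letter equal to \<open>b\<close> makes the last two
      letters equal, so the arrow between them is known.\<close>
    have "residues n (u @ [b]) = i" "k - 2 = length v"
      using residues_last[OF assms(1)] assms(1,3) that v by auto
    then show ?thesis
      using arrow_residues_eq[OF len[of b], of "k - 2"] k that v
      by (simp add: right_def left_def nth_append)
  qed
qed

text \<open>Both sides of the braid relation act as zero, so they need not be compared with each
  other.\<close>

lemma braid_action:
  assumes u: "length u + 2 = n" "t = 2 \<longrightarrow> trues u = d" and k: "1 \<le> k" "k + 1 \<le> n - 1"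
  shows "gen_action n (Gen_psi k) (gen_action n (Gen_psi (k + 1)) (gen_action n (Gen_psi k) f)) (u, d, t) = 0"
    "gen_action n (Gen_psi (k + 1)) (gen_action n (Gen_psi k) (gen_action n (Gen_psi (k + 1)) f)) (u, d, t) = 0"
proof -
  consider "k = 1" | "1 < k" "k + 1 < n - 1" | "1 < k" "k + 1 = n - 1"
    using k by fastforce
  then have "gen_action n (Gen_psi k) (gen_action n (Gen_psi (k + 1)) (gen_action n (Gen_psi k) f)) (u, d, t) = 0
    \<and> gen_action n (Gen_psi (k + 1)) (gen_action n (Gen_psi k) (gen_action n (Gen_psi (k + 1)) f)) (u, d, t) = 0"
  proof cases
    case 1
    then show ?thesis
      using k by simp
  next
    case 2
    define j where "j = k - 2"
    have j: "k = Suc (Suc j)" "Suc (Suc j) < length u" "Suc j < length u"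
      using 2 u(1) by (auto simp: j_def)
    show ?thesis
      \<comment> \<open>A nonzero value would require three pairwise distinct letters in a
        two-letter alphabet.\<close>
      using 2(2) j(2,3) unfolding j(1) by (auto simp: nth_exchange)
  next
    case 3
    then have "2 \<le> length u"
      using u(1) by auto
    then obtain v b where v: "u = v @ [b]"
      by (cases u rule: rev_cases) auto
    with \<open>2 \<le> length u\<close> obtain w' a where "v = w' @ [a]"
      by (cases v rule: rev_cases) auto
    with v obtain w where w: "u = w @ [a, b]"
      by simp
    have j: "k = Suc (Suc (length w))" "n = length w + 4"
      using 3 u(1) w by auto
    have ex: "exchange (length w) (w @ [x, x']) = w @ [x', x]" for x x' :: bool
      using exchange_append[of w x x' "[]"] by simp
    have fl: "flip_last (w @ [x, x']) = w @ [x, \<not> x']" for x x'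
      using flip_last_snoc[of "w @ [x]" x'] by simp
    \<comment> \<open>One side reaches equal letters after a single flip. The other flips two equal
      letters, which changes the number of Trues by two and fails the test for entering degree
      0.\<close>
    show ?thesis
      using u(2) unfolding j w by (auto simp: nth_append ex fl)
  qed
  then show "gen_action n (Gen_psi k) (gen_action n (Gen_psi (k + 1)) (gen_action n (Gen_psi k) f)) (u, d, t) = 0"
    "gen_action n (Gen_psi (k + 1)) (gen_action n (Gen_psi k) (gen_action n (Gen_psi (k + 1)) f)) (u, d, t) = 0"
    by blast+
qed

lemma psi_psi_action:
  assumes u: "length u + 2 = n" and k: "k \<in> {1..n - 1}" "l \<in> {1..n - 1}" "k + 1 < l"
  shows "gen_action n (Gen_psi k) (gen_action n (Gen_psi l) f) (u, d, t) =
    gen_action n (Gen_psi l) (gen_action n (Gen_psi k) f) (u, d, t)"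
proof -
  have "k = 1 \<or> k = Suc (Suc (k - 2))" "l < n - 1 \<or> l = n - 1"
    using k by auto
  then consider "k = 1" | j where "k = Suc (Suc j)" "l < n - 1" | j where "k = Suc (Suc j)" "l = n - 1"
    by blast
  then show ?thesis
  proof cases
    case 1
    then show ?thesis
      using k by simp
  next
    case (2 j)
    define m where "m = l - 2"
    have l: "l = Suc (Suc m)" "Suc j < m" "Suc m < length u" "Suc j < length u"
      using 2 k u by (auto simp: m_def)
    then show ?thesis
      using 2 exchange_commute[of j u m] by (auto simp: nth_exchange)
  next
    case (3 j)
    then have j: "Suc (Suc j) < length u" "u \<noteq> []" "Suc j < length u"
      using u k by auto
    note ex = exchange_flip_last[OF j(1)]
    have "trues (flip_last (exchange j u)) = trues (flip_last u)"
      using count_list_exchange[of j "flip_last u" True] j by (simp add: ex(1)[symmetric] length_flip_last)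
    then show ?thesis
      using 3 k j ex by auto
  qed
qed

lemma finite_seqs: "finite (seqs n)"
  by (simp add: seqs_def)

lemma klr_rel_action:
  assumes "1 < n" "klr_rel n l r" "x \<in> rows n"
  shows "action n l f x = action n r f x"
proof -
  obtain u d t where x: "x = (u, d, t)" and u: "length u + 2 = n" "t = 2 \<longrightarrow> trues u = d"
    using assms(3) by (auto simp: rows_def)
  have res: "residues n (u @ [True]) \<in> seqs n"
    using u(1) by (intro residues_in_seqs) simp
  note act = x action_mult action_diff
  note arr = arrow_residues_word[OF u(1)]
  from assms(2) show ?thesis
  proof cases
    case (idem_mult i j)
    then show ?thesis
      by (simp add: act)
  next
    case idem_sum
    then show ?thesis
      using res by (simp add: x action_sum finite_seqs)
  next
    case (dot_idem k i)
    then show ?thesis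
      by (simp add: act)
  next
    case (psi_idem k i)
    consider "k = 1" | "2 \<le> k" "k < n - 1" | "2 \<le> k" "k = n - 1"
      using psi_idem(3) by fastforce
    then show ?thesis
    proof cases
      case 2
      then show ?thesis
        using residues_exchange_iff[OF u(1) 2 _ psi_idem(4)] psi_idem(1,2) by (simp add: act)
    next
      case 3
      then have "u \<noteq> []"
        using u(1) by auto
      then show ?thesis
        using residues_flip_last_iff[OF u(1) _ psi_idem(4)] psi_idem(1,2) 3 by (simp add: act)
    qed (use psi_idem(1,2) in \<open>simp add: act\<close>)
  next
    case (dot_dot k j)
    then show ?thesis
      by (auto simp: act)
  next
    case (psi_dot_far k j)
    then show ?thesis
      by (auto simp: act)
  next
    case (psi_psi_far k j)
    then show ?thesis
      using psi_psi_action[OF u(1), of k j f d t] psi_psi_action[OF u(1), of j k f d t]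
      by (auto simp: act simp del: gen_action.simps)
  next
    case (psi_dot k i)
    then show ?thesis
      by (auto simp: act)
  next
    case (dot_psi k i)
    then show ?thesis
      by (auto simp: act)
  next
    case (braid k i)
    then show ?thesis
      using braid_action[OF u, of k "gen_action n (Gen_e i) f"] by (simp add: act del: gen_action.simps)
  next
    case (psi_sq_none k i)
    show ?thesis
    proof (cases "residues n (u @ [True]) = i")
      case True
      note arr = arr[OF psi_sq_none(3) True]
      have "n \<noteq> 2" "n > 2 \<Longrightarrow> k \<noteq> 1" "1 < k \<Longrightarrow> k \<noteq> n - 1"
        using arr(1,2,5) psi_sq_none(5,6) by blast+
      then have "1 < k" "k < n - 1"
        using psi_sq_none(3) assms(1) by auto
      moreover from this have "u ! (k - 2) \<noteq> u ! (k - 1)"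
        using arr(3) psi_sq_none(5,6) by blast
      ultimately show ?thesis
        using psi_sq_action[OF u psi_sq_none(3), of "gen_action n (Gen_e i) f"] True psi_sq_none(1,2) by (simp add: act del: gen_action.simps(3))
    next
      case False
      then show ?thesis
        using psi_sq_action[OF u psi_sq_none(3), of "gen_action n (Gen_e i) f"] psi_sq_none(1,2) by (simp add: act del: gen_action.simps(3))
    qed
  next
    case (psi_sq_right k i)
    show ?thesis
    proof (cases "residues n (u @ [True]) = i")
      case True
      note arr = arr[OF psi_sq_right(3) True]
      have n: "n \<noteq> 2"
        using arr(1) psi_sq_right(5,6) by blast
      have "u ! (k - 2) = u ! (k - 1)" if "1 < k" "k < n - 1"
        using arr(4) that psi_sq_right(5) by blast
      moreover have "last u" if "1 < k" "k = n - 1"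
        using arr(5) that psi_sq_right(5) by blast
      ultimately show ?thesis
        using psi_sq_action[OF u psi_sq_right(3), of "gen_action n (Gen_e i) f"] True psi_sq_right(1-3) n
        by (auto simp: act simp del: gen_action.simps(3))
    next
      case False
      then show ?thesis
        using psi_sq_action[OF u psi_sq_right(3), of "gen_action n (Gen_e i) f"] psi_sq_right(1,2)
        by (simp add: act del: gen_action.simps(3))
    qed
  next
    case (psi_sq_left k i)
    show ?thesis
    proof (cases "residues n (u @ [True]) = i")
      case True
      note arr = arr[OF psi_sq_left(3) True]
      have n: "n \<noteq> 2"
        using arr(1) psi_sq_left(5,6) by blast
      have "u ! (k - 2) = u ! (k - 1)" if "1 < k" "k < n - 1"
        using arr(4) that psi_sq_left(6) by blast
      moreover have "\<not> last u" if "1 < k" "k = n - 1"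
        using arr(5) that psi_sq_left(6) by blast
      ultimately show ?thesis
        using psi_sq_action[OF u psi_sq_left(3), of "gen_action n (Gen_e i) f"] True psi_sq_left(1-3) n
        by (auto simp: act simp del: gen_action.simps(3))
    next
      case False
      then show ?thesis
        using psi_sq_action[OF u psi_sq_left(3), of "gen_action n (Gen_e i) f"] psi_sq_left(1,2)
        by (simp add: act del: gen_action.simps(3))
    qed
  next
    case (psi_sq_both k i)
    show ?thesis
    proof (cases "residues n (u @ [True]) = i")
      case True
      note arr = arr[OF psi_sq_both(3) True]
      have "\<not> (1 < k \<and> k < n - 1)" "\<not> (1 < k \<and> k = n - 1)" "\<not> (k = 1 \<and> n > 2)"
        using arr(2,3,4,5) psi_sq_both(5,6) by blast+
      then have "n = 2" "k = 1"
        using psi_sq_both(3) assms(1) by auto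
      then show ?thesis
        using psi_sq_both(1,2) by (simp add: act)
    next
      case False
      then show ?thesis
        using psi_sq_action[OF u psi_sq_both(3), of "gen_action n (Gen_e i) f"] psi_sq_both(1,2)
        by (simp add: act del: gen_action.simps(3))
    qed
  qed
qed

text \<open>The column read from a row in \<open>rows n\<close> lies in \<open>rows n\<close> again.
  This lets relations that hold only on these rows be multiplied from the left.\<close>

lemma gen_action_rows:
  assumes "x \<in> rows n" "g \<in> klr_gens n" "\<And>x. x \<in> rows n \<Longrightarrow> f x = h x"
  shows "gen_action n g f x = gen_action n g h x"
proof -
  obtain u d t where x: "x = (u, d, t)" and u: "length u + 2 = n" "t = 2 \<longrightarrow> trues u = d"
    using assms(1) by (auto simp: rows_def)
  have eq: "f (w, d, s) = h (w, d, s)" if "length w = length u" "s \<noteq> 2 \<or> trues w = d" for w s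
    using assms(3)[of "(w, d, s)"] that u(1) by (auto simp: rows_def)
  show ?thesis
  proof (cases g)
    case (Gen_psi k)
    then have "k \<in> {1..n - 1}"
      using assms(2) by (auto simp: klr_gens_def)
    then consider "k = 1" | "1 < k" "k < n - 1" | "1 < k" "k = n - 1"
      by fastforce
    then show ?thesis
    proof cases
      case 2
      then have "Suc (k - 2) < length u"
        using u(1) by auto
      then show ?thesis
        using u 2 by (simp add: x Gen_psi eq)
    next
      case 3
      then have "u \<noteq> []"
        using u(1) by auto
      then show ?thesis
        using u 3 by (simp add: x Gen_psi eq length_flip_last)
    qed (simp add: x Gen_psi)
  qed (use u in \<open>simp_all add: x eq\<close>)
qed

lemma word_action_rows:
  assumes "x \<in> rows n" "set gs \<subseteq> klr_gens n" "\<And>x. x \<in> rows n \<Longrightarrow> f x = h x"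
  shows "word_action n gs f x = word_action n gs h x"
  using assms(1,2)
proof (induction gs arbitrary: x)
  case (Cons g gs)
  then show ?case
    using gen_action_rows[OF Cons.prems(1), of g "word_action n gs f" "word_action n gs h"]
    by (simp add: word_action_def)
qed (simp add: word_action_def assms(3))

lemma action_rows:
  assumes "x \<in> rows n" "p \<in> carrier (klr_free n)" "\<And>x. x \<in> rows n \<Longrightarrow> f x = h x"
  shows "action n p f x = action n p h x"
  unfolding action_def using assms(2) word_action_rows[OF assms(1) _ assms(3)]
  by (intro sum.cong) auto

section \<open>Words for a basis\<close>

definition path_word :: "bool list \<Rightarrow> klr_gen list" where
  "path_word u = map (\<lambda>j. Gen_psi (j + 2)) (sorting_path u)"

definition twist_word :: "nat \<Rightarrow> bool \<Rightarrow> bool list \<Rightarrow> klr_gen list" where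
  "twist_word n b v = (let s = sorted_word (remove1 b v)
    in rev (path_word (s @ [\<not> b])) @ Gen_psi (n - 1) # path_word (s @ [b]))"

text \<open>The outer idempotents select \<open>u\<close> and \<open>v\<close> when the word acts on
  rows. In the algebra the right one supplies the vector that is transported, and the left one fixes
  the result.\<close>

definition basis_word :: "nat \<Rightarrow> bool list \<Rightarrow> bool \<Rightarrow> bool list \<Rightarrow> bool \<Rightarrow> klr_gen list" where
  "basis_word n u p v q =
    Gen_e (residues n (u @ [True])) #
    (if p \<noteq> q then path_word u @ twist_word n p v
     else if p then path_word u else Gen_y n # path_word u) @
    rev (path_word v) @ [Gen_e (residues n (v @ [True]))]"

lemma path_word_step:
  "sorting_path u = l # sorting_path (exchange l u) \<Longrightarrow>
    path_word u = Gen_psi (l + 2) # path_word (exchange l u)"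
  by (simp add: path_word_def)

lemma path_word_gens: "length u + 2 = n \<Longrightarrow> set (path_word u) \<subseteq> klr_gens n"
  using sorting_path_bound[of _ u] by (fastforce simp: path_word_def klr_gens_def)

lemma basis_word_gens:
  assumes "length u + 2 = n" "length v + 2 = n" "trues (u @ [p]) = trues (v @ [q])"
  shows "set (basis_word n u p v q) \<subseteq> klr_gens n"
proof -
  have "residues n (u @ [True]) \<in> seqs n" "residues n (v @ [True]) \<in> seqs n"
    using assms by (auto intro: residues_in_seqs)
  then have e: "Gen_e (residues n (u @ [True])) \<in> klr_gens n" "Gen_e (residues n (v @ [True])) \<in> klr_gens n"
    by (simp_all add: klr_gens_def)
  have y: "Gen_y n \<in> klr_gens n"
    using assms(1) by (auto simp: klr_gens_def)
  have "set (twist_word n p v) \<subseteq> klr_gens n" if "p \<noteq> q"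
  proof -
    have "p \<in> set v"
      using letter_in_word[of u v p q] assms that by simp
    then have len: "length (sorted_word (remove1 p v) @ [b]) + 2 = n" for b
      using sorted_word_replace(3)[of p v] assms(2) by simp
    then have "n > 1"
      by force
    then have "Gen_psi (n - 1) \<in> klr_gens n"
      by (simp add: klr_gens_def)
    then show ?thesis
      using path_word_gens[OF len] by (simp add: twist_word_def Let_def)
  qed
  then show ?thesis
    using e y path_word_gens[OF assms(1)] path_word_gens[OF assms(2)] by (auto simp: basis_word_def)
qed

lemma word_action_Cons: "word_action n (g # gs) f = gen_action n g (word_action n gs f)"
  by (simp add: word_action_def)

lemma word_action_Nil [simp]: "word_action n [] f = f"
  by (simp add: word_action_def)

lemma gen_action_exchange:
  assumes "length u + 2 = n" "descent l u"
  shows "gen_action n (Gen_psi (l + 2)) f (u, d, t) = f (exchange l u, d, t)"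
    "gen_action n (Gen_psi (l + 2)) f (exchange l u, d, t) = f (u, d, t)"
  using descentD[OF assms(2)] assms(1) by (auto simp: nth_exchange)

lemma path_action:
  "length u + 2 = n \<Longrightarrow> word_action n (path_word u) f (u, d, t) = f (sorted_word u, d, t)"
proof (induction u rule: sorting_induct)
  case (sorted u)
  then show ?case
    using no_descent_sorted[of u] by (simp add: path_word_def sorting_path_Nil)
next
  case (step u l)
  have "word_action n (path_word u) f (u, d, t) =
      word_action n (path_word (exchange l u)) f (exchange l u, d, t)"
    unfolding path_word_step[OF step(2)] word_action_Cons
    by (rule gen_action_exchange(1)[OF step(4,1)])
  also have "\<dots> = f (sorted_word u, d, t)"
    using step(3,4) sorted_word_exchange[OF descentD(1)[OF step(1)]] by simp
  finally show ?case .
qed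

lemma back_action:
  "length u + 2 = n \<Longrightarrow> word_action n (rev (path_word u)) f (sorted_word u, d, t) = f (u, d, t)"
proof (induction u arbitrary: f rule: sorting_induct)
  case (sorted u)
  then show ?case
    using no_descent_sorted[of u] by (simp add: path_word_def sorting_path_Nil)
next
  case (step u l)
  have "word_action n (rev (path_word u)) f (sorted_word u, d, t) =
      word_action n (rev (path_word (exchange l u))) (gen_action n (Gen_psi (l + 2)) f)
        (sorted_word (exchange l u), d, t)"
    unfolding path_word_step[OF step(2)] sorted_word_exchange[OF descentD(1)[OF step(1)]]
    by (simp add: word_action_append word_action_Cons del: gen_action.simps)
  also have "\<dots> = gen_action n (Gen_psi (l + 2)) f (exchange l u, d, t)"
    by (rule step(3)) (use step(4) in simp)
  also have "\<dots> = f (u, d, t)"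
    by (rule gen_action_exchange(2)[OF step(4,1)])
  finally show ?case .
qed

text \<open>The flip is read at a row whose word ends in the new letter, the negation of
  \<open>b\<close>; this is why the sign in degree 2 is negative for \<open>b\<close> True.\<close>

lemma twist_action:
  fixes f :: "row \<Rightarrow> 'a :: field"
  assumes "length u + 2 = n" "length v + 2 = n" "trues (u @ [b]) = trues (v @ [\<not> b])"
  shows "word_action n (twist_word n b v) f (sorted_word u, d, t) =
    (if t = 1 then if trues v = d then f (sorted_word v, d, 0) else 0
     else if t = 2 then (if b then - f (sorted_word v, d, 1) else f (sorted_word v, d, 1)) else 0)"
proof -
  have b: "b \<in> set v"
    using letter_in_word[of u v b "\<not> b"] assms by simp
  define s where "s = sorted_word (remove1 b v)"
  have s: "sorted_word (s @ [b]) = sorted_word v" "sorted_word (s @ [\<not> b]) = sorted_word u"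
    "length (s @ [c]) + 2 = n" for c
    using sorted_word_replace[OF b] assms unfolding s_def by simp_all
  have tr: "trues (s @ [b]) = trues v"
    using arg_cong[OF s(1), of trues] by simp
  have n: "n - 1 \<noteq> 1"
    using s(3)[of b] by simp
  have flip: "gen_action n (Gen_psi (n - 1)) g (s @ [\<not> b], d, t) =
      (if t = 1 then if trues (s @ [b]) = d then g (s @ [b], d, 0) else 0
       else if t = 2 then if b then - g (s @ [b], d, 1) else g (s @ [b], d, 1) else 0)" for g :: "row \<Rightarrow> 'a"
    using n by (simp add: flip_last_snoc)
  have "word_action n (twist_word n b v) f (sorted_word u, d, t) =
      gen_action n (Gen_psi (n - 1)) (word_action n (path_word (s @ [b])) f) (s @ [\<not> b], d, t)"
    unfolding twist_word_def Let_def s_def[symmetric] s(2)[symmetric] word_action_append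
      back_action[OF s(3)] word_action_Cons ..
  then show ?thesis
    unfolding flip path_action[OF s(3)] s(1) tr .
qed

text \<open>The dual family: the indicator function of degree 0 at \<open>v\<close>, read at
  \<open>u\<close> in the degree encoded by \<open>p\<close> and \<open>q\<close>, detects exactly
  one basis word. Linear independence and injectivity of the indexing both follow from it.\<close>

lemma basis_word_action:
  fixes u v u' v' :: "bool list" and p q p' q' :: bool and f :: "row \<Rightarrow> 'k :: field"
  assumes len: "length u + 2 = n" "length v + 2 = n" "length u' + 2 = n" "length v' + 2 = n"
    and trues: "trues (u @ [p]) = trues (v @ [q])" "trues (u' @ [p']) = trues (v' @ [q'])"
  defines "d \<equiv> trues v" and "t \<equiv> if p \<noteq> q then 1 else if p then 0 else 2"
    and "f \<equiv> \<lambda>r. if r = (v, trues v, 0) then 1 else 0"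
  shows "word_action n (basis_word n u' p' v' q') f (u, d, t) =
    (if u' = u \<and> p' = p \<and> v' = v \<and> q' = q then 1 else 0)"
proof (cases "u' = u")
  case False
  then have "residues n (u @ [True]) \<noteq> residues n (u' @ [True])"
    using residues_inj[OF len(1,3)] by metis
  then show ?thesis
    using False by (simp add: basis_word_def word_action_Cons)
next
  case True
  define h where "h = word_action n (rev (path_word v') @ [Gen_e (residues n (v' @ [True]))]) f"
  have h: "h (sorted_word v', d, s) = (if v' = v \<and> s = 0 then 1 else 0)" for s
    unfolding h_def word_action_append back_action[OF len(4)]
    by (auto simp: word_action_Cons f_def d_def)
  have "word_action n (basis_word n u' p' v' q') f (u, d, t) =
      word_action n (if p' \<noteq> q' then path_word u @ twist_word n p' v'
        else if p' then path_word u else Gen_y n # path_word u) h (u, d, t)"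
    by (simp add: basis_word_def word_action_Cons h_def True flip: word_action_append)
  also have "\<dots> = (if u' = u \<and> p' = p \<and> v' = v \<and> q' = q then 1 else 0)"
  proof (cases "p' = q'")
    case pq': True
    have "sorted_word u = sorted_word v'"
      using trues(2) len pq' True by (intro sorted_word_cong) simp_all
    then have hu: "h (sorted_word u, d, s) = (if v' = v \<and> s = 0 then 1 else 0)" for s
      using h by simp
    show ?thesis
      by (cases p'; cases p; cases q)
        (simp_all add: pq'[symmetric] True t_def word_action_Cons path_action[OF len(1)] hu)
  next
    case False
    then have q': "q' = (\<not> p')"
      by blast
    have "word_action n (path_word u @ twist_word n p' v') h (u, d, t) =
        (if v' = v \<and> p \<noteq> q then 1 else 0)"
      unfolding word_action_append path_action[OF len(1)]
        twist_action[OF len(1,4) trues(2)[unfolded True q']] h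
      by (auto simp: t_def d_def)
    \<comment> \<open>In degree 1 the numbers of Trues in \<open>u\<close> and \<open>v\<close>
      differ by one, and the sign of the difference determines both extra letters.\<close>
    moreover have "p' = p \<and> q' = q" if "v' = v" "p \<noteq> q"
      using trues that True q' by (cases p; cases p'; cases q) simp_all
    ultimately show ?thesis
      using True False by auto
  qed
  finally show ?thesis .
qed

section \<open>Counting the index set\<close>

definition basis_index :: "nat \<Rightarrow> (bool list \<times> bool list) set" where
  "basis_index n = {(s, t). Suc (length s) = n \<and> Suc (length t) = n \<and> trues s = trues t}"

lemma finite_basis_index: "finite (basis_index n)"
proof (rule finite_subset)
  show "basis_index n \<subseteq> {s. set s \<subseteq> UNIV \<and> length s = n - 1} \<times> {s. set s \<subseteq> UNIV \<and> length s = n - 1}"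
    by (auto simp: basis_index_def)
qed (intro finite_cartesian_product finite_lists_length_eq; simp)+

lemma card_words_trues: "card {w. length w = N \<and> trues w = k} = N choose k"
proof (induction N arbitrary: k)
  case 0
  have "{w. length w = 0 \<and> trues w = k} = (if k = 0 then {[]} else {})"
    by auto
  then show ?case
    by (cases k) simp_all
next
  case (Suc N)
  let ?S = "\<lambda>N k. {w. length w = N \<and> trues w = k}"
  have fin: "finite (?S N k)" for k
    by (rule finite_subset[OF _ finite_lists_length_eq[of UNIV N]]) auto
  have split: "?S (Suc N) k = Cons False ` ?S N k \<union> Cons True ` {w. length w = N \<and> Suc (trues w) = k}"
    by (auto simp: length_Suc_conv image_iff split: if_splits)
  show ?case
  proof (cases k)
    case 0
    then show ?thesis
      using Suc.IH[of 0] unfolding split by (simp add: card_image)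
  next
    case (Suc k')
    have "?S (Suc N) k = Cons False ` ?S N k \<union> Cons True ` ?S N k'"
      using split Suc by simp
    moreover have "card (Cons False ` ?S N k \<union> Cons True ` ?S N k') =
        card (Cons False ` ?S N k) + card (Cons True ` ?S N k')"
      by (rule card_Un_disjoint) (use fin in auto)
    ultimately have "card (?S (Suc N) k) = card (Cons False ` ?S N k) + card (Cons True ` ?S N k')"
      by (simp only:)
    also have "\<dots> = (N choose k) + (N choose k')"
      using Suc.IH by (simp add: card_image)
    finally show ?thesis
      using Suc by simp
  qed
qed

text \<open>Complementing the second word turns equal numbers of Trues into a total of n - 1.
  Concatenation is then a bijective form of the Vandermonde sum.\<close>

lemma card_basis_index:
  assumes "1 \<le> n"
  shows "card (basis_index n) = (2 * (n - 1)) choose (n - 1)"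
proof -
  let ?m = "n - 1"
  have neg: "trues (map Not w) = falses w" for w
    by (induction w) auto
  have "bij_betw (\<lambda>(s, t). s @ map Not t) (basis_index n) {w. length w = 2 * ?m \<and> trues w = ?m}"
  proof (rule bij_betw_byWitness[where f' = "\<lambda>w. (take ?m w, map Not (drop ?m w))"])
    show "\<forall>a\<in>basis_index n. (\<lambda>w. (take ?m w, map Not (drop ?m w))) ((\<lambda>(s, t). s @ map Not t) a) = a"
      using assms by (auto simp: basis_index_def comp_def)
    show "\<forall>w\<in>{w. length w = 2 * ?m \<and> trues w = ?m}.
        (\<lambda>(s, t). s @ map Not t) ((\<lambda>w. (take ?m w, map Not (drop ?m w))) w) = w"
      by (auto simp: comp_def)
    show "(\<lambda>(s, t). s @ map Not t) ` basis_index n \<subseteq> {w. length w = 2 * ?m \<and> trues w = ?m}"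
      using assms trues_plus_falses by (auto simp: basis_index_def neg)
    show "(\<lambda>w. (take ?m w, map Not (drop ?m w))) ` {w. length w = 2 * ?m \<and> trues w = ?m} \<subseteq> basis_index n"
    proof (clarify)
      fix w :: "bool list" assume w: "length w = 2 * ?m" "trues w = ?m"
      have "trues (take ?m w) + trues (drop ?m w) = ?m"
        using w(2) count_list_append[of "take ?m w" "drop ?m w" True] by simp
      moreover have "trues (drop ?m w) + falses (drop ?m w) = ?m"
        using w(1) trues_plus_falses[of "drop ?m w"] by simp
      ultimately show "(take ?m w, map Not (drop ?m w)) \<in> basis_index n"
        using w(1) assms by (simp add: basis_index_def neg)
    qed
  qed
  from bij_betw_same_card[OF this] show ?thesis
    unfolding card_words_trues .
qed

section \<open>The cyclotomic quotient\<close>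

context assoc_algebra
begin

context
  fixes I
  assumes I: "ideal I A"
begin

interpretation I: ideal I A by (rule I)

lemma coset_closed: "x \<in> carrier A \<Longrightarrow> I +>\<^bsub>A\<^esub> x \<in> carrier (quot_algebra A I)"
  by (auto simp: A_RCOSETS_defs a_r_coset_def)

lemma coset_surj: "X \<in> carrier (quot_algebra A I) \<Longrightarrow> \<exists>x\<in>carrier A. X = I +>\<^bsub>A\<^esub> x"
  by (auto simp: A_RCOSETS_defs a_r_coset_def)

lemma coset_add:
  "\<lbrakk>x \<in> carrier A; y \<in> carrier A\<rbrakk> \<Longrightarrow>
    I +>\<^bsub>A\<^esub> (x \<oplus>\<^bsub>A\<^esub> y) = (I +>\<^bsub>A\<^esub> x) \<oplus>\<^bsub>quot_algebra A I\<^esub> (I +>\<^bsub>A\<^esub> y)"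
  by (simp add: I.a_rcos_sum)

lemma coset_mult:
  "\<lbrakk>x \<in> carrier A; y \<in> carrier A\<rbrakk> \<Longrightarrow>
    I +>\<^bsub>A\<^esub> (x \<otimes>\<^bsub>A\<^esub> y) = (I +>\<^bsub>A\<^esub> x) \<otimes>\<^bsub>quot_algebra A I\<^esub> (I +>\<^bsub>A\<^esub> y)"
  by (simp add: I.rcoset_mult_add)

lemma coset_eq_zero_iff:
  "x \<in> carrier A \<Longrightarrow> I +>\<^bsub>A\<^esub> x = \<zero>\<^bsub>quot_algebra A I\<^esub> \<longleftrightarrow> x \<in> I"
  using I.a_rcos_const I.rcos_const_imp_mem by auto

text \<open>Used to bound the cyclotomic ideal, which lives in a quotient, by the image of an ideal
  of the free algebra.\<close>

lemma ideal_coset_image: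
  assumes "ideal J A"
  shows "ideal ((+>\<^bsub>A\<^esub>) I ` J) (quot_algebra A I)"
proof -
  interpret J: ideal J A by fact
  interpret Q: assoc_algebra K "quot_algebra A I"
    by (rule assoc_algebra_quot[OF I])
  have J: "x \<in> carrier A" if "x \<in> J" for x
    using that by (rule J.Icarr)
  show ?thesis
  proof (rule idealI[OF Q.ring_axioms])
    show "subgroup ((+>\<^bsub>A\<^esub>) I ` J) (add_monoid (quot_algebra A I))"
    proof (rule Q.add.subgroupI)
      show "(+>\<^bsub>A\<^esub>) I ` J \<subseteq> carrier (quot_algebra A I)"
        using J coset_closed by blast
      show "(+>\<^bsub>A\<^esub>) I ` J \<noteq> {}"
        using J.zero_closed by blast
    next
      fix X assume "X \<in> (+>\<^bsub>A\<^esub>) I ` J"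
      then obtain x where x: "x \<in> J" "X = I +>\<^bsub>A\<^esub> x" by blast
      have "(I +>\<^bsub>A\<^esub> (\<ominus>\<^bsub>A\<^esub> x)) \<oplus>\<^bsub>quot_algebra A I\<^esub> X = I +>\<^bsub>A\<^esub> \<zero>\<^bsub>A\<^esub>"
        using coset_add[of "\<ominus>\<^bsub>A\<^esub> x" x] J[OF x(1)] x(2) M.l_neg by (simp del: quot_algebra_sel)
      also have "\<dots> = \<zero>\<^bsub>quot_algebra A I\<^esub>"
        using coset_eq_zero_iff[of "\<zero>\<^bsub>A\<^esub>"] by (simp del: quot_algebra_sel)
      finally have "\<ominus>\<^bsub>quot_algebra A I\<^esub> X = I +>\<^bsub>A\<^esub> (\<ominus>\<^bsub>A\<^esub> x)"
        using Q.minus_equality coset_closed J[OF x(1)] x(2) by (simp del: quot_algebra_sel)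
      then show "\<ominus>\<^bsub>quot_algebra A I\<^esub> X \<in> (+>\<^bsub>A\<^esub>) I ` J"
        using x(1) J.a_inv_closed by blast
    next
      fix X Y assume "X \<in> (+>\<^bsub>A\<^esub>) I ` J" "Y \<in> (+>\<^bsub>A\<^esub>) I ` J"
      then show "X \<oplus>\<^bsub>quot_algebra A I\<^esub> Y \<in> (+>\<^bsub>A\<^esub>) I ` J"
        using J coset_add J.a_closed by (auto simp del: quot_algebra_sel simp flip: coset_add)
    qed
  next
    fix X Y assume X: "X \<in> (+>\<^bsub>A\<^esub>) I ` J" and Y: "Y \<in> carrier (quot_algebra A I)"
    obtain x where x: "x \<in> J" "X = I +>\<^bsub>A\<^esub> x" using X by blast
    obtain y where y: "y \<in> carrier A" "Y = I +>\<^bsub>A\<^esub> y" using coset_surj[OF Y] by blast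
    have "Y \<otimes>\<^bsub>quot_algebra A I\<^esub> X = I +>\<^bsub>A\<^esub> (y \<otimes>\<^bsub>A\<^esub> x)"
      "X \<otimes>\<^bsub>quot_algebra A I\<^esub> Y = I +>\<^bsub>A\<^esub> (x \<otimes>\<^bsub>A\<^esub> y)"
      using coset_mult x y J by (simp_all del: quot_algebra_sel)
    then show "Y \<otimes>\<^bsub>quot_algebra A I\<^esub> X \<in> (+>\<^bsub>A\<^esub>) I ` J" "X \<otimes>\<^bsub>quot_algebra A I\<^esub> Y \<in> (+>\<^bsub>A\<^esub>) I ` J"
      using J.I_l_closed[OF x(1) y(1)] J.I_r_closed[OF x(1) y(1)] by blast+
  qed
qed

end

end

section \<open>Classes in the iterated quotient and left multiplication on it\<close>

definition cyc_class :: "nat \<Rightarrow> ('k :: field, klr_gen) ncpoly \<Rightarrow> ('k, klr_gen) ncpoly set set" where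
  "cyc_class n x = cyclotomic_ideal n +>\<^bsub>klr_algebra n\<^esub> klr_class n x"

definition word_monom :: "klr_gen list \<Rightarrow> ('k :: field, klr_gen) ncpoly" where
  "word_monom gs = Poly_Mapping.single (Wrd gs) 1"

lemma word_monom_Nil: "word_monom [] = 1"
  by (simp add: word_monom_def flip: zero_free_mon_def)

lemma word_monom_Cons: "word_monom (g # gs) = gen g * word_monom gs"
  by (simp add: word_monom_def gen_def mult_single plus_free_mon_def)

lemma word_monom_snoc: "word_monom (gs @ [g]) = word_monom gs * gen g"
  by (simp add: word_monom_def gen_def mult_single plus_free_mon_def)

lemma ncpoly_eq_sum: "p = (\<Sum>w\<in>Poly_Mapping.keys p. Poly_Mapping.single 0 (Poly_Mapping.lookup p w) * word_monom (letters w))"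
proof (rule poly_mapping_eqI)
  fix v
  have "(\<Sum>w\<in>Poly_Mapping.keys p. Poly_Mapping.lookup (Poly_Mapping.single w (Poly_Mapping.lookup p w)) v) =
      Poly_Mapping.lookup p v"
    by (simp add: lookup_single when_def in_keys_iff)
  then show "Poly_Mapping.lookup p v = Poly_Mapping.lookup
      (\<Sum>w\<in>Poly_Mapping.keys p. Poly_Mapping.single 0 (Poly_Mapping.lookup p w) * word_monom (letters w)) v"
    by (simp add: lookup_sum word_monom_def mult_single)
qed

lemma action_word_monom: "action n (word_monom gs) f r = word_action n gs f r"
  by (simp add: word_monom_def action_single)

definition basis_element :: "nat \<Rightarrow> bool list \<times> bool list \<Rightarrow> ('k :: field, klr_gen) ncpoly" where
  "basis_element n = (\<lambda>(s, t). word_monom (basis_word n (butlast s) (last s) (butlast t) (last t)))"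

definition lmul :: "nat \<Rightarrow> ('k :: field, klr_gen) ncpoly \<Rightarrow>
    ('k, klr_gen) ncpoly set set \<Rightarrow> ('k, klr_gen) ncpoly set set" where
  "lmul n x z = cyc_class n x \<otimes>\<^bsub>cyclotomic_klr_algebra n\<^esub> z"

context
  fixes n :: nat and F :: "('k :: field, ('k, klr_gen) ncpoly) module"
    and R :: "('k :: field, ('k, klr_gen) ncpoly set set) module"
  assumes n: "1 < n"
  defines "F \<equiv> klr_free n" and "R \<equiv> cyclotomic_klr_algebra n"
begin

interpretation F: assoc_algebra "class_ring :: 'k ring" F
  unfolding F_def by (rule assoc_algebra_free)

interpretation A: assoc_algebra "class_ring :: 'k ring" "klr_algebra n"
  by (rule assoc_algebra_klr)

interpretation R: assoc_algebra "class_ring :: 'k ring" R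
  unfolding R_def by (rule assoc_algebra_cyclotomic_klr) (use n in simp)

lemma ideals: "ideal (klr_ideal n) F" "ideal (cyclotomic_ideal n :: ('k, klr_gen) ncpoly set set) (klr_algebra n)"
proof -
  show "ideal (klr_ideal n) F"
    unfolding F_def by (rule ideal_klr_ideal)
  show "ideal (cyclotomic_ideal n :: ('k, klr_gen) ncpoly set set) (klr_algebra n)"
    by (rule ideal_cyclotomic_ideal) (use n in simp)
qed

lemma F_ops: "x \<otimes>\<^bsub>F\<^esub> y = x * y" "x \<oplus>\<^bsub>F\<^esub> y = x + y" "\<zero>\<^bsub>F\<^esub> = 0" "\<one>\<^bsub>F\<^esub> = 1"
  "c \<odot>\<^bsub>F\<^esub> x = Poly_Mapping.single 0 c * x"
  by (simp_all add: F_def)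

lemma F_closed:
  "0 \<in> carrier F" "1 \<in> carrier F" "Poly_Mapping.single 0 c \<in> carrier F"
  "x \<in> carrier F \<Longrightarrow> - x \<in> carrier F"
  "\<lbrakk>x \<in> carrier F; y \<in> carrier F\<rbrakk> \<Longrightarrow> x + y \<in> carrier F"
  "\<lbrakk>x \<in> carrier F; y \<in> carrier F\<rbrakk> \<Longrightarrow> x - y \<in> carrier F"
  "\<lbrakk>x \<in> carrier F; y \<in> carrier F\<rbrakk> \<Longrightarrow> x * y \<in> carrier F"
  "g \<in> klr_gens n \<Longrightarrow> gen g \<in> carrier F"
  unfolding F_def by (rule free_algebra_closed; assumption?)+

lemma F_rel_closed: "klr_rel n l r \<Longrightarrow> l \<in> carrier F" "klr_rel n l r \<Longrightarrow> r \<in> carrier F"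
  unfolding F_def by (rule klr_rel_closed; assumption)+

lemma klr_class_hom:
  assumes "x \<in> carrier F" "y \<in> carrier F"
  shows "klr_class n (x + y) = klr_class n x \<oplus>\<^bsub>klr_algebra n\<^esub> klr_class n y"
    "klr_class n (x * y) = klr_class n x \<otimes>\<^bsub>klr_algebra n\<^esub> klr_class n y"
    "klr_class n (Poly_Mapping.single 0 c * x) = c \<odot>\<^bsub>klr_algebra n\<^esub> klr_class n x"
    "klr_class n x \<in> carrier (klr_algebra n)"
  using F.coset_add[OF ideals(1) assms] F.coset_mult[OF ideals(1) assms]
    F.quot_algebra_smult[OF ideals(1) _ assms(1), of c] F.coset_closed[OF ideals(1) assms(1)]
  unfolding klr_class_def klr_algebra_def F_ops F_def[symmetric] by (simp_all del: quot_algebra_sel)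

lemma klr_class_eq_zero_iff:
  "x \<in> carrier F \<Longrightarrow> klr_class n x = \<zero>\<^bsub>klr_algebra n\<^esub> \<longleftrightarrow> x \<in> klr_ideal n"
  using F.coset_eq_zero_iff[OF ideals(1)] unfolding klr_class_def klr_algebra_def F_def by blast

lemma cyc_class_hom:
  assumes "x \<in> carrier F" "y \<in> carrier F"
  shows "cyc_class n (x + y) = cyc_class n x \<oplus>\<^bsub>R\<^esub> cyc_class n y"
    "cyc_class n (x * y) = cyc_class n x \<otimes>\<^bsub>R\<^esub> cyc_class n y"
    "cyc_class n (Poly_Mapping.single 0 c * x) = c \<odot>\<^bsub>R\<^esub> cyc_class n x"
    "cyc_class n x \<in> carrier R"
proof -
  note kx = klr_class_hom(4)[OF assms] klr_class_hom(4)[OF assms(2,1)]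
  show "cyc_class n (x + y) = cyc_class n x \<oplus>\<^bsub>R\<^esub> cyc_class n y"
    "cyc_class n (x * y) = cyc_class n x \<otimes>\<^bsub>R\<^esub> cyc_class n y"
    "cyc_class n (Poly_Mapping.single 0 c * x) = c \<odot>\<^bsub>R\<^esub> cyc_class n x"
    "cyc_class n x \<in> carrier R"
    using A.coset_add[OF ideals(2) kx] A.coset_mult[OF ideals(2) kx]
      A.quot_algebra_smult[OF ideals(2) _ kx(1), of c] A.coset_closed[OF ideals(2) kx(1)]
    unfolding cyc_class_def R_def cyclotomic_klr_algebra_def klr_class_hom[OF assms]
    by (simp_all del: quot_algebra_sel)
qed

lemma cyc_class_eq_zero_iff:
  "x \<in> carrier F \<Longrightarrow> cyc_class n x = \<zero>\<^bsub>R\<^esub> \<longleftrightarrow> klr_class n x \<in> cyclotomic_ideal n"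
  unfolding cyc_class_def R_def cyclotomic_klr_algebra_def
  by (rule A.coset_eq_zero_iff[OF ideals(2) klr_class_hom(4)])

lemma cyc_class_surj: "X \<in> carrier R \<Longrightarrow> \<exists>x\<in>carrier F. X = cyc_class n x"
  unfolding cyc_class_def R_def cyclotomic_klr_algebra_def
  using A.coset_surj[OF ideals(2)] F.coset_surj[OF ideals(1)]
  unfolding klr_class_def klr_algebra_def F_def by blast

lemma cyc_class_zero: "cyc_class n 0 = \<zero>\<^bsub>R\<^esub>"
proof -
  have "(0 :: ('k, klr_gen) ncpoly) \<in> klr_ideal n"
    using additive_subgroup.zero_closed[OF ideal.axioms(1)[OF ideals(1)]] by (simp add: F_ops)
  then have "klr_class n (0 :: ('k, klr_gen) ncpoly) = \<zero>\<^bsub>klr_algebra n\<^esub>"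
    using klr_class_eq_zero_iff[OF F_closed(1)] by simp
  then show ?thesis
    using cyc_class_eq_zero_iff[OF F_closed(1)] additive_subgroup.zero_closed[OF ideal.axioms(1)[OF ideals(2)]]
    by simp
qed

lemma cyc_class_diff:
  assumes "x \<in> carrier F" "y \<in> carrier F"
  shows "cyc_class n (x - y) = cyc_class n x \<ominus>\<^bsub>R\<^esub> cyc_class n y"
proof -
  have "cyc_class n x = cyc_class n (x - y) \<oplus>\<^bsub>R\<^esub> cyc_class n y"
    using cyc_class_hom(1)[OF F_closed(6)[OF assms] assms(2)] by simp
  then show ?thesis
    using cyc_class_hom(4)[OF F_closed(6)[OF assms] assms(2)] cyc_class_hom(4)[OF assms(2,1)]
    by (simp add: R.minus_eq R.a_assoc R.r_neg)
qed

lemma cyc_class_rel: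
  fixes l r :: "('k, klr_gen) ncpoly"
  assumes "klr_rel n l r"
  shows "cyc_class n l = cyc_class n r"
proof -
  note lr = F_rel_closed[OF assms]
  have "l - r \<in> klr_ideal n"
    unfolding klr_ideal_def F_def[symmetric]
    by (rule set_mp[OF F.genideal_self])
      (use assms F_rel_closed F_closed(6) in blast)+
  then have "klr_class n (l - r) = \<zero>\<^bsub>klr_algebra n\<^esub>"
    using klr_class_eq_zero_iff[OF F_closed(6)[OF lr]] by simp
  then have "klr_class n l = klr_class n r"
    using klr_class_hom(1)[OF F_closed(6)[OF lr] lr(2)] klr_class_hom(4)[OF lr(2,2)] by simp
  then show ?thesis
    by (simp add: cyc_class_def)
qed

lemma gens_closed:
  "i \<in> seqs n \<Longrightarrow> klr_e i \<in> carrier F" "k \<in> {1..n} \<Longrightarrow> klr_y k \<in> carrier F"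
  "k \<in> {1..n - 1} \<Longrightarrow> klr_psi k \<in> carrier F"
  using F_closed(8) by (auto simp: klr_gens_def)

lemma cyc_class_cyclotomic:
  assumes "i \<in> seqs n"
  shows "entry i 1 = 0 \<Longrightarrow> cyc_class n (klr_y 1 * klr_e i) = \<zero>\<^bsub>R\<^esub>"
    "entry i 1 \<noteq> 0 \<Longrightarrow> cyc_class n (klr_e i) = \<zero>\<^bsub>R\<^esub>"
proof -
  let ?S = "{klr_class n (klr_y 1 * klr_e i) | i. i \<in> seqs n \<and> entry i 1 = 0} \<union>
     {klr_class n (klr_e i) | i. i \<in> seqs n \<and> entry i 1 \<noteq> 0} :: ('k, klr_gen) ncpoly set set"
  have y: "klr_y 1 * klr_e i \<in> carrier F" if "i \<in> seqs n" for i
    using F_closed(7)[OF gens_closed(2)[of 1] gens_closed(1)[OF that]] n by simp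
  have "?S \<subseteq> carrier (klr_algebra n)"
    using klr_class_hom(4) y gens_closed(1) by blast
  then have S: "?S \<subseteq> cyclotomic_ideal n"
    unfolding cyclotomic_ideal_def by (rule A.genideal_self)
  show "entry i 1 = 0 \<Longrightarrow> cyc_class n (klr_y 1 * klr_e i) = \<zero>\<^bsub>R\<^esub>"
    using cyc_class_eq_zero_iff[OF y[OF assms]] S assms by blast
  show "entry i 1 \<noteq> 0 \<Longrightarrow> cyc_class n (klr_e i) = \<zero>\<^bsub>R\<^esub>"
    using cyc_class_eq_zero_iff[OF gens_closed(1)[OF assms]] S assms by blast
qed

lemma lmul_closed: "x \<in> carrier F \<Longrightarrow> z \<in> carrier R \<Longrightarrow> lmul n x z \<in> carrier R"
  using cyc_class_hom(4) unfolding lmul_def R_def[symmetric] by blast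

lemma lmul_mult:
  "\<lbrakk>x \<in> carrier F; y \<in> carrier F; z \<in> carrier R\<rbrakk> \<Longrightarrow> lmul n (x * y) z = lmul n x (lmul n y z)"
  using cyc_class_hom(2,4) unfolding lmul_def R_def[symmetric] by (simp add: R.m_assoc)

lemma lmul_diff:
  "\<lbrakk>x \<in> carrier F; y \<in> carrier F; z \<in> carrier R\<rbrakk> \<Longrightarrow>
    lmul n (x - y) z = lmul n x z \<ominus>\<^bsub>R\<^esub> lmul n y z"
  using cyc_class_diff cyc_class_hom(4) unfolding lmul_def R_def[symmetric]
  by (simp add: R.minus_eq R.l_distr R.l_minus)

lemma lmul_zero: "z \<in> carrier R \<Longrightarrow> lmul n 0 z = \<zero>\<^bsub>R\<^esub>"
  unfolding lmul_def R_def[symmetric] by (simp add: cyc_class_zero)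

lemma lmul_hom: "x \<in> carrier F \<Longrightarrow> lmul n x \<in> hom (add_monoid R) (add_monoid R)"
  using cyc_class_hom(4) unfolding lmul_def R_def[symmetric] by (auto intro!: homI simp: R.r_distr)

lemma lmul_rel:
  fixes l r :: "('k, klr_gen) ncpoly"
  shows "klr_rel n l r \<Longrightarrow> lmul n l z = lmul n r z"
  by (simp add: lmul_def cyc_class_rel)

lemma cyclotomic_klr_module_lmul:
  "cyclotomic_klr_module R n (\<lambda>i. lmul n (klr_e i)) (\<lambda>k. lmul n (klr_y k)) (\<lambda>k. lmul n (klr_psi k))"
proof -
  have suc: "k + 1 \<in> {1..n}" "k \<in> {1..n}" if "k \<in> {1..n - 1}" for k
    using that by auto
  note closed = gens_closed F_closed(6,7) lmul_closed
  note simps = lmul_mult lmul_diff lmul_zero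
  show ?thesis
  proof (intro cyclotomic_klr_module.intro cyclotomic_klr_module_axioms.intro)
    fix i j :: "nat list" and z assume a: "i \<in> seqs n" "j \<in> seqs n" "z \<in> carrier R"
    show "lmul n (klr_e i) (lmul n (klr_e j) z) = (if i = j then lmul n (klr_e i) z else \<zero>\<^bsub>R\<^esub>)"
      using lmul_rel[OF klr_rel.idem_mult[OF a(1,2)], of z] a by (simp add: closed simps split: if_splits)
  next
    fix k i z assume a: "k \<in> {1..n}" "i \<in> seqs n" "z \<in> carrier R"
    show "lmul n (klr_y k) (lmul n (klr_e i) z) = lmul n (klr_e i) (lmul n (klr_y k) z)"
      using lmul_rel[OF klr_rel.dot_idem[OF a(1,2)], of z] a by (simp add: closed simps)
  next
    fix k i z assume a: "k \<in> {1..n - 1}" "i \<in> seqs n" "z \<in> carrier R"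
    show "lmul n (klr_psi k) (lmul n (klr_e i) z) = lmul n (klr_e (swap_entries k i)) (lmul n (klr_psi k) z)"
      using lmul_rel[OF klr_rel.psi_idem[OF a(1,2)], of z] a swap_entries_seqs[OF a(2,1)]
      by (simp add: closed simps)
  next
    fix k l z assume a: "k \<in> {1..n - 1}" "l \<in> {1..n}" "l \<noteq> k" "l \<noteq> k + 1" "z \<in> carrier R"
    show "lmul n (klr_psi k) (lmul n (klr_y l) z) = lmul n (klr_y l) (lmul n (klr_psi k) z)"
      using lmul_rel[OF klr_rel.psi_dot_far[OF a(1-4)], of z] a by (simp add: closed simps)
  next
    fix k l z assume a: "k \<in> {1..n - 1}" "l \<in> {1..n - 1}" "k + 1 < l \<or> l + 1 < k" "z \<in> carrier R"
    show "lmul n (klr_psi k) (lmul n (klr_psi l) z) = lmul n (klr_psi l) (lmul n (klr_psi k) z)"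
      using lmul_rel[OF klr_rel.psi_psi_far[OF a(1-3)], of z] a by (simp add: closed simps)
  next
    fix k i z assume a: "k \<in> {1..n - 1}" "i \<in> seqs n" "z \<in> carrier R"
    show "lmul n (klr_psi k) (lmul n (klr_y (k + 1)) (lmul n (klr_e i) z)) =
        lmul n (klr_y k) (lmul n (klr_psi k) (lmul n (klr_e i) z))"
      using lmul_rel[OF klr_rel.psi_dot[OF a(1,2)], of z] a suc[OF a(1)] by (simp add: closed simps)
    show "lmul n (klr_y (k + 1)) (lmul n (klr_psi k) (lmul n (klr_e i) z)) =
        lmul n (klr_psi k) (lmul n (klr_y k) (lmul n (klr_e i) z))"
      using lmul_rel[OF klr_rel.dot_psi[OF a(1,2)], of z] a suc[OF a(1)] by (simp add: closed simps)
  next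
    fix k i z assume a: "k \<in> {1..n - 1}" "k + 1 \<in> {1..n - 1}" "i \<in> seqs n" "z \<in> carrier R"
    show "lmul n (klr_psi k) (lmul n (klr_psi (k + 1)) (lmul n (klr_psi k) (lmul n (klr_e i) z))) =
        lmul n (klr_psi (k + 1)) (lmul n (klr_psi k) (lmul n (klr_psi (k + 1)) (lmul n (klr_e i) z)))"
      using lmul_rel[OF klr_rel.braid[OF a(1-3)], of z] a by (simp add: closed simps)
  next
    fix k i z assume a: "k \<in> {1..n - 1}" "i \<in> seqs n" "z \<in> carrier R"
      "\<not> arrow n (entry i k) (entry i (k + 1))" "\<not> arrow n (entry i (k + 1)) (entry i k)"
    show "lmul n (klr_psi k) (lmul n (klr_psi k) (lmul n (klr_e i) z)) = lmul n (klr_e i) z"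
      using lmul_rel[OF klr_rel.psi_sq_none[OF a(1,2,4,5)], of z] a by (simp add: closed simps)
  next
    fix k i z assume a: "k \<in> {1..n - 1}" "i \<in> seqs n" "z \<in> carrier R"
      "arrow n (entry i k) (entry i (k + 1))" "\<not> arrow n (entry i (k + 1)) (entry i k)"
    show "lmul n (klr_psi k) (lmul n (klr_psi k) (lmul n (klr_e i) z)) =
        lmul n (klr_y (k + 1)) (lmul n (klr_e i) z) \<ominus>\<^bsub>R\<^esub> lmul n (klr_y k) (lmul n (klr_e i) z)"
      using lmul_rel[OF klr_rel.psi_sq_right[OF a(1,2,4,5)], of z] a suc[OF a(1)]
      by (simp add: closed simps)
  next
    fix k i z assume a: "k \<in> {1..n - 1}" "i \<in> seqs n" "z \<in> carrier R"
      "\<not> arrow n (entry i k) (entry i (k + 1))" "arrow n (entry i (k + 1)) (entry i k)"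
    show "lmul n (klr_psi k) (lmul n (klr_psi k) (lmul n (klr_e i) z)) =
        lmul n (klr_y k) (lmul n (klr_e i) z) \<ominus>\<^bsub>R\<^esub> lmul n (klr_y (k + 1)) (lmul n (klr_e i) z)"
      using lmul_rel[OF klr_rel.psi_sq_left[OF a(1,2,4,5)], of z] a suc[OF a(1)]
      by (simp add: closed simps)
  next
    fix k i z assume a: "k \<in> {1..n - 1}" "i \<in> seqs n" "z \<in> carrier R"
      "arrow n (entry i k) (entry i (k + 1))" "arrow n (entry i (k + 1)) (entry i k)"
    show "lmul n (klr_psi k) (lmul n (klr_psi k) (lmul n (klr_e i) z)) =
        lmul n (klr_y (k + 1)) (lmul n (klr_y k) (lmul n (klr_e i) z) \<ominus>\<^bsub>R\<^esub> lmul n (klr_y (k + 1)) (lmul n (klr_e i) z))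
        \<ominus>\<^bsub>R\<^esub> lmul n (klr_y k) (lmul n (klr_y k) (lmul n (klr_e i) z) \<ominus>\<^bsub>R\<^esub> lmul n (klr_y (k + 1)) (lmul n (klr_e i) z))"
      using lmul_rel[OF klr_rel.psi_sq_both[OF a(1,2,4,5)], of z] a suc[OF a(1)]
      by (simp add: closed simps)
  next
    fix i z assume a: "i \<in> seqs n" "entry i 1 = 0" "z \<in> carrier R"
    have "lmul n (klr_y 1 * klr_e i) z = \<zero>\<^bsub>R\<^esub>"
      using cyc_class_cyclotomic(1)[OF a(1,2)] a(3) by (simp add: lmul_def R_def[symmetric])
    then show "lmul n (klr_y 1) (lmul n (klr_e i) z) = \<zero>\<^bsub>R\<^esub>"
      using a n by (simp add: closed simps)
  next
    fix i z assume a: "i \<in> seqs n" "entry i 1 \<noteq> 0" "z \<in> carrier R"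
    show "lmul n (klr_e i) z = \<zero>\<^bsub>R\<^esub>"
      using cyc_class_cyclotomic(2)[OF a(1,2)] a(3) by (simp add: lmul_def R_def[symmetric])
  qed (use n R.abelian_group_axioms in \<open>auto intro!: lmul_hom gens_closed\<close>)
qed

text \<open>The polynomials acting as zero on all rows form a two-sided ideal \<open>N\<close>
  containing the relations and the lifts of the cyclotomic generators. Thus the action factors
  through the quotient without being defined on cosets of cosets.\<close>

lemma action_cyc_class_zero:
  assumes "x \<in> carrier F" "cyc_class n x = \<zero>\<^bsub>R\<^esub>" "r \<in> rows n"
  shows "action n x f r = 0"
proof -
  define N where "N = {x \<in> carrier F. \<forall>f. \<forall>r\<in>rows n. action n x f r = 0}"
  have N: "ideal N F"
  proof (rule idealI[OF F.ring_axioms])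
    have minus: "\<ominus>\<^bsub>F\<^esub> x = - x" if "x \<in> carrier F" for x
      using F.minus_equality[of "- x" x] F_closed(4)[OF that] that by (simp add: F_ops)
    show "subgroup N (add_monoid F)"
      by (rule F.add.subgroupI)
        (auto simp: N_def F_ops minus action_add action_uminus F_closed intro: exI[of _ 0])
  next
    fix x z assume x: "x \<in> N" and z: "z \<in> carrier F"
    then have carr: "x \<in> carrier F" "z * x \<in> carrier F" "x * z \<in> carrier F"
      using F_closed(7) by (auto simp: N_def)
    have "action n (z * x) f r = 0" if "r \<in> rows n" for f r
    proof -
      \<comment> \<open>\<open>x\<close> is known to act as zero only on \<open>rows n\<close>; this
        is enough because \<open>action n z\<close> evaluated there reads no other row.\<close>
      have "action n z (action n x f) r = action n z (\<lambda>_. 0) r"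
        by (rule action_rows[OF that]) (use x z in \<open>simp_all add: N_def F_def\<close>)
      then show ?thesis
        by (simp add: action_mult action_def[of n z "\<lambda>_. 0"] word_action_zero)
    qed
    then show "z \<otimes>\<^bsub>F\<^esub> x \<in> N"
      using carr by (simp add: N_def F_ops)
    show "x \<otimes>\<^bsub>F\<^esub> z \<in> N"
      using carr x by (simp add: N_def F_ops action_mult)
  qed
  have "klr_ideal n \<subseteq> N"
    unfolding klr_ideal_def F_def[symmetric]
  proof (rule F.genideal_minimal[OF N])
    show "{l - r |l r. klr_rel n l r} \<subseteq> N"
      using F_rel_closed F_closed(6) klr_rel_action[OF n]
      by (auto simp: N_def action_diff)
  qed
  have "cyclotomic_ideal n \<subseteq> klr_class n ` N"
    unfolding cyclotomic_ideal_def
  proof (rule A.genideal_minimal)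
    show "ideal (klr_class n ` N) (klr_algebra n :: ('k, _) module)"
      using F.ideal_coset_image[OF ideals(1) N] unfolding klr_class_def klr_algebra_def F_def .
    have "klr_y 1 * klr_e i \<in> N" if "i \<in> seqs n" for i
      using that n F_closed(7)[OF gens_closed(2)[of 1] gens_closed(1)[OF that]]
      by (auto simp: N_def action_mult rows_def)
    moreover have "klr_e i \<in> N" if "i \<in> seqs n" "entry i 1 \<noteq> 0" for i
      using that gens_closed(1)[OF that(1)] by (auto simp: N_def rows_def entry_def residues_def)
    ultimately show "{klr_class n (klr_y 1 * klr_e i) |i. i \<in> seqs n \<and> entry i 1 = 0} \<union>
        {klr_class n (klr_e i) |i. i \<in> seqs n \<and> entry i 1 \<noteq> 0} \<subseteq> klr_class n ` N"
      by blast
  qed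
  \<comment> \<open>Membership in the image only gives some \<open>x'\<close> in \<open>N\<close>
    with the same class as \<open>x\<close>. Their difference lies in \<open>klr_ideal n\<close>,
    hence in \<open>N\<close> too.\<close>
  then obtain x' where x': "x' \<in> N" "klr_class n x = klr_class n x'"
    using assms(1,2) cyc_class_eq_zero_iff by blast
  have x'F: "x' \<in> carrier F"
    using x'(1) by (simp add: N_def)
  have "klr_class n (x - x') \<oplus>\<^bsub>klr_algebra n\<^esub> klr_class n x' = klr_class n x'"
    using klr_class_hom(1)[OF F_closed(6)[OF assms(1) x'F] x'F] x'(2) by simp
  then have "klr_class n (x - x') = \<zero>\<^bsub>klr_algebra n\<^esub>"
    using A.add.r_cancel_one klr_class_hom(4) F_closed(6)[OF assms(1) x'F] x'F by simp
  then have "x - x' \<in> N"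
    using klr_class_eq_zero_iff[OF F_closed(6)[OF assms(1) x'F]] \<open>klr_ideal n \<subseteq> N\<close> by auto
  then show ?thesis
    using x'(1) assms(3) by (auto simp: N_def action_diff)
qed

section \<open>Spanning\<close>

interpretation M: cyclotomic_klr_module R n
  "\<lambda>i. lmul n (klr_e i)" "\<lambda>k. lmul n (klr_y k)" "\<lambda>k. lmul n (klr_psi k)"
  by (rule cyclotomic_klr_module_lmul)

abbreviation "lmul_word \<equiv> foldr (\<lambda>g. lmul n (gen g :: ('k, klr_gen) ncpoly))"

abbreviation "idem v \<equiv> cyc_class n (klr_e (residues n (v @ [True])) :: ('k, klr_gen) ncpoly)"

lemma word_monom_closed: "set gs \<subseteq> klr_gens n \<Longrightarrow> word_monom gs \<in> carrier F"
  by (induction gs) (simp_all add: word_monom_Nil word_monom_Cons F_closed)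

lemma cyc_class_word_monom_snoc:
  assumes "set gs \<subseteq> klr_gens n" "g \<in> klr_gens n"
  shows "cyc_class n (word_monom (gs @ [g])) = lmul_word gs (cyc_class n (gen g))"
  using assms(1)
proof (induction gs)
  case Nil
  show ?case
    by (simp add: word_monom_def gen_def)
next
  case (Cons h gs)
  have "word_monom (gs @ [g]) \<in> carrier F" "gen h \<in> carrier F"
    using Cons.prems assms(2) word_monom_closed[of "gs @ [g]"] F_closed(8) by simp_all
  then show ?case
    using Cons cyc_class_hom(2)[of "gen h" "word_monom (gs @ [g])"] by (simp add: word_monom_Cons lmul_def R_def)
qed

lemma cyc_class_e_weight:
  assumes "i \<in> seqs n"
  shows "cyc_class n (klr_e i) \<in> M.weight i"
proof -
  have "cyc_class n (klr_e i * klr_e i) = cyc_class n (klr_e i :: ('k, klr_gen) ncpoly)"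
    using cyc_class_rel[OF klr_rel.idem_mult[OF assms assms]] by simp
  moreover have "cyc_class n (klr_e i * klr_e i) = lmul n (klr_e i) (cyc_class n (klr_e i :: ('k, klr_gen) ncpoly))"
    using cyc_class_hom(2)[OF gens_closed(1)[OF assms] gens_closed(1)[OF assms]] by (simp add: lmul_def R_def)
  ultimately show ?thesis
    using cyc_class_hom(4)[OF gens_closed(1)[OF assms] gens_closed(1)[OF assms]] by (simp add: M.weight_def)
qed

lemma idem_wspace: "M.is_word v \<Longrightarrow> idem v \<in> M.wspace v"
  unfolding M.wspace_def by (rule cyc_class_e_weight[OF M.residues_word_seqs])

lemma lmul_word_transport:
  "lmul_word (path_word u) h = M.transport u h" "lmul_word (rev (path_word u)) h = M.untransport u h"
  by (simp_all add: path_word_def M.transport_def M.untransport_def foldr_map comp_def rev_map)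

lemma cyc_class_basis_word:
  assumes "M.is_word u" "M.is_word v" "trues (u @ [p]) = trues (v @ [q])"
  shows "cyc_class n (word_monom (basis_word n u p v q)) = M.basis_vector u p v q (idem v)"
proof -
  let ?W = "if p \<noteq> q then path_word u @ twist_word n p v else if p then path_word u else Gen_y n # path_word u"
  have gens: "set (basis_word n u p v q) \<subseteq> klr_gens n"
    using assms by (intro basis_word_gens) (simp_all add: M.is_word_def)
  have twist: "lmul_word (twist_word n p v) h = M.twist p v h" for p h
    unfolding twist_word_def Let_def M.twist_def foldr_append comp_def foldr_Cons lmul_word_transport ..
  have "cyc_class n (word_monom (basis_word n u p v q)) =
      lmul n (klr_e (residues n (u @ [True]))) (lmul_word ?W (M.untransport v (idem v)))"
    using cyc_class_word_monom_snoc[of "Gen_e (residues n (u @ [True])) # ?W @ rev (path_word v)"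
        "Gen_e (residues n (v @ [True]))"] gens
    by (simp add: basis_word_def lmul_word_transport split del: if_split)
  also have "lmul_word ?W (M.untransport v (idem v)) = M.basis_vector u p v q (idem v)"
    by (simp add: M.basis_vector_def lmul_word_transport twist)
  finally show ?thesis
    using M.basis_vector_wspace[OF assms(2) idem_wspace[OF assms(2)] assms(1,3)]
    by (simp add: M.wspace_def M.weight_def)
qed

abbreviation "basis_image \<equiv> (\<lambda>i. cyc_class n (basis_element n i :: ('k, klr_gen) ncpoly)) ` basis_index n"

lemma basis_indexE:
  assumes "i \<in> basis_index n"
  obtains u p v q where "i = (u @ [p], v @ [q])" "M.is_word u" "M.is_word v"
    "trues (u @ [p]) = trues (v @ [q])"
proof -
  obtain s t where i: "i = (s, t)" and st: "Suc (length s) = n" "Suc (length t) = n" "trues s = trues t"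
    using assms by (auto simp: basis_index_def)
  have "s = butlast s @ [last s]" "t = butlast t @ [last t]"
    using st n by (cases s rule: rev_cases; cases t rule: rev_cases; simp)+
  moreover have "length (butlast s) + 2 = n" "length (butlast t) + 2 = n"
    using st n by simp_all
  ultimately show ?thesis
    using i st(3) by (intro that[of "butlast s" "last s" "butlast t" "last t"]) (simp_all add: M.is_word_def)
qed

lemma basis_element_closed: "i \<in> basis_index n \<Longrightarrow> basis_element n i \<in> carrier F"
proof (erule basis_indexE)
  fix u p v q
  assume "i = (u @ [p], v @ [q])" "M.is_word u" "M.is_word v" "trues (u @ [p]) = trues (v @ [q])"
  then show "basis_element n i \<in> carrier F"
    using word_monom_closed[OF basis_word_gens[of u n v p q]] by (simp add: basis_element_def M.is_word_def)
qed

lemma basis_image_closed: "basis_image \<subseteq> carrier R"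
  using cyc_class_hom(4) basis_element_closed by blast

interpretation S: submodule "class_ring :: 'k ring" "R.span basis_image" R
  by (rule R.span_is_submodule[OF basis_image_closed])

lemma spanned_in_span:
  assumes "M.is_word v" "M.spanned v (idem v) z"
  shows "z \<in> R.span basis_image"
proof -
  have basis: "M.basis_vector u p v q (idem v) \<in> R.span basis_image"
    if "M.is_word u" "trues (u @ [p]) = trues (v @ [q])" for u p q
  proof -
    have "(u @ [p], v @ [q]) \<in> basis_index n"
      using that assms(1) n by (auto simp: basis_index_def M.is_word_def)
    then have "M.basis_vector u p v q (idem v) \<in> basis_image"
      using cyc_class_basis_word[OF that(1) assms(1) that(2)]
      by (intro image_eqI[of _ _ "(u @ [p], v @ [q])"]) (simp_all add: basis_element_def)
    then show ?thesis
      using R.in_own_span[OF basis_image_closed] by blast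
  qed
  have neg: "\<ominus>\<^bsub>R\<^esub> x \<in> R.span basis_image" if "x \<in> R.span basis_image" for x
  proof -
    have x: "x \<in> carrier R"
      using that S.subset by blast
    have "(- 1) \<odot>\<^bsub>R\<^esub> x \<oplus>\<^bsub>R\<^esub> 1 \<odot>\<^bsub>R\<^esub> x = \<zero>\<^bsub>R\<^esub>"
      using R.smult_l_distr[of "- 1" 1 x] R.smult_l_null[of x] x by (simp add: class_ring_simps)
    then have "\<ominus>\<^bsub>R\<^esub> x = (- 1) \<odot>\<^bsub>R\<^esub> x"
      using R.minus_equality R.smult_one[of x] R.smult_closed[of "- 1" x] x by simp
    then show ?thesis
      using S.smult_closed[of "- 1" x] that by simp
  qed
  show ?thesis
    using assms(2) basis neg S.zero_closed unfolding M.spanned_def by auto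
qed

lemma lmul_word_zero: "set gs \<subseteq> klr_gens n \<Longrightarrow> lmul_word gs \<zero>\<^bsub>R\<^esub> = \<zero>\<^bsub>R\<^esub>"
  by (induction gs) (simp_all add: M.hom_zero[OF lmul_hom] F_closed)

lemma lmul_word_spanned:
  assumes "M.is_word v"
  shows "set gs \<subseteq> klr_gens n \<Longrightarrow> M.spanned v (idem v) (lmul_word gs (idem v))"
proof (induction gs)
  case Nil
  show ?case
    using M.spanned_generator[OF assms idem_wspace[OF assms]] by simp
next
  case (Cons g gs)
  then have "M.spanned v (idem v) (lmul_word gs (idem v))" "g \<in> klr_gens n"
    by simp_all
  then show ?case
    using M.spanned_generators[OF assms idem_wspace[OF assms]] by (auto simp: klr_gens_def)
qed

text \<open>Either the class of \<open>klr_e i\<close> is zero, or \<open>weight_residues\<close>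
  makes \<open>i\<close> the residue sequence of a word, and all monomials applied to its idempotent
  are signed basis vectors or zero.\<close>

lemma word_monom_e_in_span:
  assumes "set gs \<subseteq> klr_gens n" "i \<in> seqs n"
  shows "cyc_class n (word_monom gs * klr_e i) \<in> R.span basis_image"
proof -
  have g: "Gen_e i \<in> klr_gens n"
    using assms(2) by (simp add: klr_gens_def)
  have "cyc_class n (word_monom gs * klr_e i) = lmul_word gs (cyc_class n (klr_e i))"
    using cyc_class_word_monom_snoc[OF assms(1) g] by (simp add: word_monom_snoc)
  moreover have "lmul_word gs (cyc_class n (klr_e i)) \<in> R.span basis_image"
  proof (cases "cyc_class n (klr_e i) = \<zero>\<^bsub>R\<^esub>")
    case True
    then show ?thesis
      using lmul_word_zero[OF assms(1)] S.zero_closed by simp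
  next
    case False
    then obtain w where w: "Suc (length w) = n" "i = residues n w"
      using M.weight_residues[OF assms(2) cyc_class_e_weight[OF assms(2)]] by blast
    then obtain v b where v: "w = v @ [b]" "M.is_word v"
      using n by (cases w rule: rev_cases) (auto simp: M.is_word_def)
    then have "i = residues n (v @ [True])"
      using w(2) residues_last[of v n b True] by (simp add: M.is_word_def)
    then show ?thesis
      using spanned_in_span[OF v(2) lmul_word_spanned[OF v(2) assms(1)]] by simp
  qed
  ultimately show ?thesis
    by simp
qed

lemma cyc_class_sum_in_span:
  assumes "finite S" "\<And>i. i \<in> S \<Longrightarrow> x i \<in> carrier F \<and> cyc_class n (x i) \<in> R.span basis_image"
  shows "(\<Sum>i\<in>S. x i) \<in> carrier F \<and> cyc_class n (\<Sum>i\<in>S. x i) \<in> R.span basis_image"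
  using assms
proof (induction S)
  case empty
  then show ?case
    using F_closed(1) S.zero_closed by (simp add: cyc_class_zero)
next
  case (insert i S)
  then have "x i \<in> carrier F" "(\<Sum>i\<in>S. x i) \<in> carrier F" "cyc_class n (x i) \<in> R.span basis_image"
    "cyc_class n (\<Sum>i\<in>S. x i) \<in> R.span basis_image"
    by simp_all
  then show ?case
    using insert.hyps F_closed(5) cyc_class_hom(1) S.m_closed by simp
qed

text \<open>Inserting the sum of all idempotents on the right reduces a monomial to the previous
  case.\<close>

lemma word_monom_in_span:
  assumes "set gs \<subseteq> klr_gens n"
  shows "cyc_class n (word_monom gs) \<in> R.span basis_image"
proof -
  have e: "(\<Sum>i\<in>S. klr_e i) \<in> carrier F" if "S \<subseteq> seqs n" for S
    using that by (induction S rule: infinite_finite_induct) (simp_all add: F_closed gens_closed)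
  have "cyc_class n (word_monom gs) = cyc_class n (word_monom gs * 1)"
    by simp
  also have "\<dots> = cyc_class n (word_monom gs) \<otimes>\<^bsub>R\<^esub> cyc_class n 1"
    by (rule cyc_class_hom(2)[OF word_monom_closed[OF assms] F_closed(2)])
  also have "\<dots> = cyc_class n (word_monom gs) \<otimes>\<^bsub>R\<^esub> cyc_class n (\<Sum>i\<in>seqs n. klr_e i)"
    by (simp only: cyc_class_rel[OF klr_rel.idem_sum])
  also have "\<dots> = cyc_class n (word_monom gs * (\<Sum>i\<in>seqs n. klr_e i))"
    by (rule cyc_class_hom(2)[OF word_monom_closed[OF assms] e[OF subset_refl], symmetric])
  also have "\<dots> = cyc_class n (\<Sum>i\<in>seqs n. word_monom gs * klr_e i)"
    by (simp add: sum_distrib_left)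
  also have "\<dots> \<in> R.span basis_image"
    using cyc_class_sum_in_span[OF finite_seqs, of n "\<lambda>i. word_monom gs * klr_e i"] word_monom_e_in_span[OF assms]
      F_closed(7)[OF word_monom_closed[OF assms] gens_closed(1)] by blast
  finally show ?thesis .
qed

lemma span_basis_image: "R.span basis_image = carrier R"
proof
  show "R.span basis_image \<subseteq> carrier R"
    by (rule S.subset)
  show "carrier R \<subseteq> R.span basis_image"
  proof
    fix X assume "X \<in> carrier R"
    then obtain x where x: "x \<in> carrier F" "X = cyc_class n x"
      using cyc_class_surj by blast
    let ?t = "\<lambda>w. Poly_Mapping.single 0 (Poly_Mapping.lookup x w) * word_monom (letters w)"
    have "?t w \<in> carrier F \<and> cyc_class n (?t w) \<in> R.span basis_image" if "w \<in> Poly_Mapping.keys x" for w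
    proof -
      have gs: "set (letters w) \<subseteq> klr_gens n"
        using x(1) that by (auto simp: F_def)
      have "cyc_class n (?t w) = Poly_Mapping.lookup x w \<odot>\<^bsub>R\<^esub> cyc_class n (word_monom (letters w))"
        using cyc_class_hom(3)[OF word_monom_closed[OF gs] word_monom_closed[OF gs]] .
      also have "\<dots> \<in> R.span basis_image"
        by (rule S.smult_closed[OF _ word_monom_in_span[OF gs]]) simp
      finally show ?thesis
        using F_closed(7)[OF F_closed(3) word_monom_closed[OF gs]] by simp
    qed
    then have "cyc_class n (\<Sum>w\<in>Poly_Mapping.keys x. ?t w) \<in> R.span basis_image"
      using cyc_class_sum_in_span[OF finite_keys, of x ?t] by blast
    then show "X \<in> R.span basis_image"
      unfolding x(2) by (subst ncpoly_eq_sum)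
  qed
qed

section \<open>Linear independence and the dimension\<close>

lemma basis_element_action:
  assumes "i \<in> basis_index n"
  obtains f r where "r \<in> rows n"
    "\<And>j. j \<in> basis_index n \<Longrightarrow>
      action n (basis_element n j :: ('k, klr_gen) ncpoly) f r = (if j = i then 1 else 0)"
proof -
  obtain u p v q where i: "i = (u @ [p], v @ [q])" and u: "length u + 2 = n" and v: "length v + 2 = n"
    and tr: "trues (u @ [p]) = trues (v @ [q])"
    using basis_indexE[OF assms] unfolding M.is_word_def by metis
  let ?t = "if p \<noteq> q then 1 else if p then 0 else 2 :: nat"
  let ?f = "\<lambda>r. if r = (v, trues v, 0) then 1 else 0 :: 'k"
  show ?thesis
  proof (rule that)
    show "(u, trues v, ?t) \<in> rows n"
      using u tr by (auto simp: rows_def)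
    fix j assume "j \<in> basis_index n"
    then obtain u' p' v' q' where j: "j = (u' @ [p'], v' @ [q'])" "length u' + 2 = n" "length v' + 2 = n"
      "trues (u' @ [p']) = trues (v' @ [q'])"
      using basis_indexE unfolding M.is_word_def by metis
    show "action n (basis_element n j) ?f (u, trues v, ?t) = (if j = i then 1 else 0)"
      using basis_word_action[OF u v j(2,3) tr j(4)] by (simp add: i j(1) basis_element_def action_word_monom)
  qed
qed

text \<open>Evaluating the combination with the test function and row of index \<open>i\<close>
  returns the coefficient \<open>c i\<close>, while a vanishing class forces the value 0.\<close>

lemma combination_zero:
  assumes "cyc_class n (\<Sum>i\<in>basis_index n. Poly_Mapping.single 0 (c i) * basis_element n i) = \<zero>\<^bsub>R\<^esub>"
    "i \<in> basis_index n"
  shows "c i = 0"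
proof -
  obtain f r where r: "r \<in> rows n" "\<And>j. j \<in> basis_index n \<Longrightarrow>
      action n (basis_element n j :: ('k, klr_gen) ncpoly) f r = (if j = i then 1 else 0)"
    using basis_element_action[OF assms(2)] by blast
  have carr: "(\<Sum>i\<in>S. Poly_Mapping.single 0 (c i) * basis_element n i) \<in> carrier F"
    if "S \<subseteq> basis_index n" for S
    using that by (induction S rule: infinite_finite_induct) (simp_all add: F_closed basis_element_closed)
  have "action n (\<Sum>j\<in>basis_index n. Poly_Mapping.single 0 (c j) * basis_element n j) f r =
      (\<Sum>j\<in>basis_index n. if j = i then c j else 0)"
    unfolding action_sum
    by (rule sum.cong) (simp_all add: action_mult action_single zero_free_mon_def r(2))
  also have "\<dots> = c i"
    using assms(2) finite_basis_index[of n] by simp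
  finally show ?thesis
    using action_cyc_class_zero[OF carr[OF subset_refl] assms(1) r(1)] by simp
qed

lemma inj_basis_image: "inj_on (\<lambda>i. cyc_class n (basis_element n i :: ('k, klr_gen) ncpoly)) (basis_index n)"
proof (rule inj_onI, rule ccontr)
  fix i j assume ij: "i \<in> basis_index n" "j \<in> basis_index n" "i \<noteq> j"
    and eq: "cyc_class n (basis_element n i) = cyc_class n (basis_element n j :: ('k, klr_gen) ncpoly)"
  obtain f r where r: "r \<in> rows n" "\<And>j. j \<in> basis_index n \<Longrightarrow>
      action n (basis_element n j :: ('k, klr_gen) ncpoly) f r = (if j = i then 1 else 0)"
    using basis_element_action[OF ij(1)] by blast
  note carr = basis_element_closed[OF ij(1)] basis_element_closed[OF ij(2)]
  have "cyc_class n (basis_element n i - basis_element n j :: ('k, klr_gen) ncpoly) = \<zero>\<^bsub>R\<^esub>"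
    using cyc_class_diff[OF carr] eq cyc_class_hom(4)[OF carr(2,2)] by (simp add: R.minus_eq R.r_neg)
  then show False
    using action_cyc_class_zero[OF F_closed(6)[OF carr] _ r(1), of f] r(2)[OF ij(1)] r(2)[OF ij(2)] ij(3)
    by (simp add: action_diff)
qed

text \<open>Coefficients are attached to classes, the sum runs over indices. By
  \<open>inj_basis_image\<close> no class is counted twice, so a linear combination lifts to one
  polynomial.\<close>

lemma lincomb_basis_image:
  assumes "S \<subseteq> basis_index n"
  shows "R.lincomb a ((\<lambda>i. cyc_class n (basis_element n i)) ` S) =
    cyc_class n (\<Sum>i\<in>S. Poly_Mapping.single 0 (a (cyc_class n (basis_element n i))) * basis_element n i)"
proof -
  let ?b = "\<lambda>i. cyc_class n (basis_element n i :: ('k, klr_gen) ncpoly)"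
  let ?x = "\<lambda>i. Poly_Mapping.single 0 (a (?b i)) * basis_element n i"
  have carr: "?x i \<in> carrier F" if "i \<in> basis_index n" for i
    using that by (simp add: F_closed basis_element_closed)
  have sum: "(\<Sum>i\<in>S. ?x i) \<in> carrier F" if "S \<subseteq> basis_index n" for S
    using that by (induction S rule: infinite_finite_induct) (simp_all add: F_closed(1,5) carr)
  have "finite S"
    using assms finite_basis_index by (rule finite_subset)
  then show ?thesis
    using assms
  proof (induction S)
    case empty
    show ?case
      by (simp add: R.lincomb_def cyc_class_zero)
  next
    case (insert i S)
    have i: "i \<in> basis_index n" and S: "S \<subseteq> basis_index n"
      using insert.prems by simp_all
    have "?b i \<notin> ?b ` S"
      using inj_on_image_mem_iff[OF inj_basis_image i S] insert.hyps(2) by simp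
    moreover have "?b ` S \<subseteq> carrier R" "?b i \<in> carrier R"
      using basis_image_closed i S by blast+
    ultimately have "R.lincomb a (?b ` S \<union> {?b i}) = a (?b i) \<odot>\<^bsub>R\<^esub> ?b i \<oplus>\<^bsub>R\<^esub> R.lincomb a (?b ` S)"
      using insert.hyps(1) by (intro R.lincomb_insert) simp_all
    also have "\<dots> = cyc_class n (?x i) \<oplus>\<^bsub>R\<^esub> cyc_class n (\<Sum>i\<in>S. ?x i)"
      using insert.IH[OF S] cyc_class_hom(3)[OF basis_element_closed[OF i] basis_element_closed[OF i]] by simp
    also have "\<dots> = cyc_class n (\<Sum>i\<in>insert i S. ?x i)"
      using cyc_class_hom(1)[OF carr[OF i] sum[OF S]] insert.hyps by simp
    finally show ?case
      by simp
  qed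
qed

lemma basis_basis_image: "R.basis basis_image"
proof -
  have "R.lin_indpt basis_image"
  proof (rule R.finite_lin_indpt2[OF finite_imageI[OF finite_basis_index] basis_image_closed])
    fix a assume a: "R.lincomb a basis_image = \<zero>\<^bsub>R\<^esub>"
    show "\<forall>X\<in>basis_image. a X = \<zero>\<^bsub>class_ring\<^esub>"
    proof
      fix X assume "X \<in> basis_image"
      then obtain i where i: "i \<in> basis_index n" "X = cyc_class n (basis_element n i)"
        by blast
      show "a X = \<zero>\<^bsub>class_ring\<^esub>"
        using combination_zero[OF a[unfolded lincomb_basis_image[OF subset_refl]] i(1)] i(2) by simp
    qed
  qed
  then show ?thesis
    unfolding R.basis_def using span_basis_image basis_image_closed by blast
qed

lemma dim_cyclotomic: "R.fin_dim \<and> R.dim = (2 * (n - 1)) choose (n - 1)"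
proof
  have fin: "finite basis_image"
    using finite_basis_index by simp
  then show "R.fin_dim"
    unfolding R.fin_dim_def using basis_basis_image unfolding R.basis_def by blast
  show "R.dim = (2 * (n - 1)) choose (n - 1)"
    using R.dim_basis[OF fin basis_basis_image] card_image[OF inj_basis_image] card_basis_index[of n] n
    by simp
qed

end

theorem proposition15:
  fixes n :: nat
  assumes "n > 1"
  shows "vectorspace.fin_dim (class_ring :: 'k :: field ring) (cyclotomic_klr_algebra n) \<and>
    vectorspace.dim (class_ring :: 'k ring) (cyclotomic_klr_algebra n) = (2 * (n - 1)) choose (n - 1)"
  using dim_cyclotomic[OF assms] .

end
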